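(* Let $(X,\mathscr{B},\mu)$ be a probability space, $L_1\in\mathbb{N}\cup\{0\}$, $L_2\in\mathbb{N}$, and $T,R_1,\dots,R_{L_1},S,W:X\to X$ be measure preserving automorphisms. Suppose $\{R_1,\dots,R_{L_1},S,W\}$ generates a commutative group, and $S$ is weakly mixing. Let $p_1,\dots,p_{L_2}\in\mathbb{Q}[x]$ be pairwise essentially distinct integer polynomials, each having degree at least $2$. For any $f,h_i,g_j\in L^\infty(X,\mu)$ with $1\le i\le L_1$, $1\le j\le L_2$, satisfying $\int_Xg_j\,d\mu=0$ for some $1\le j\le L_2$, and for which $\mu_{f,T}\perp\mathcal{L}$, $$\lim_{N\to\infty}\frac1N\sum_{n=1}^N T^nf\left(\prod_{i=1}^{L_1}R_i^nh_i\right)\left(\prod_{j=1}^{L_2}S^{p_j(n)}W^ng_j\right)=0,$$ with convergence taking place in $L^2(X,\mu)$.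
   Context: $\mathbb{N}=\{1,2,\dots\}$; an empty product equals $1$. A polynomial $p\in\mathbb{Q}[x]$ is an integer polynomial if $p(x)\in\mathbb{Z}$ for every integer $x$. Integer polynomials $p$ and $q$ are essentially distinct if $p-q$ is not constant. A measure preserving automorphism $R$ of $(X,\mathscr{B},\mu)$ is an invertible bi-measurable map with $\mu(R^{-1}A)=\mu(A)=\mu(RA)$ for all $A\in\mathscr{B}$; it acts on functions by $Rf=f\circ R$. It is weakly mixing if $R\times R$ is ergodic on $(X\times X,\mathscr{B}\otimes\mathscr{B},\mu\times\mu)$. For $f\in L^2(X,\mu)$, the spectral measure $\mu_{f,R}$ is the positive measure on $[0,1]$ with $\widehat{\mu_{f,R}}(n)=\langle R^nf,f\rangle$ (Fourier coefficients). $\mathcal{L}$ is Lebesgue measure on $[0,1]$. *)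

theory Defs
  imports
    "HOL-Probability.Probability"
    "HOL-Computational_Algebra.Polynomial"
    "HOL-Algebra.Bij"
    "HOL-Algebra.Elementary_Groups"
begin

definition mp_automorphism :: "'a measure \<Rightarrow> ('a \<Rightarrow> 'a) \<Rightarrow> bool" where
  "mp_automorphism M R \<longleftrightarrow>
     bij_betw R (space M) (space M) \<and>
     R \<in> measurable M M \<and> inv_into (space M) R \<in> measurable M M \<and>
     (\<forall>A\<in>sets M. emeasure M (R -` A \<inter> space M) = emeasure M A \<and>
                 emeasure M (R ` A) = emeasure M A)"

definition aut_power :: "'a measure \<Rightarrow> ('a \<Rightarrow> 'a) \<Rightarrow> int \<Rightarrow> 'a \<Rightarrow> 'a" where
  "aut_power M R k =
     (if k \<ge> 0 then R ^^ nat k else inv_into (space M) R ^^ nat (- k))"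

definition koopman :: "'a measure \<Rightarrow> ('a \<Rightarrow> 'a) \<Rightarrow> int \<Rightarrow> ('a \<Rightarrow> complex) \<Rightarrow> 'a \<Rightarrow> complex" where
  "koopman M R k f = (\<lambda>x. f (aut_power M R k x))"

text \<open>The maps are restricted to \<^term>\<open>space M\<close> because the elements of
  \<^const>\<open>BijGroup\<close> are extensional; their values off the space are irrelevant.\<close>

definition generate_commutative_group :: "'a measure \<Rightarrow> ('a \<Rightarrow> 'a) set \<Rightarrow> bool" where
  "generate_commutative_group M F \<longleftrightarrow>
     comm_group (subgroup_generated (BijGroup (space M)) ((\<lambda>R. restrict R (space M)) ` F))"

definition ergodic :: "'a measure \<Rightarrow> ('a \<Rightarrow> 'a) \<Rightarrow> bool" where
  "ergodic M R \<longleftrightarrow> mp_automorphism M R \<and>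
     (\<forall>A\<in>sets M. R -` A \<inter> space M = A \<longrightarrow>
        emeasure M A = 0 \<or> emeasure M (space M - A) = 0)"

definition weakly_mixing :: "'a measure \<Rightarrow> ('a \<Rightarrow> 'a) \<Rightarrow> bool" where
  "weakly_mixing M R \<longleftrightarrow> mp_automorphism M R \<and> ergodic (M \<Otimes>\<^sub>M M) (map_prod R R)"

definition integer_polynomial :: "rat poly \<Rightarrow> bool" where
  "integer_polynomial p \<longleftrightarrow> (\<forall>x::int. poly p (of_int x) \<in> \<int>)"

definition essentially_distinct :: "rat poly \<Rightarrow> rat poly \<Rightarrow> bool" where
  "essentially_distinct p q \<longleftrightarrow> \<not> (\<exists>c. p - q = [:c:])"

text \<open>The floor only converts the type: it is applied to integer polynomials.\<close>

definition int_value :: "rat poly \<Rightarrow> nat \<Rightarrow> int" where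
  "int_value p n = \<lfloor>poly p (of_nat n)\<rfloor>"

definition L_infinity :: "'a measure \<Rightarrow> ('a \<Rightarrow> complex) set" where
  "L_infinity M = {f \<in> borel_measurable M. \<exists>C. AE x in M. cmod (f x) \<le> C}"

definition L_two :: "'a measure \<Rightarrow> ('a \<Rightarrow> complex) set" where
  "L_two M = {f \<in> borel_measurable M. integrable M (\<lambda>x. (cmod (f x))\<^sup>2)}"

definition L_two_inner :: "'a measure \<Rightarrow> ('a \<Rightarrow> complex) \<Rightarrow> ('a \<Rightarrow> complex) \<Rightarrow> complex" where
  "L_two_inner M f g = (\<integral>x. f x * cnj (g x) \<partial>M)"

definition L_two_norm :: "'a measure \<Rightarrow> ('a \<Rightarrow> complex) \<Rightarrow> real" where
  "L_two_norm M f = sqrt (\<integral>x. (cmod (f x))\<^sup>2 \<partial>M)"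

definition tendsto_L_two :: "'a measure \<Rightarrow> (nat \<Rightarrow> 'a \<Rightarrow> complex) \<Rightarrow> ('a \<Rightarrow> complex) \<Rightarrow> bool" where
  "tendsto_L_two M F f \<longleftrightarrow>
     (\<forall>N. F N \<in> L_two M) \<and> f \<in> L_two M \<and>
     (\<lambda>N. L_two_norm M (\<lambda>x. F N x - f x)) \<longlonglongrightarrow> 0"

definition lebesgue01 :: "real measure" where
  "lebesgue01 = restrict_space lborel {0..1}"

definition fourier_coeff :: "real measure \<Rightarrow> int \<Rightarrow> complex" where
  "fourier_coeff \<nu> n = (\<integral>t. cis (- 2 * pi * of_int n * t) \<partial>\<nu>)"

text \<open>A predicate rather than a function: the Fourier coefficients do not distinguish the
  endpoints of \<open>[0,1]\<close>, so they determine \<open>\<nu>\<close> only up to moving mass between \<open>0\<close> and \<open>1\<close>.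
  This does not affect singularity with respect to Lebesgue measure.\<close>

definition is_spectral_measure ::
  "'a measure \<Rightarrow> ('a \<Rightarrow> complex) \<Rightarrow> ('a \<Rightarrow> 'a) \<Rightarrow> real measure \<Rightarrow> bool" where
  "is_spectral_measure M f R \<nu> \<longleftrightarrow>
     finite_measure \<nu> \<and> sets \<nu> = sets lebesgue01 \<and>
     (\<forall>n::int. fourier_coeff \<nu> n = L_two_inner M (koopman M R n f) f)"

definition mutually_singular :: "'a measure \<Rightarrow> 'a measure \<Rightarrow> bool" where
  "mutually_singular \<mu> \<nu> \<longleftrightarrow>
     sets \<mu> = sets \<nu> \<and>
     (\<exists>A\<in>sets \<mu>. emeasure \<mu> A = 0 \<and> emeasure \<nu> (space \<nu> - A) = 0)"

end

theory Submission
  imports Defs "HOL-Library.Function_Algebras"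
begin

text \<open>
  Write the summand as \<open>T\<^sup>n f \<cdot> u\<^sub>n\<close>, where \<open>u\<^sub>n\<close> collects the factors coming from the
  commuting maps.  Nothing relates \<open>T\<close> to the other maps, so only two facts are available: the
  spectral measure \<open>\<nu>\<close> of \<open>f\<close> is singular, and for all but finitely many lags \<open>k\<close> the averages
  over \<open>n\<close> of \<open>\<langle>u\<^sub>n\<^sub>+\<^sub>k, u\<^sub>n\<rangle>\<close> tend to \<open>0\<close>.  These two facts suffice.  Since \<open>\<nu>\<close> is almost
  carried by a compact null set, there is a trigonometric polynomial \<open>P\<close> with coefficients
  \<open>c\<^sub>k\<close> which is close to \<open>1\<close> in \<open>L\<^sup>2(\<nu>)\<close> and has small norm in \<open>L\<^sup>2\<close> of Lebesgue measure, so
  \<open>\<Sum> |c\<^sub>k|\<^sup>2\<close> is small (\<open>singular_trig_poly_approx\<close>).  The first property says that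
  \<open>f\<close> is close to \<open>\<Sum> c\<^sub>k T\<^sup>k f\<close>.  Hence the average of \<open>T\<^sup>n f \<cdot> u\<^sub>n\<close> is close to that of
  \<open>T\<^sup>n f \<cdot> \<Sum> c\<^sub>k u\<^sub>n\<^sub>-\<^sub>k\<close>, whose norm is controlled, by the Cauchy--Schwarz inequality and the
  assumption on correlations, by \<open>\<Sum> |c\<^sub>k|\<^sup>2\<close> (\<open>weighted_van_der_corput\<close>,
  \<open>singular_spectrum_L2_null\<close>).  With \<open>t = 1\<close> in place of \<open>T\<^sup>n f\<close> and constant weights the same
  inequality is van der Corput's lemma.

  It remains to treat the correlations of \<open>u\<close>.  The correlation of \<open>u\<close> at lag \<open>k\<close> is the
  integral of a product of the same shape, with polynomials \<open>p\<^sub>j(n + k)\<close> and \<open>p\<^sub>j(n)\<close>; because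
  the degrees are at least \<open>2\<close>, these are pairwise essentially distinct for all but finitely many
  \<open>k\<close>.  As the maps commute and preserve
  the measure, the integral of such a product does not change when one of the linear iterates
  \<open>R\<^sub>i\<^sup>n\<close>, or the common iterate \<open>W\<^sup>n\<close> if there is no \<open>R\<^sub>i\<close>, is divided out of all factors.  So the correlations of a
  product with \<open>L + 1\<close> linear iterates are governed by averages with \<open>L\<close> linear iterates, and by van
  der Corput's lemma those are governed by their own correlations; the number of linear iterates
  decreases to \<open>0\<close> (\<open>mixed_prod_integral_tendsto\<close>, \<open>mixed_null\<close>).  What is left is
  an average of \<open>\<Prod> S\<^bsup>q(n)\<^esup> g\<^sub>q\<close> for the single weakly mixing map \<open>S\<close>.  Bergelson's theorem
  (\<open>polynomial_ergodic_theorem\<close>) says that it tends to \<open>\<Prod> \<integral> g\<^sub>q\<close>; it is proved by induction on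
  a weight of the family of polynomials, again with van der Corput's lemma.  The weak mixing
  hypothesis enters there through \<open>weakly_mixing_correlations_square\<close>: the correlations
  of a function of mean zero tend to \<open>0\<close> in the mean, which is the ergodic theorem for \<open>S \<times> S\<close>.
\<close>


section \<open>Averages of bounded sequences of functions\<close>

lemma real_tendsto_sandwich0:
  fixes f g :: "nat \<Rightarrow> real"
  assumes "\<And>n. 0 \<le> f n" "\<And>n. f n \<le> g n" "g \<longlonglongrightarrow> 0"
  shows "f \<longlonglongrightarrow> 0"
  by (rule tendsto_sandwich[OF _ _ tendsto_const assms(3)]) (auto simp: assms)

text \<open>Sequences are indexed by all integers, so that they can be shifted freely, but the
  averages run over \<open>1, \<dots>, N\<close>; the average with \<open>N = 0\<close> is \<open>0\<close>.\<close>

definition cesaro :: "nat \<Rightarrow> (int \<Rightarrow> complex) \<Rightarrow> complex" where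
  "cesaro N a = (\<Sum>n=1..N. a (int n)) / of_nat N"

lemma cesaro_diff: "cesaro N (\<lambda>n. a n - b n) = cesaro N a - cesaro N b"
  by (simp add: cesaro_def sum_subtractf diff_divide_distrib)

lemma cesaro_cmult: "cesaro N (\<lambda>n. c * a n) = c * cesaro N a"
  by (simp add: cesaro_def sum_distrib_left)

lemma cesaro_sum: "cesaro N (\<lambda>n. \<Sum>k\<in>K. a k n) = (\<Sum>k\<in>K. cesaro N (a k))"
  unfolding cesaro_def by (subst sum.swap) (simp add: sum_divide_distrib)

lemma cesaro_const: "N > 0 \<Longrightarrow> cesaro N (\<lambda>n. c) = c"
  by (simp add: cesaro_def)

lemma cesaro_cong: "(\<And>n. a n = b n) \<Longrightarrow> cesaro N a = cesaro N b"
  by (simp add: cesaro_def)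

lemma cesaro_cnj: "cesaro N (\<lambda>n. cnj (a n)) = cnj (cesaro N a)"
  by (simp add: cesaro_def)

lemma cesaro_bound:
  assumes "\<And>n. cmod (a n) \<le> C"
  shows "cmod (cesaro N a) \<le> C"
proof (cases "N = 0")
  case True
  then show ?thesis using assms[of 0] norm_ge_zero[of "a 0"] by (simp add: cesaro_def del: norm_ge_zero)
next
  case False
  have "cmod (\<Sum>n=1..N. a (int n)) \<le> (\<Sum>n=1..N. C)"
    by (intro order_trans[OF norm_sum] sum_mono assms)
  then show ?thesis using False by (simp add: cesaro_def norm_divide field_simps)
qed

lemma cesaro_shift_nat:
  assumes "\<And>n. cmod (a n) \<le> C"
  shows "cmod (cesaro N (\<lambda>n. a (n + int l)) - cesaro N a) \<le> 2 * C * l / N"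
proof (cases "N = 0")
  case True
  then show ?thesis by (simp add: cesaro_def)
next
  case N: False
  show ?thesis
  proof (induction l)
    case 0
    then show ?case by simp
  next
    case (Suc l)
    define b where "b = (\<lambda>n. a (n + int l))"
    have s: "(\<Sum>n=1..N. b (int n + 1)) - (\<Sum>n=1..N. b (int n)) = b (int N + 1) - b 1" for N
      by (induction N) (auto simp: algebra_simps)
    have "cesaro N (\<lambda>n. a (n + int (Suc l))) - cesaro N b = (b (int N + 1) - b 1) / of_nat N"
      unfolding s[symmetric] cesaro_def by (simp add: b_def diff_divide_distrib algebra_simps)
    moreover have "cmod (b (int N + 1) - b 1) \<le> 2 * C"
      using norm_triangle_ineq4[of "b (int N + 1)" "b 1"] assms[of "int N + 1 + int l"] assms[of "1 + int l"]
      by (simp add: b_def)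
    ultimately have "cmod (cesaro N (\<lambda>n. a (n + int (Suc l))) - cesaro N b) \<le> 2 * C / N"
      by (simp add: norm_divide divide_right_mono)
    with Suc.IH show ?case
      using norm_triangle_ineq[of "cesaro N (\<lambda>n. a (n + int (Suc l))) - cesaro N b" "cesaro N b - cesaro N a"]
      unfolding b_def by (simp add: add_divide_distrib algebra_simps)
  qed
qed

lemma cesaro_shift:
  assumes "\<And>n. cmod (a n) \<le> C"
  shows "cmod (cesaro N (\<lambda>n. a (n + l)) - cesaro N a) \<le> 2 * C * \<bar>l\<bar> / N"
proof (cases "l \<ge> 0")
  case True
  then show ?thesis using cesaro_shift_nat[of a C N "nat l"] assms by simp
next
  case False
  then show ?thesis
    using cesaro_shift_nat[of "\<lambda>n. a (n + l)" C N "nat (- l)"] assms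
    by (simp add: norm_minus_commute)
qed

lemma cesaro_square_le:
  "(cmod (cesaro N a))\<^sup>2 \<le> (\<Sum>n=1..N. (cmod (a (int n)))\<^sup>2) / real N"
proof (cases "N = 0")
  case True
  then show ?thesis by (simp add: cesaro_def)
next
  case False
  have "(cmod (\<Sum>n=1..N. a (int n)))\<^sup>2 \<le> (\<Sum>n=1..N. cmod (a (int n)))\<^sup>2"
    by (intro power_mono norm_sum) auto
  also have "\<dots> \<le> (\<Sum>n=1..N. (cmod (a (int n)))\<^sup>2) * N"
    using sum_squared_le_sum_of_squares[of "\<lambda>n. cmod (a (int n))" "{1..N}"] by simp
  finally show ?thesis using False
    by (simp add: cesaro_def norm_divide power_divide field_simps power2_eq_square)
qed

lemma borel_measurable_cnj [measurable (raw)]: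
  assumes "f \<in> borel_measurable M"
  shows "(\<lambda>x. cnj (f x)) \<in> borel_measurable M"
  by (rule measurable_compose[OF assms]) (intro borel_measurable_continuous_onI continuous_intros)

text \<open>Boundedness is required at every point of the space, not only almost everywhere: then shifts
  and products can be bounded pointwise, without exceptional sets.\<close>

definition bdd_by :: "'a measure \<Rightarrow> real \<Rightarrow> ('a \<Rightarrow> complex) \<Rightarrow> bool" where
  "bdd_by M C f \<longleftrightarrow> f \<in> borel_measurable M \<and> (\<forall>x\<in>space M. cmod (f x) \<le> C)"

definition bdd_fun :: "'a measure \<Rightarrow> ('a \<Rightarrow> complex) \<Rightarrow> bool" where
  "bdd_fun M f \<longleftrightarrow> (\<exists>C. bdd_by M C f)"

lemma bdd_byD: "bdd_by M C f \<Longrightarrow> x \<in> space M \<Longrightarrow> cmod (f x) \<le> C"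
  by (simp add: bdd_by_def)

lemma bdd_by_measurable: "bdd_by M C f \<Longrightarrow> f \<in> borel_measurable M"
  by (simp add: bdd_by_def)

lemma bdd_by_mono: "bdd_by M C f \<Longrightarrow> C \<le> C' \<Longrightarrow> bdd_by M C' f"
  by (force simp: bdd_by_def)

lemma bdd_by_mult:
  assumes "bdd_by M C f" "bdd_by M D g"
  shows "bdd_by M (C * D) (\<lambda>x. f x * g x)"
proof -
  have "cmod (f x * g x) \<le> C * D" if "x \<in> space M" for x
    unfolding norm_mult using bdd_byD[OF assms(1) that] bdd_byD[OF assms(2) that]
    by (intro mult_mono) (auto intro: order_trans[OF norm_ge_zero])
  then show ?thesis using assms by (auto simp: bdd_by_def)
qed

lemma bdd_by_cnj: "bdd_by M C f \<Longrightarrow> bdd_by M C (\<lambda>x. cnj (f x))"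
  by (auto simp: bdd_by_def)

lemma bdd_by_const: "bdd_by M (cmod c) (\<lambda>x. c)"
  by (simp add: bdd_by_def)

lemma bdd_by_add:
  assumes "bdd_by M C f" "bdd_by M D g"
  shows "bdd_by M (C + D) (\<lambda>x. f x + g x)"
  using assms unfolding bdd_by_def by (auto intro!: norm_triangle_mono)

lemma bdd_by_sum:
  assumes "\<And>k. k \<in> K \<Longrightarrow> bdd_by M (C k) (f k)"
  shows "bdd_by M (\<Sum>k\<in>K. C k) (\<lambda>x. \<Sum>k\<in>K. f k x)"
  using assms unfolding bdd_by_def
  by (auto intro!: borel_measurable_sum order_trans[OF norm_sum] sum_mono)

lemma bdd_by_cesaro:
  assumes "\<And>n. bdd_by M C (u n)"
  shows "bdd_by M C (\<lambda>x. cesaro N (\<lambda>n. u n x))"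
proof -
  have "(\<lambda>x. cesaro N (\<lambda>n. u n x)) \<in> borel_measurable M"
    unfolding cesaro_def by (intro borel_measurable_divide borel_measurable_sum bdd_by_measurable[OF assms]) auto
  then show ?thesis using assms unfolding bdd_by_def by (auto intro!: cesaro_bound)
qed

lemma bdd_funI: "bdd_by M C f \<Longrightarrow> bdd_fun M f"
  by (auto simp: bdd_fun_def)

lemma bdd_fun_measurable: "bdd_fun M f \<Longrightarrow> f \<in> borel_measurable M"
  by (auto simp: bdd_fun_def bdd_by_def)

lemma bdd_fun_mult: "bdd_fun M f \<Longrightarrow> bdd_fun M g \<Longrightarrow> bdd_fun M (\<lambda>x. f x * g x)"
  unfolding bdd_fun_def using bdd_by_mult by blast

lemma bdd_fun_add: "bdd_fun M f \<Longrightarrow> bdd_fun M g \<Longrightarrow> bdd_fun M (\<lambda>x. f x + g x)"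
  unfolding bdd_fun_def using bdd_by_add by blast

lemma bdd_fun_const: "bdd_fun M (\<lambda>x. c)"
  unfolding bdd_fun_def using bdd_by_const by blast

lemma bdd_fun_diff:
  assumes "bdd_fun M f" "bdd_fun M g" shows "bdd_fun M (\<lambda>x. f x - g x)"
  using bdd_fun_add[OF assms(1) bdd_fun_mult[OF bdd_fun_const[of _ "-1"] assms(2)]] by simp

lemma bdd_fun_cnj: "bdd_fun M f \<Longrightarrow> bdd_fun M (\<lambda>x. cnj (f x))"
  unfolding bdd_fun_def using bdd_by_cnj by blast

lemma bdd_by_prod:
  assumes "\<And>k. k \<in> K \<Longrightarrow> bdd_by M (C k) (f k)"
  shows "bdd_by M (\<Prod>k\<in>K. C k) (\<lambda>x. \<Prod>k\<in>K. f k x)"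
  using assms unfolding bdd_by_def
  by (auto intro!: borel_measurable_prod prod_mono simp: prod_norm[symmetric])

lemma bdd_fun_prod:
  assumes "\<And>k. k \<in> K \<Longrightarrow> bdd_fun M (f k)"
  shows "bdd_fun M (\<lambda>x. \<Prod>k\<in>K. f k x)"
proof -
  obtain C where "\<And>k. k \<in> K \<Longrightarrow> bdd_by M (C k) (f k)"
    using assms unfolding bdd_fun_def by metis
  from bdd_by_prod[OF this] show ?thesis by (rule bdd_funI)
qed

lemma integral_square_sum_expand:
  fixes f :: "'i \<Rightarrow> 'a \<Rightarrow> complex"
  assumes "\<And>k l. integrable M (\<lambda>x. f k x * cnj (f l x))"
  shows "complex_of_real (\<integral>x. (cmod (\<Sum>k\<in>K. c k * f k x))\<^sup>2 \<partial>M)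
    = (\<Sum>k\<in>K. \<Sum>l\<in>K. c k * cnj (c l) * (\<integral>x. f k x * cnj (f l x) \<partial>M))"
proof -
  have "complex_of_real (\<integral>x. (cmod (\<Sum>k\<in>K. c k * f k x))\<^sup>2 \<partial>M)
      = (\<integral>x. complex_of_real ((cmod (\<Sum>k\<in>K. c k * f k x))\<^sup>2) \<partial>M)"
    by (rule integral_complex_of_real[symmetric])
  also have "\<dots> = (\<integral>x. (\<Sum>k\<in>K. \<Sum>l\<in>K. (c k * cnj (c l)) * (f k x * cnj (f l x))) \<partial>M)"
    by (rule Bochner_Integration.integral_cong[OF refl])
       (simp only: complex_norm_square cnj_sum sum_product complex_cnj_mult mult_ac)
  also have "\<dots> = (\<Sum>k\<in>K. \<Sum>l\<in>K. c k * cnj (c l) * (\<integral>x. f k x * cnj (f l x) \<partial>M))"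
    by (simp add: assms)
  finally show ?thesis .
qed

context prob_space
begin

lemma bdd_by_nonneg: "bdd_by M C f \<Longrightarrow> 0 \<le> C"
  using not_empty norm_ge_zero order_trans unfolding bdd_by_def by blast

lemma integrable_bdd_by: "bdd_by M C f \<Longrightarrow> integrable M f"
  by (auto simp: bdd_by_def intro!: integrable_const_bound[where B=C])

lemma integrable_bdd_fun: "bdd_fun M f \<Longrightarrow> integrable M f"
  by (auto simp: bdd_fun_def intro: integrable_bdd_by)

lemma integrable_bdd_by_square: "bdd_by M C f \<Longrightarrow> integrable M (\<lambda>x. (cmod (f x))\<^sup>2)"
  by (rule integrable_const_bound[where B="C\<^sup>2"]) (auto simp: bdd_by_def intro!: power_mono)

lemma integrable_bdd_fun_square: "bdd_fun M f \<Longrightarrow> integrable M (\<lambda>x. (cmod (f x))\<^sup>2)"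
  by (auto simp: bdd_fun_def intro: integrable_bdd_by_square)

lemma integral_bdd_by_le:
  assumes "bdd_by M C f"
  shows "cmod (\<integral>x. f x \<partial>M) \<le> C"
proof -
  have "cmod (\<integral>x. f x \<partial>M) \<le> (\<integral>x. cmod (f x) \<partial>M)"
    by (rule integral_norm_bound)
  also have "\<dots> \<le> (\<integral>x. C \<partial>M)"
    using assms by (intro integral_mono integrable_norm integrable_bdd_by[OF assms]) (auto simp: bdd_byD)
  finally show ?thesis by (simp add: prob_space)
qed

lemma integral_bdd_by_square_le:
  assumes "bdd_by M C f"
  shows "(\<integral>x. (cmod (f x))\<^sup>2 \<partial>M) \<le> C\<^sup>2"
proof -
  have "(\<integral>x. (cmod (f x))\<^sup>2 \<partial>M) \<le> (\<integral>x. C\<^sup>2 \<partial>M)"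
    using assms by (intro integral_mono integrable_bdd_by_square[OF assms]) (auto simp: bdd_byD power_mono)
  then show ?thesis by (simp add: prob_space)
qed

text \<open>The Cauchy--Schwarz inequality for a bounded and a square integrable function.\<close>

lemma integral_mult_square_le:
  assumes "bdd_by M C f" "bdd_fun M g"
  shows "(cmod (\<integral>x. f x * g x \<partial>M))\<^sup>2 \<le> C\<^sup>2 * (\<integral>x. (cmod (g x))\<^sup>2 \<partial>M)"
proof -
  note g = integrable_bdd_fun[OF assms(2)] integrable_bdd_fun_square[OF assms(2)]
  have "cmod (\<integral>x. f x * g x \<partial>M) \<le> (\<integral>x. cmod (f x * g x) \<partial>M)"
    by (rule integral_norm_bound)
  also have "\<dots> \<le> (\<integral>x. C * cmod (g x) \<partial>M)"
    using assms bdd_fun_mult[OF bdd_funI[OF assms(1)] assms(2)]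
    by (intro integral_mono integrable_norm integrable_bdd_fun)
       (auto simp: norm_mult bdd_byD integrable_norm[OF g(1)] intro!: mult_right_mono)
  also have "\<dots> = C * (\<integral>x. cmod (g x) \<partial>M)" by simp
  finally have "(cmod (\<integral>x. f x * g x \<partial>M))\<^sup>2 \<le> (C * (\<integral>x. cmod (g x) \<partial>M))\<^sup>2"
    by (intro power_mono) auto
  also have "\<dots> = C\<^sup>2 * (\<integral>x. cmod (g x) \<partial>M)\<^sup>2" by (simp add: power_mult_distrib)
  also have "(\<integral>x. cmod (g x) \<partial>M)\<^sup>2 \<le> (\<integral>x. (cmod (g x))\<^sup>2 \<partial>M)"
    using variance_positive[of "\<lambda>x. cmod (g x)"] variance_eq[of "\<lambda>x. cmod (g x)"] g by simp
  finally show ?thesis by (simp add: mult_left_mono)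
qed

lemma integral_cesaro:
  assumes "\<And>n. bdd_by M C (u n)"
  shows "(\<integral>x. cesaro N (\<lambda>n. u n x) \<partial>M) = cesaro N (\<lambda>n. \<integral>x. u n x \<partial>M)"
  unfolding cesaro_def
  by (subst integral_divide_zero, subst Bochner_Integration.integral_sum)
     (auto intro!: integrable_bdd_by[OF assms])

text \<open>Convergence to \<open>0\<close> in \<open>L\<^sup>2\<close>, expressed by the squares of the norms.\<close>

definition L2_null :: "(nat \<Rightarrow> 'a \<Rightarrow> complex) \<Rightarrow> bool" where
  "L2_null F \<longleftrightarrow> (\<lambda>N. \<integral>x. (cmod (F N x))\<^sup>2 \<partial>M) \<longlonglongrightarrow> 0"

lemma L2_null_integral_mult:
  assumes "bdd_fun M f" "\<And>N. bdd_fun M (F N)" "L2_null F"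
  shows "(\<lambda>N. \<integral>x. f x * F N x \<partial>M) \<longlonglongrightarrow> 0"
proof -
  obtain C where C: "bdd_by M C f" using assms(1) by (auto simp: bdd_fun_def)
  have 1: "(\<lambda>N. C\<^sup>2 * (\<integral>x. (cmod (F N x))\<^sup>2 \<partial>M)) \<longlonglongrightarrow> 0"
    using tendsto_mult_left[OF assms(3)[unfolded L2_null_def], of "C\<^sup>2"] by simp
  have "(\<lambda>N. (cmod (\<integral>x. f x * F N x \<partial>M))\<^sup>2) \<longlonglongrightarrow> 0"
    by (rule real_tendsto_sandwich0[OF _ integral_mult_square_le[OF C assms(2)] 1]) simp
  from tendsto_real_sqrt[OF this] have "(\<lambda>N. cmod (\<integral>x. f x * F N x \<partial>M)) \<longlonglongrightarrow> 0" by simp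
  then show ?thesis by (simp add: tendsto_norm_zero_iff)
qed

lemma L2_null_add:
  assumes "\<And>N. bdd_fun M (F N)" "\<And>N. bdd_fun M (G N)" "L2_null F" "L2_null G"
  shows "L2_null (\<lambda>N x. F N x + G N x)"
  unfolding L2_null_def
proof (rule real_tendsto_sandwich0)
  have *: "(cmod (a + b))\<^sup>2 \<le> 2 * (cmod a)\<^sup>2 + 2 * (cmod b)\<^sup>2" for a b
  proof -
    have "(cmod (a + b))\<^sup>2 \<le> (cmod a + cmod b)\<^sup>2" by (intro power_mono norm_triangle_ineq) auto
    also have "\<dots> \<le> 2 * (cmod a)\<^sup>2 + 2 * (cmod b)\<^sup>2"
      using sum_squares_bound[of "cmod a" "cmod b"] by (simp add: power2_eq_square algebra_simps)
    finally show ?thesis .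
  qed
  have "(\<integral>x. (cmod (F N x + G N x))\<^sup>2 \<partial>M)
     \<le> (\<integral>x. 2 * (cmod (F N x))\<^sup>2 + 2 * (cmod (G N x))\<^sup>2 \<partial>M)" for N
    by (intro integral_mono * Bochner_Integration.integrable_add integrable_mult_right
       integrable_bdd_fun_square bdd_fun_add assms)
  also have "(\<integral>x. 2 * (cmod (F N x))\<^sup>2 + 2 * (cmod (G N x))\<^sup>2 \<partial>M) = 2 * (\<integral>x. (cmod (F N x))\<^sup>2 \<partial>M) + 2 * (\<integral>x. (cmod (G N x))\<^sup>2 \<partial>M)" for N
    by (subst Bochner_Integration.integral_add)
       (auto intro!: integrable_bdd_fun_square assms)
  finally show "(\<integral>x. (cmod (F N x + G N x))\<^sup>2 \<partial>M)
      \<le> 2 * (\<integral>x. (cmod (F N x))\<^sup>2 \<partial>M) + 2 * (\<integral>x. (cmod (G N x))\<^sup>2 \<partial>M)" for N .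
  show "(\<lambda>N. 2 * (\<integral>x. (cmod (F N x))\<^sup>2 \<partial>M) + 2 * (\<integral>x. (cmod (G N x))\<^sup>2 \<partial>M)) \<longlonglongrightarrow> 0"
    using tendsto_add[OF tendsto_mult[OF tendsto_const[of 2] assms(3)[unfolded L2_null_def]]
        tendsto_mult[OF tendsto_const[of 2] assms(4)[unfolded L2_null_def]]] by simp
qed simp

end

section \<open>Van der Corput's inequality and its weighted form\<close>

lemma div_eventually_small:
  fixes D e :: real
  assumes "e > 0"
  shows "\<forall>\<^sub>F N in sequentially. D / real N < e"
proof -
  have "(\<lambda>N. D / real N) \<longlonglongrightarrow> 0" by (rule lim_const_over_n)
  from order_tendstoD(2)[OF this assms] show ?thesis .
qed

lemma square_sum3_le: "(cmod (a + b + c))\<^sup>2 \<le> 3 * ((cmod a)\<^sup>2 + (cmod b)\<^sup>2 + (cmod c)\<^sup>2)"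
proof -
  have "(cmod (a + b + c))\<^sup>2 \<le> (cmod a + cmod b + cmod c)\<^sup>2"
    by (intro power_mono order_trans[OF norm_triangle_ineq] add_right_mono norm_triangle_ineq) simp
  also have "\<dots> \<le> 3 * ((cmod a)\<^sup>2 + (cmod b)\<^sup>2 + (cmod c)\<^sup>2)"
    using sum_squares_bound[of "cmod a" "cmod b"] sum_squares_bound[of "cmod a" "cmod c"]
      sum_squares_bound[of "cmod b" "cmod c"]
    by (simp add: power2_eq_square algebra_simps)
  finally show ?thesis .
qed

context prob_space
begin

text \<open>A sequence of measurable functions with a common bound.\<close>

definition seq_bdd :: "real \<Rightarrow> (int \<Rightarrow> 'a \<Rightarrow> complex) \<Rightarrow> bool" where
  "seq_bdd C u \<longleftrightarrow> (\<forall>n. bdd_by M C (u n))"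

text \<open>The average of the inner products of \<open>u (n + h)\<close> and \<open>u n\<close> over \<open>n = 1, \<dots>, N\<close>.\<close>

definition correl :: "(int \<Rightarrow> 'a \<Rightarrow> complex) \<Rightarrow> int \<Rightarrow> nat \<Rightarrow> complex" where
  "correl u h N = cesaro N (\<lambda>n. \<integral>x. u (n + h) x * cnj (u n x) \<partial>M)"

text \<open>An upper bound for the limit superior, over \<open>N\<close>, of the modulus of the correlation at
  lag \<open>h\<close>.\<close>

definition correl_le :: "(int \<Rightarrow> 'a \<Rightarrow> complex) \<Rightarrow> int \<Rightarrow> real \<Rightarrow> bool" where
  "correl_le u h b \<longleftrightarrow> (\<forall>e>0. \<forall>\<^sub>F N in sequentially. cmod (correl u h N) \<le> b + e)"

lemma correl_leI_tendsto:
  assumes "correl u h \<longlonglongrightarrow> c" "cmod c \<le> b"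
  shows "correl_le u h b"
  unfolding correl_le_def
proof (intro allI impI)
  fix e :: real assume "e > 0"
  then have "\<forall>\<^sub>F N in sequentially. cmod (correl u h N) < b + e"
    using assms(2) by (intro order_tendstoD(2)[OF tendsto_norm[OF assms(1)]]) linarith
  then show "\<forall>\<^sub>F N in sequentially. cmod (correl u h N) \<le> b + e"
    by eventually_elim simp
qed

lemma seq_bddD: "seq_bdd C u \<Longrightarrow> bdd_by M C (u n)"
  by (simp add: seq_bdd_def)

lemma correl_integrand_bdd: "seq_bdd C u \<Longrightarrow> bdd_by M (C * C) (\<lambda>x. u k x * cnj (u l x))"
  by (intro bdd_by_mult bdd_by_cnj seq_bddD)

lemma correl_bound: "seq_bdd C u \<Longrightarrow> cmod (correl u h N) \<le> C * C"
  unfolding correl_def by (intro cesaro_bound integral_bdd_by_le correl_integrand_bdd)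

lemma correl_le_trivial: "seq_bdd C u \<Longrightarrow> correl_le u h (C * C)"
  unfolding correl_le_def
  by (auto intro!: always_eventually intro: order_trans[OF correl_bound])

lemma correl_le_shift:
  assumes "seq_bdd C u" "correl_le u (k - l) b" "e > 0"
  shows "\<forall>\<^sub>F N in sequentially.
           cmod (cesaro N (\<lambda>n. \<integral>x. u (n + k) x * cnj (u (n + l) x) \<partial>M)) \<le> b + e"
proof -
  define a where "a = (\<lambda>n. \<integral>x. u (n + (k - l)) x * cnj (u n x) \<partial>M)"
  have bd: "cmod (a n) \<le> C * C" for n
    unfolding a_def by (intro integral_bdd_by_le correl_integrand_bdd assms(1))
  have "\<forall>\<^sub>F N in sequentially. cmod (correl u (k - l) N) \<le> b + e / 2"
    using assms(2,3) by (auto simp: correl_le_def)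
  moreover have "\<forall>\<^sub>F N in sequentially. 2 * (C * C) * \<bar>l\<bar> / real N < e / 2"
    using assms(3) by (intro div_eventually_small) simp
  ultimately show ?thesis
  proof eventually_elim
    case (elim N)
    have "cmod (cesaro N (\<lambda>n. a (n + l)) - cesaro N a) \<le> 2 * (C * C) * \<bar>l\<bar> / N"
      by (rule cesaro_shift[OF bd])
    then have "cmod (cesaro N (\<lambda>n. a (n + l))) \<le> cmod (cesaro N a) + 2 * (C * C) * \<bar>l\<bar> / N"
      using norm_triangle_ineq2[of "cesaro N (\<lambda>n. a (n + l))" "cesaro N a"] by linarith
    moreover have "cmod (cesaro N a) \<le> b + e / 2"
      using elim(1) by (simp add: a_def correl_def)
    ultimately have "cmod (cesaro N (\<lambda>n. a (n + l))) \<le> b + e"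
      using elim(2) by simp
    then show ?case by (simp add: a_def add.assoc)
  qed
qed

lemma correl_le_uminus:
  assumes "seq_bdd C u" "correl_le u h b"
  shows "correl_le u (- h) b"
  unfolding correl_le_def
proof (intro allI impI)
  fix e :: real assume e: "e > 0"
  have "correl u (- h) N
      = cnj (cesaro N (\<lambda>n. \<integral>x. u (n + 0) x * cnj (u (n + - h) x) \<partial>M))" for N
    unfolding correl_def cesaro_cnj[symmetric] Bochner_Integration.integral_cnj[symmetric]
    by (intro cesaro_cong) (simp add: mult.commute)
  with correl_le_shift[OF assms(1), of 0 "- h" b e] assms(2) e
  show "\<forall>\<^sub>F N in sequentially. cmod (correl u (- h) N) \<le> b + e"
    by simp
qed

text \<open>The mean square of a combination of shifts of \<open>u\<close> is, in the limit, at most a quadratic form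
  in the moduli of the coefficients with entries bounding the correlations of \<open>u\<close>.\<close>

lemma gram_bound:
  assumes u: "seq_bdd C u" and K: "finite K"
    and corr: "\<And>h. correl_le u h (\<beta> h)" and e: "e > 0"
  shows "\<forall>\<^sub>F N in sequentially.
    (\<Sum>n=1..N. \<integral>x. (cmod (\<Sum>k\<in>K. c k * u (int n - k) x))\<^sup>2 \<partial>M) / real N
      \<le> (\<Sum>k\<in>K. \<Sum>l\<in>K. cmod (c k) * cmod (c l) * \<beta> (l - k)) + e"
proof -
  define S where "S = (\<Sum>k\<in>K. \<Sum>l\<in>K. cmod (c k) * cmod (c l))"
  have S: "S \<ge> 0" unfolding S_def by (intro sum_nonneg) simp
  define e' where "e' = e / (S + 1)"
  have e': "e' > 0" using e S by (simp add: e'_def)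
  define a where "a = (\<lambda>k l n. \<integral>x. u (n - k) x * cnj (u (n - l) x) \<partial>M)"
  have "\<forall>\<^sub>F N in sequentially. cmod (cesaro N (a k l)) \<le> \<beta> (l - k) + e'" for k l
    using correl_le_shift[OF u _ e', of "- k" "- l" "\<beta> (l - k)"] corr[of "l - k"]
    by (simp add: a_def)
  then have "\<forall>\<^sub>F N in sequentially. \<forall>k\<in>K. \<forall>l\<in>K. cmod (cesaro N (a k l)) \<le> \<beta> (l - k) + e'"
    using K by (simp add: eventually_ball_finite)
  then show ?thesis
  proof eventually_elim
    case (elim N)
    have 1: "complex_of_real (\<integral>x. (cmod (\<Sum>k\<in>K. c k * u (n - k) x))\<^sup>2 \<partial>M)
        = (\<Sum>k\<in>K. \<Sum>l\<in>K. c k * cnj (c l) * a k l n)" for n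
      unfolding a_def
      by (rule integral_square_sum_expand) (rule integrable_bdd_by[OF correl_integrand_bdd[OF u]])
    have "complex_of_real ((\<Sum>n=1..N. \<integral>x. (cmod (\<Sum>k\<in>K. c k * u (int n - k) x))\<^sup>2 \<partial>M) / real N)
       = cesaro N (\<lambda>n. complex_of_real (\<integral>x. (cmod (\<Sum>k\<in>K. c k * u (n - k) x))\<^sup>2 \<partial>M))"
      by (simp add: cesaro_def)
    also have "\<dots> = (\<Sum>k\<in>K. \<Sum>l\<in>K. c k * cnj (c l) * cesaro N (a k l))"
      unfolding 1 by (simp only: cesaro_sum cesaro_cmult)
    finally have eq: "complex_of_real ((\<Sum>n=1..N. \<integral>x. (cmod (\<Sum>k\<in>K. c k * u (int n - k) x))\<^sup>2 \<partial>M) / real N)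
       = (\<Sum>k\<in>K. \<Sum>l\<in>K. c k * cnj (c l) * cesaro N (a k l))" .
    have "(\<Sum>n=1..N. \<integral>x. (cmod (\<Sum>k\<in>K. c k * u (int n - k) x))\<^sup>2 \<partial>M) / real N
       \<le> cmod (complex_of_real ((\<Sum>n=1..N. \<integral>x. (cmod (\<Sum>k\<in>K. c k * u (int n - k) x))\<^sup>2 \<partial>M) / real N))"
      by (subst norm_of_real) (rule abs_ge_self)
    also have "\<dots> = cmod (\<Sum>k\<in>K. \<Sum>l\<in>K. c k * cnj (c l) * cesaro N (a k l))"
      unfolding eq ..
    also have "\<dots> \<le> (\<Sum>k\<in>K. \<Sum>l\<in>K. cmod (c k) * cmod (c l) * (\<beta> (l - k) + e'))"
    proof (intro order_trans[OF norm_sum] sum_mono)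
      fix k l assume "k \<in> K" "l \<in> K"
      then have "cmod (cesaro N (a k l)) \<le> \<beta> (l - k) + e'" using elim by blast
      then show "cmod (c k * cnj (c l) * cesaro N (a k l)) \<le> cmod (c k) * cmod (c l) * (\<beta> (l - k) + e')"
        by (simp add: norm_mult mult_left_mono)
    qed
    also have "\<dots> = (\<Sum>k\<in>K. \<Sum>l\<in>K. cmod (c k) * cmod (c l) * \<beta> (l - k)) + S * e'"
      by (simp add: S_def distrib_left sum.distrib sum_distrib_right)
    also have "S * e' \<le> e"
      using S e by (simp add: e'_def field_simps)
    finally show ?case by simp
  qed
qed

lemma integral_cesaro_square_le:
  assumes t: "seq_bdd B t" and v: "\<And>n. bdd_by M C (v n)"
  shows "(\<integral>x. (cmod (cesaro N (\<lambda>n. t n x * v n x)))\<^sup>2 \<partial>M)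
    \<le> B\<^sup>2 * ((\<Sum>n=1..N. \<integral>x. (cmod (v (int n) x))\<^sup>2 \<partial>M) / real N)"
proof -
  have "(\<integral>x. (cmod (cesaro N (\<lambda>n. t n x * v n x)))\<^sup>2 \<partial>M)
      \<le> (\<integral>x. (\<Sum>n=1..N. B\<^sup>2 * (cmod (v (int n) x))\<^sup>2) / real N \<partial>M)"
  proof (rule integral_mono)
    show "integrable M (\<lambda>x. (cmod (cesaro N (\<lambda>n. t n x * v n x)))\<^sup>2)"
      by (rule integrable_bdd_by_square[OF bdd_by_cesaro[OF bdd_by_mult[OF seq_bddD[OF t] v]]])
    show "integrable M (\<lambda>x. (\<Sum>n=1..N. B\<^sup>2 * (cmod (v (int n) x))\<^sup>2) / real N)"
      by (intro integrable_divide Bochner_Integration.integrable_sum integrable_mult_right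
          integrable_bdd_by_square[OF v])
    fix x assume x: "x \<in> space M"
    have "(cmod (cesaro N (\<lambda>n. t n x * v n x)))\<^sup>2
        \<le> (\<Sum>n=1..N. (cmod (t (int n) x * v (int n) x))\<^sup>2) / real N"
      by (rule cesaro_square_le)
    also have "\<dots> \<le> (\<Sum>n=1..N. B\<^sup>2 * (cmod (v (int n) x))\<^sup>2) / real N"
      using bdd_byD[OF seq_bddD[OF t] x]
      by (intro divide_right_mono sum_mono)
         (auto simp: norm_mult power_mult_distrib intro!: mult_right_mono power_mono)
    finally show "(cmod (cesaro N (\<lambda>n. t n x * v n x)))\<^sup>2
        \<le> (\<Sum>n=1..N. B\<^sup>2 * (cmod (v (int n) x))\<^sup>2) / real N" .
  qed
  also have "\<dots> = B\<^sup>2 * ((\<Sum>n=1..N. \<integral>x. (cmod (v (int n) x))\<^sup>2 \<partial>M) / real N)"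
    by (simp add: Bochner_Integration.integral_sum integrable_bdd_by_square[OF v] sum_distrib_left)
  finally show ?thesis .
qed

text \<open>If \<open>t\<close> is nearly reproduced by a combination \<open>\<Sum> c k * t (n + k)\<close> of its shifts, then
  in an average of \<open>t n * u n\<close> these shifts can be moved over to \<open>u\<close>; what
  remains is controlled by the correlations of \<open>u\<close>.\<close>

lemma weighted_van_der_corput:
  assumes t: "seq_bdd B t" and u: "seq_bdd C u" and K: "finite K"
    and approx: "\<And>n. (\<integral>x. (cmod (t n x - (\<Sum>k\<in>K. c k * t (n + k) x)))\<^sup>2 \<partial>M) \<le> d"
    and corr: "\<And>h. correl_le u h (\<beta> h)" and e: "e > 0"
  shows "\<forall>\<^sub>F N in sequentially. (\<integral>x. (cmod (cesaro N (\<lambda>n. t n x * u n x)))\<^sup>2 \<partial>M)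
     \<le> 3 * (C\<^sup>2 * d + B\<^sup>2 * (\<Sum>k\<in>K. \<Sum>l\<in>K. cmod (c k) * cmod (c l) * \<beta> (l - k))) + e"
proof -
  note B = bdd_by_nonneg[OF seq_bddD[OF t, of 0]] and C = bdd_by_nonneg[OF seq_bddD[OF u, of 0]]
  define w where "w = (\<lambda>n x. t n x - (\<Sum>k\<in>K. c k * t (n + k) x))"
  define v where "v = (\<lambda>n x. \<Sum>k\<in>K. c k * u (n - k) x)"
  \<comment> \<open>\<open>X1\<close> is the error of the approximation of \<open>t\<close>, \<open>X2\<close> collects the boundary terms that arise
    when the shifts are moved from \<open>t\<close> to \<open>u\<close>, and \<open>X3\<close> is the main term.\<close>
  define X1 where "X1 = (\<lambda>N x. cesaro N (\<lambda>n. w n x * u n x))"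
  define X2 where "X2 = (\<lambda>N x. \<Sum>k\<in>K. c k * (cesaro N (\<lambda>n. t (n + k) x * u n x)
      - cesaro N (\<lambda>n. t n x * u (n - k) x)))"
  define X3 where "X3 = (\<lambda>N x. cesaro N (\<lambda>n. t n x * v n x))"
  define V where "V = (\<Sum>k\<in>K. \<Sum>l\<in>K. cmod (c k) * cmod (c l) * \<beta> (l - k))"
  have split: "cesaro N (\<lambda>n. t n x * u n x) = X1 N x + X2 N x + X3 N x" for N x
  proof -
    have "X1 N x = cesaro N (\<lambda>n. t n x * u n x) - (\<Sum>k\<in>K. c k * cesaro N (\<lambda>n. t (n + k) x * u n x))"
      unfolding X1_def w_def left_diff_distrib cesaro_diff sum_distrib_right mult.assoc cesaro_sum cesaro_cmult ..
    moreover have "X3 N x = (\<Sum>k\<in>K. c k * cesaro N (\<lambda>n. t n x * u (n - k) x))"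
      unfolding X3_def v_def sum_distrib_left mult.left_commute[of "t _ _"] cesaro_sum cesaro_cmult ..
    ultimately show ?thesis
      by (simp add: X2_def right_diff_distrib sum_subtractf)
  qed
  define cs where "cs = (\<Sum>k\<in>K. cmod (c k))"
  have wb: "bdd_by M (B + 1 * (\<Sum>k\<in>K. cmod (c k) * B)) (w n)" for n
  proof -
    have "bdd_by M (\<Sum>k\<in>K. cmod (c k) * B) (\<lambda>x. \<Sum>k\<in>K. c k * t (n + k) x)"
      by (intro bdd_by_sum bdd_by_mult bdd_by_const seq_bddD t)
    from bdd_by_add[OF seq_bddD[OF t] bdd_by_mult[OF bdd_by_const[of M "-1"] this]]
    show ?thesis by (simp add: w_def)
  qed
  have vb: "bdd_by M (\<Sum>k\<in>K. cmod (c k) * C) (v n)" for n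
    unfolding v_def by (intro bdd_by_sum bdd_by_mult bdd_by_const seq_bddD u)
  have X1b: "bdd_fun M (X1 N)" for N
    unfolding X1_def by (rule bdd_funI[OF bdd_by_cesaro[OF bdd_by_mult[OF wb seq_bddD[OF u]]]])
  have X3b: "bdd_fun M (X3 N)" for N
    unfolding X3_def by (rule bdd_funI[OF bdd_by_cesaro[OF bdd_by_mult[OF seq_bddD[OF t] vb]]])
  have X12b: "bdd_fun M (\<lambda>x. cesaro N (\<lambda>n. t n x * u n x))" for N
    by (rule bdd_funI[OF bdd_by_cesaro[OF bdd_by_mult[OF seq_bddD[OF t] seq_bddD[OF u]]]])
  have "X2 N = (\<lambda>x. cesaro N (\<lambda>n. t n x * u n x) - (X1 N x + X3 N x))" for N
    by (rule ext) (simp add: split)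
  then have X2b: "bdd_fun M (X2 N)" for N
    by (simp add: bdd_fun_diff bdd_fun_add X12b X1b X3b)
  have int1: "(\<integral>x. (cmod (X1 N x))\<^sup>2 \<partial>M) \<le> C\<^sup>2 * d" if "N > 0" for N
  proof -
    have "(\<integral>x. (cmod (X1 N x))\<^sup>2 \<partial>M) \<le> C\<^sup>2 * ((\<Sum>n=1..N. \<integral>x. (cmod (w (int n) x))\<^sup>2 \<partial>M) / real N)"
      unfolding X1_def using integral_cesaro_square_le[OF u wb] by (simp only: mult.commute[of "w _ _"])
    also have "\<dots> \<le> C\<^sup>2 * ((\<Sum>n=1..N. d) / real N)"
      using approx by (intro divide_right_mono sum_mono mult_left_mono) (auto simp: w_def)
    finally show ?thesis using that by simp
  qed
  define D where "D = (\<Sum>k\<in>K. cmod (c k) * (2 * (B * C) * \<bar>k\<bar>))"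
  have D: "D \<ge> 0" unfolding D_def using B C by (intro sum_nonneg mult_nonneg_nonneg) auto
  have X2_le: "cmod (X2 N x) \<le> D / N" if x: "x \<in> space M" for N x
  proof -
    have "cmod (X2 N x) \<le> (\<Sum>k\<in>K. cmod (c k) * (2 * (B * C) * \<bar>k\<bar> / N))"
      unfolding X2_def
    proof (intro order_trans[OF norm_sum] sum_mono)
      fix k
      have "cmod (t n x * u (n - k) x) \<le> B * C" for n
        using bdd_byD[OF bdd_by_mult[OF seq_bddD[OF t] seq_bddD[OF u]] x] .
      from mult_left_mono[OF cesaro_shift[of "\<lambda>n. t n x * u (n - k) x", OF this, of N k], of "cmod (c k)"]
      show "cmod (c k * (cesaro N (\<lambda>n. t (n + k) x * u n x) - cesaro N (\<lambda>n. t n x * u (n - k) x)))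
          \<le> cmod (c k) * (2 * (B * C) * \<bar>k\<bar> / N)"
        by (simp add: norm_mult)
    qed
    then show ?thesis by (simp add: D_def sum_divide_distrib)
  qed
  have int2: "(\<integral>x. (cmod (X2 N x))\<^sup>2 \<partial>M) \<le> (D / N)\<^sup>2" for N
    using X2_le bdd_fun_measurable[OF X2b]
    by (intro integral_bdd_by_square_le) (simp add: bdd_by_def)
  have int3: "(\<integral>x. (cmod (X3 N x))\<^sup>2 \<partial>M) \<le> B\<^sup>2 * ((\<Sum>n=1..N. \<integral>x. (cmod (v (int n) x))\<^sup>2 \<partial>M) / real N)" for N
    unfolding X3_def by (rule integral_cesaro_square_le[OF t vb])
  define e1 where "e1 = e / (6 * (B\<^sup>2 + 1))"
  have e1: "e1 > 0" "6 * (B\<^sup>2 * e1) \<le> e"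
    using e by (auto simp: e1_def divide_simps add_pos_nonneg add_nonneg_pos)
  have "\<forall>\<^sub>F N in sequentially. (\<Sum>n=1..N. \<integral>x. (cmod (v (int n) x))\<^sup>2 \<partial>M) / real N \<le> V + e1"
    unfolding v_def V_def by (rule gram_bound[OF u K corr e1(1)])
  moreover have "\<forall>\<^sub>F N in sequentially. D / real N < sqrt (e / 6)"
    using e by (intro div_eventually_small) simp
  moreover have "\<forall>\<^sub>F N in sequentially. N > (0::nat)" by (rule eventually_gt_at_top)
  ultimately show ?thesis
  proof eventually_elim
    case (elim N)
    have "(\<integral>x. (cmod (cesaro N (\<lambda>n. t n x * u n x)))\<^sup>2 \<partial>M)
        \<le> (\<integral>x. 3 * ((cmod (X1 N x))\<^sup>2 + (cmod (X2 N x))\<^sup>2 + (cmod (X3 N x))\<^sup>2) \<partial>M)"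
    proof (rule integral_mono)
      show "integrable M (\<lambda>x. (cmod (cesaro N (\<lambda>n. t n x * u n x)))\<^sup>2)"
        by (rule integrable_bdd_fun_square[OF X12b])
      show "integrable M (\<lambda>x. 3 * ((cmod (X1 N x))\<^sup>2 + (cmod (X2 N x))\<^sup>2 + (cmod (X3 N x))\<^sup>2))"
        by (intro integrable_mult_right Bochner_Integration.integrable_add
           integrable_bdd_fun_square X1b X2b X3b)
    qed (unfold split, rule square_sum3_le)
    also have "\<dots> = 3 * ((\<integral>x. (cmod (X1 N x))\<^sup>2 \<partial>M) + (\<integral>x. (cmod (X2 N x))\<^sup>2 \<partial>M) + (\<integral>x. (cmod (X3 N x))\<^sup>2 \<partial>M))"
      using integrable_bdd_fun_square[OF X1b[of N]] integrable_bdd_fun_square[OF X2b[of N]]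
        integrable_bdd_fun_square[OF X3b[of N]]
      by (simp add: Bochner_Integration.integral_add)
    also have "\<dots> \<le> 3 * (C\<^sup>2 * d + e / 6 + B\<^sup>2 * (V + e1))"
    proof -
      have "(D / N)\<^sup>2 \<le> (sqrt (e / 6))\<^sup>2" using elim(2) D by (intro power_mono) auto
      then have "(\<integral>x. (cmod (X2 N x))\<^sup>2 \<partial>M) \<le> e / 6" using int2[of N] e by simp
      moreover have "(\<integral>x. (cmod (X3 N x))\<^sup>2 \<partial>M) \<le> B\<^sup>2 * (V + e1)"
        using int3[of N] mult_left_mono[OF elim(1), of "B\<^sup>2"] by simp
      ultimately show ?thesis using int1[OF elim(3)] by simp
    qed
    also have "\<dots> \<le> 3 * (C\<^sup>2 * d + B\<^sup>2 * V) + e"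
      using e1(2) by (simp add: algebra_simps)
    finally show ?case unfolding V_def .
  qed
qed

text \<open>Van der Corput's lemma is the case \<open>t = 1\<close> with constant weights \<open>1 / H\<close>.\<close>

lemma van_der_corput:
  assumes u: "seq_bdd C u"
    and corr: "\<And>h. correl_le u (int h) (\<beta> h)"
    and \<beta>0: "\<And>h. \<beta> h \<ge> 0"
    and \<beta>: "(\<lambda>H. (\<Sum>h<H. \<beta> h) / real H) \<longlonglongrightarrow> 0"
  shows "L2_null (\<lambda>N x. cesaro N (\<lambda>n. u n x))"
  unfolding L2_null_def
proof (rule LIMSEQ_I)
  fix e :: real assume e: "e > 0"
  have "\<forall>\<^sub>F H in sequentially. (\<Sum>h<H. \<beta> h) / real H < e / 24"
    using e by (intro order_tendstoD(2)[OF \<beta>]) simp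
  moreover have "\<forall>\<^sub>F H in sequentially. H > (0::nat)" by (rule eventually_gt_at_top)
  ultimately have "\<forall>\<^sub>F H in sequentially. (\<Sum>h<H. \<beta> h) / real H < e / 24 \<and> H > 0"
    by eventually_elim simp
  then obtain H :: nat where H: "(\<Sum>h<H. \<beta> h) / real H < e / 24" "H > 0"
    by (auto simp: eventually_sequentially)
  define K where "K = {0..<int H}"
  define c :: "int \<Rightarrow> complex" where "c = (\<lambda>k. 1 / of_nat H)"
  have corr': "correl_le u h (\<beta> (nat \<bar>h\<bar>))" for h
  proof (cases "h \<ge> 0")
    case False
    then show ?thesis using correl_le_uminus[OF u corr[of "nat (- h)"]] by simp
  qed (use corr[of "nat h"] in simp)
  have one: "seq_bdd 1 (\<lambda>n x. 1)" using bdd_by_const[of M 1] by (simp add: seq_bdd_def)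
  \<comment> \<open>Each value of \<open>\<bar>l - k\<bar>\<close> occurs for at most two \<open>l\<close>.\<close>
  have row: "(\<Sum>l\<in>K. \<beta> (nat \<bar>l - k\<bar>)) \<le> 2 * (\<Sum>h<H. \<beta> h)" if k: "k \<in> K" for k
  proof -
    have "(\<Sum>l\<in>K. \<beta> (nat \<bar>l - k\<bar>)) = (\<Sum>l\<in>{0..<k} \<union> {k..<int H}. \<beta> (nat \<bar>l - k\<bar>))"
      using k by (intro sum.cong) (auto simp: K_def)
    also have "\<dots> = (\<Sum>l\<in>{0..<k}. \<beta> (nat \<bar>l - k\<bar>)) + (\<Sum>l\<in>{k..<int H}. \<beta> (nat \<bar>l - k\<bar>))"
      by (rule sum.union_disjoint) auto
    also have "(\<Sum>l\<in>{0..<k}. \<beta> (nat \<bar>l - k\<bar>)) = (\<Sum>h\<in>(\<lambda>l. nat \<bar>l - k\<bar>) ` {0..<k}. \<beta> h)"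
      by (subst sum.reindex) (auto simp: inj_on_def)
    also have "\<dots> \<le> (\<Sum>h<H. \<beta> h)"
      using k by (intro sum_mono2) (auto simp: K_def \<beta>0)
    also have "(\<Sum>l\<in>{k..<int H}. \<beta> (nat \<bar>l - k\<bar>)) = (\<Sum>h\<in>(\<lambda>l. nat \<bar>l - k\<bar>) ` {k..<int H}. \<beta> h)"
      by (subst sum.reindex) (auto simp: inj_on_def)
    also have "\<dots> \<le> (\<Sum>h<H. \<beta> h)"
      using k by (intro sum_mono2) (auto simp: K_def \<beta>0)
    finally show ?thesis by simp
  qed
  have "(\<Sum>k\<in>K. \<Sum>l\<in>K. cmod (c k) * cmod (c l) * \<beta> (nat \<bar>l - k\<bar>))
      = (\<Sum>k\<in>K. \<Sum>l\<in>K. \<beta> (nat \<bar>l - k\<bar>)) / (real H)\<^sup>2"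
    by (simp add: c_def norm_divide sum_divide_distrib power2_eq_square)
  also have "\<dots> \<le> (\<Sum>k\<in>K. 2 * (\<Sum>h<H. \<beta> h)) / (real H)\<^sup>2"
    by (intro divide_right_mono sum_mono row) auto
  also have "\<dots> = 2 * ((\<Sum>h<H. \<beta> h) / real H)"
    by (simp add: K_def power2_eq_square)
  also have "\<dots> < e / 12" using H by linarith
  finally have V: "(\<Sum>k\<in>K. \<Sum>l\<in>K. cmod (c k) * cmod (c l) * \<beta> (nat \<bar>l - k\<bar>)) < e / 12" .
  have sc: "1 - (\<Sum>k\<in>K. c k * 1) = 0" using H(2) by (simp add: c_def K_def)
  have "\<forall>\<^sub>F N in sequentially. (\<integral>x. (cmod (cesaro N (\<lambda>n. 1 * u n x)))\<^sup>2 \<partial>M)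
     \<le> 3 * (C\<^sup>2 * 0 + 1\<^sup>2 * (\<Sum>k\<in>K. \<Sum>l\<in>K. cmod (c k) * cmod (c l) * \<beta> (nat \<bar>l - k\<bar>))) + e / 4"
    using e by (intro weighted_van_der_corput[OF one u _ _ corr']) (auto simp only: sc, auto simp: K_def)
  then have "\<forall>\<^sub>F N in sequentially. (\<integral>x. (cmod (cesaro N (\<lambda>n. u n x)))\<^sup>2 \<partial>M) < e"
  proof eventually_elim
    case (elim N)
    then show ?case using V e by simp
  qed
  then show "\<exists>no. \<forall>n\<ge>no. norm ((\<integral>x. (cmod (cesaro n (\<lambda>n. u n x)))\<^sup>2 \<partial>M) - 0) < e"
    by (simp add: eventually_sequentially)
qed

end

section \<open>Trigonometric polynomials and singular measures\<close>

text \<open>Laurent polynomials on the unit circle; the values elsewhere are irrelevant.\<close>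

definition trig_poly :: "(complex \<Rightarrow> complex) \<Rightarrow> bool" where
  "trig_poly f \<longleftrightarrow> (\<exists>K c. finite (K :: int set) \<and>
     (\<forall>z. cmod z = 1 \<longrightarrow> f z = (\<Sum>k\<in>K. c k * z powi k)))"

lemma trig_polyI:
  fixes m :: "'i \<Rightarrow> int"
  assumes "finite J" "\<And>z. cmod z = 1 \<Longrightarrow> f z = (\<Sum>j\<in>J. d j * z powi m j)"
  shows "trig_poly f"
  unfolding trig_poly_def
proof (intro exI conjI allI impI)
  show "finite (m ` J)" using assms(1) by simp
  fix z :: complex assume "cmod z = 1"
  then have "f z = (\<Sum>j\<in>J. d j * z powi m j)" by (rule assms(2))
  also have "\<dots> = (\<Sum>k\<in>m ` J. \<Sum>j\<in>{j \<in> J. m j = k}. d j * z powi m j)"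
    by (rule sum.image_gen[OF assms(1)])
  also have "\<dots> = (\<Sum>k\<in>m ` J. (\<Sum>j\<in>{j \<in> J. m j = k}. d j) * z powi k)"
    by (intro sum.cong refl) (simp add: sum_distrib_right)
  finally show "f z = (\<Sum>k\<in>m ` J. (\<Sum>j\<in>{j \<in> J. m j = k}. d j) * z powi k)" .
qed

lemma trig_poly_mult:
  assumes "trig_poly f" "trig_poly g"
  shows "trig_poly (\<lambda>z. f z * g z)"
proof -
  obtain K c L d where K: "finite K" "\<And>z. cmod z = 1 \<Longrightarrow> f z = (\<Sum>k\<in>K. c k * z powi k)"
    and L: "finite L" "\<And>z. cmod z = 1 \<Longrightarrow> g z = (\<Sum>k\<in>L. d k * z powi k)"
    using assms unfolding trig_poly_def by blast
  show ?thesis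
  proof (rule trig_polyI)
    show "finite (K \<times> L)" using K L by simp
    fix z :: complex assume z: "cmod z = 1"
    then have "z \<noteq> 0" by auto
    then show "f z * g z = (\<Sum>j\<in>K \<times> L. (c (fst j) * d (snd j)) * z powi (fst j + snd j))"
      unfolding K(2)[OF z] L(2)[OF z] sum_product sum.cartesian_product
      by (intro sum.cong refl) (auto simp: power_int_add mult_ac)
  qed
qed

lemma trig_poly_add:
  assumes "trig_poly f" "trig_poly g"
  shows "trig_poly (\<lambda>z. f z + g z)"
proof -
  obtain K c L d where K: "finite K" "\<And>z. cmod z = 1 \<Longrightarrow> f z = (\<Sum>k\<in>K. c k * z powi k)"
    and L: "finite L" "\<And>z. cmod z = 1 \<Longrightarrow> g z = (\<Sum>k\<in>L. d k * z powi k)"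
    using assms unfolding trig_poly_def by blast
  show ?thesis
  proof (rule trig_polyI)
    show "finite (K <+> L)" using K L by simp
    fix z :: complex assume z: "cmod z = 1"
    show "f z + g z = (\<Sum>j\<in>K <+> L. case_sum c d j * z powi (case_sum (\<lambda>k. k) (\<lambda>k. k) j))"
      unfolding K(2)[OF z] L(2)[OF z] by (subst sum.Plus) (auto simp: K L)
  qed
qed

lemma trig_poly_const: "trig_poly (\<lambda>z. c)"
  by (rule trig_polyI[of "{()}" _ "\<lambda>_. c" "\<lambda>_. 0"]) auto

lemma trig_poly_real_linear:
  assumes "bounded_linear (f :: complex \<Rightarrow> real)"
  shows "trig_poly (\<lambda>z. of_real (f z))"
proof (rule trig_polyI)
  interpret bounded_linear f by fact
  fix z :: complex assume z: "cmod z = 1"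
  have "f z = f (Re z *\<^sub>R 1 + Im z *\<^sub>R \<i>)"
    by (rule arg_cong[where f=f]) (simp add: complex_eq_iff)
  also have "\<dots> = Re z * f 1 + Im z * f \<i>" by (simp add: add scaleR)
  finally have 1: "complex_of_real (f z) = of_real (Re z) * of_real (f 1) + of_real (Im z) * of_real (f \<i>)"
    by simp
  have inv: "inverse z = cnj z" using z by (simp add: inverse_complex_def complex_eq_iff cmod_def)
  then have "z powi -1 = cnj z" by (simp add: power_int_minus)
  then have "(\<Sum>k\<in>{1, -1 :: int}. (of_real (f 1) / 2 + of_int k * of_real (f \<i>) / (2 * \<i>)) * z powi k)
      = of_real (f 1) * ((z + cnj z) / 2) + of_real (f \<i>) * ((z - cnj z) / (2 * \<i>))"
    by (simp add: algebra_simps add_divide_distrib diff_divide_distrib)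
  also have "(z + cnj z) / 2 = of_real (Re z)" by (simp add: complex_eq_iff)
  also have "(z - cnj z) / (2 * \<i>) = of_real (Im z)" by (simp add: complex_eq_iff Re_divide Im_divide power2_eq_square)
  finally show "complex_of_real (f z)
     = (\<Sum>k\<in>{1, -1 :: int}. (of_real (f 1) / 2 + of_int k * of_real (f \<i>) / (2 * \<i>)) * z powi k)"
    using 1 by (simp add: mult.commute)
qed auto

lemma trig_poly_real_polynomial_function:
  assumes "real_polynomial_function p"
  shows "trig_poly (\<lambda>z. of_real (p z))"
  using assms
  by (induction rule: real_polynomial_function.induct)
     (auto intro: trig_poly_real_linear trig_poly_const trig_poly_add trig_poly_mult)

text \<open>The sign makes the \<open>k\<close>-th Fourier coefficient of \<open>\<nu>\<close> the integral of
  \<open>circle_map t powi k\<close>.\<close>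

definition circle_map :: "real \<Rightarrow> complex" where
  "circle_map t = cis (- 2 * pi * t)"

lemma circle_map_norm [simp]: "cmod (circle_map t) = 1"
  by (simp add: circle_map_def)

lemma circle_map_powi: "circle_map t powi k = cis (- 2 * pi * of_int k * t)"
  by (simp add: circle_map_def cis_power_int mult_ac)

lemma continuous_circle_map [continuous_intros]: "continuous_on A circle_map"
  unfolding circle_map_def[abs_def] by (intro continuous_intros)

lemma borel_measurable_circle_map [measurable]: "circle_map \<in> borel_measurable borel"
  by (intro borel_measurable_continuous_onI continuous_intros)

lemma circle_map_eqD:
  assumes "circle_map s = circle_map t" "s \<in> {0..1}" "t \<in> {0..1}"
  shows "s = t \<or> s \<in> {0, 1}"
proof -
  have "sin (- 2 * pi * s) = sin (- 2 * pi * t)" "cos (- 2 * pi * s) = cos (- 2 * pi * t)"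
    using assms(1) by (simp_all add: circle_map_def complex_eq_iff)
  then obtain n :: int where "- 2 * pi * s = - 2 * pi * t + 2 * pi * n"
    using sin_cos_eq_iff[of "- 2 * pi * s" "- 2 * pi * t"] by auto
  then have "2 * pi * (t - s) = 2 * pi * n" by (simp add: algebra_simps)
  then have n: "t - s = n" by simp
  then have "of_int n \<le> (1::real)" "of_int n \<ge> (-1::real)" using assms by auto
  then have "n \<in> {-1, 0, 1}" by auto
  then show ?thesis using n assms by auto
qed

lemma space_lebesgue01 [simp]: "space lebesgue01 = {0..1}"
  by (simp add: lebesgue01_def space_restrict_space)

lemma sets_lebesgue01_iff: "A \<in> sets lebesgue01 \<longleftrightarrow> A \<subseteq> {0..1} \<and> A \<in> sets borel"
  by (simp add: lebesgue01_def sets_restrict_space_iff)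

lemma prob_space_lebesgue01: "prob_space lebesgue01"
  by (rule prob_spaceI) (simp add: lebesgue01_def space_restrict_space emeasure_restrict_space)

lemma measurable_lebesgue01: "f \<in> borel_measurable borel \<Longrightarrow> f \<in> borel_measurable lebesgue01"
  by (simp add: lebesgue01_def measurable_restrict_space1)

lemma integral_circle_map_powi:
  "(\<integral>t. circle_map t powi k \<partial>lebesgue01) = (if k = 0 then 1 else 0)"
proof (cases "k = 0")
  case True
  interpret prob_space lebesgue01 by (rule prob_space_lebesgue01)
  show ?thesis using True prob_space by simp
next
  case False
  define a where "a = - 2 * pi * of_int k"
  have a: "a \<noteq> 0" using False by (simp add: a_def)
  have "(\<integral>t. circle_map t powi k \<partial>lebesgue01) = (\<integral>t. indicator {0..1} t *\<^sub>R cis (a * t) \<partial>lborel)"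
    unfolding lebesgue01_def circle_map_powi a_def by (subst integral_restrict_space) simp_all
  also have "\<dots> = cis (a * 1) / (\<i> * of_real a) - cis (a * 0) / (\<i> * of_real a)"
  proof (rule integral_FTC_atLeastAtMost)
    show "continuous_on {0..1} (\<lambda>t. cis (a * t))" by (intro continuous_intros)
    fix t :: real
    have "((\<lambda>t. exp (\<i> * of_real a * of_real t) / (\<i> * of_real a)) has_vector_derivative
        (of_real 1 * (exp (\<i> * of_real a * of_real t) * (\<i> * of_real a)) / (\<i> * of_real a))) (at t within {0..1})"
      using a
      by (auto intro!: derivative_eq_intros has_vector_derivative_real_field)
    then show "((\<lambda>t. cis (a * t) / (\<i> * of_real a)) has_vector_derivative cis (a * t)) (at t within {0..1})"
      using a by (simp add: cis_conv_exp mult_ac)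
  qed simp
  also have "cis (a * 1) = 1"
  proof -
    have "cis (a * 1) = cis (2 * pi * of_int (- k))" by (simp add: a_def)
    then show ?thesis by (simp only: cis_multiple_2pi Ints_of_int)
  qed
  finally show ?thesis using False by simp
qed

lemma integrable_circle_map_powi:
  assumes "finite_measure \<nu>" "sets \<nu> = sets lebesgue01"
  shows "integrable \<nu> (\<lambda>t. circle_map t powi k)"
proof -
  interpret finite_measure \<nu> by fact
  show ?thesis
  proof (rule integrable_const_bound[where B=1])
    have "continuous_on UNIV (\<lambda>t. circle_map t powi k)"
      unfolding circle_map_powi by (intro continuous_intros)
    then have "(\<lambda>t. circle_map t powi k) \<in> borel_measurable lebesgue01"
      by (intro measurable_lebesgue01 borel_measurable_continuous_onI)
    then show "(\<lambda>t. circle_map t powi k) \<in> borel_measurable \<nu>"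
      using measurable_cong_sets[OF assms(2) refl] by blast
  qed (simp add: norm_power_int)
qed

lemma integral_trig_poly_square_expand:
  assumes "finite_measure \<nu>" "sets \<nu> = sets lebesgue01"
  shows "complex_of_real (\<integral>t. (cmod (\<Sum>k\<in>K. c k * circle_map t powi k))\<^sup>2 \<partial>\<nu>)
    = (\<Sum>k\<in>K. \<Sum>l\<in>K. (c k * cnj (c l)) * (\<integral>t. circle_map t powi (k - l) \<partial>\<nu>))"
proof -
  have eq: "circle_map t powi k * cnj (circle_map t powi l) = circle_map t powi (k - l)" for t k l
    by (simp add: circle_map_powi cis_cnj cis_mult algebra_simps)
  show ?thesis
    by (subst integral_square_sum_expand) (simp_all only: eq integrable_circle_map_powi[OF assms])
qed

lemma integral_trig_poly_square:
  assumes "finite K"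
  shows "(\<integral>t. (cmod (\<Sum>k\<in>K. c k * circle_map t powi k))\<^sup>2 \<partial>lebesgue01) = (\<Sum>k\<in>K. (cmod (c k))\<^sup>2)"
proof -
  interpret prob_space lebesgue01 by (rule prob_space_lebesgue01)
  have "complex_of_real (\<integral>t. (cmod (\<Sum>k\<in>K. c k * circle_map t powi k))\<^sup>2 \<partial>lebesgue01)
     = (\<Sum>k\<in>K. \<Sum>l\<in>K. (c k * cnj (c l)) * (if k = l then 1 else 0))"
    by (subst integral_trig_poly_square_expand) (simp_all add: finite_measure_axioms integral_circle_map_powi)
  also have "\<dots> = (\<Sum>k\<in>K. c k * cnj (c k))"
    using assms by (simp add: if_distrib cong: if_cong)
  also have "\<dots> = complex_of_real (\<Sum>k\<in>K. (cmod (c k))\<^sup>2)"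
    by (simp only: complex_norm_square of_real_sum)
  finally show ?thesis by (simp only: of_real_eq_iff)
qed

text \<open>A finite measure singular to Lebesgue measure is almost carried by a compact null set.\<close>

lemma singular_compact_carrier:
  assumes fin: "finite_measure \<nu>" and sets: "sets \<nu> = sets lebesgue01"
    and sing: "mutually_singular \<nu> lebesgue01" and e: "e > 0"
  obtains K where "compact K" "K \<subseteq> {0..1}" "measure \<nu> ({0..1} - K) \<le> e" "emeasure lebesgue01 K = 0"
proof -
  interpret finite_measure \<nu> by fact
  have sp: "space \<nu> = {0..1}" using sets_eq_imp_space_eq[OF sets] by simp
  obtain A where A: "A \<in> sets lebesgue01" "emeasure \<nu> A = 0" "emeasure lebesgue01 ({0..1} - A) = 0"
    using sing sets by (auto simp: mutually_singular_def)
  define B where "B = {0..1} - A"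
  have B: "B \<in> sets lebesgue01" "B \<in> sets borel" using A(1) by (auto simp: B_def sets_lebesgue01_iff)
  define \<nu>' where "\<nu>' = distr \<nu> borel (\<lambda>t. t)"
  have id: "(\<lambda>t. t) \<in> measurable \<nu> borel"
    using measurable_lebesgue01[of "\<lambda>t. t"] measurable_cong_sets[OF sets refl] by auto
  have \<nu>'[simp]: "emeasure \<nu>' C = emeasure \<nu> (C \<inter> {0..1})" if "C \<in> sets borel" for C
    using that id sp by (simp add: \<nu>'_def emeasure_distr)
  have Bsub: "B \<inter> {0..1} = B" by (auto simp: B_def)
  have "\<exists>K. compact K \<and> K \<subseteq> B \<and> emeasure \<nu> B \<le> emeasure \<nu> K + e"
  proof (cases "emeasure \<nu> B \<le> e")
    case True
    then show ?thesis by (intro exI[of _ "{}"]) simp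
  next
    case False
    have "emeasure \<nu>' B - ennreal e < emeasure \<nu>' B"
      using False e B Bsub emeasure_finite
      by (intro ennreal_between) (auto simp: less_top[symmetric] zero_less_iff_neq_zero dest: order_trans)
    also have "\<dots> = (SUP K\<in>{K. K \<subseteq> B \<and> compact K}. emeasure \<nu>' K)"
      by (rule inner_regular[OF _ _ B(2)]) (auto simp: \<nu>'_def emeasure_distr id emeasure_finite)
    finally obtain K where K: "K \<subseteq> B" "compact K" "emeasure \<nu>' B - ennreal e < emeasure \<nu>' K"
      by (auto simp: less_SUP_iff)
    have "K \<inter> {0..1} = K" using K(1) by (auto simp: B_def)
    then have "emeasure \<nu> B - ennreal e < emeasure \<nu> K"
      using K B Bsub by (simp add: borel_compact)
    then have "emeasure \<nu> B \<le> emeasure \<nu> K + e"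
      by (metis less_imp_le ennreal_minus_le_iff add.commute)
    then show ?thesis using K by blast
  qed
  then obtain K where K: "compact K" "K \<subseteq> B" "emeasure \<nu> B \<le> emeasure \<nu> K + e" by blast
  have K01: "K \<subseteq> {0..1}" using K(2) by (auto simp: B_def)
  have Ks: "K \<in> sets lebesgue01" using K(1) K01 by (simp add: sets_lebesgue01_iff borel_compact)
  have "ennreal (measure \<nu> B) \<le> ennreal (measure \<nu> K + e)"
    using K(3) e by (simp add: emeasure_eq_measure ennreal_plus)
  then have "measure \<nu> B \<le> measure \<nu> K + e" using e by (subst (asm) ennreal_le_iff) auto
  moreover have "measure \<nu> ({0..1} - K) = measure \<nu> A + measure \<nu> (B - K)"
  proof -
    have "{0..1} - K = A \<union> (B - K)" using K(2) A(1) by (auto simp: B_def sets_lebesgue01_iff)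
    then show ?thesis using A(1) B(1) Ks sets
      by (simp add: B_def) (subst finite_measure_Union, auto)
  qed
  moreover have "measure \<nu> A = 0" using A(2) by (simp add: measure_def)
  moreover have "measure \<nu> (B - K) = measure \<nu> B - measure \<nu> K"
    using K(2) B(1) Ks sets by (intro finite_measure_Diff) auto
  ultimately have "measure \<nu> ({0..1} - K) \<le> e" by simp
  moreover have "emeasure lebesgue01 K = 0"
    using emeasure_mono[OF K(2) B(1)] A(3) by (simp add: B_def)
  ultimately show ?thesis using that[OF K(1) K01] by blast
qed

text \<open>A continuous function on the circle that equals \<open>1\<close> on the image of a compact carrier and is
  supported near it is approximated uniformly by a trigonometric polynomial; by Parseval's identity
  the mean square of the latter is the square sum of its coefficients.\<close>

lemma singular_trig_poly_approx:
  assumes fin: "finite_measure \<nu>" and sets: "sets \<nu> = sets lebesgue01"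
    and sing: "mutually_singular \<nu> lebesgue01" and e: "e > 0"
  obtains K :: "int set" and c where "finite K"
    "(\<integral>t. (cmod (1 - (\<Sum>k\<in>K. c k * circle_map t powi k)))\<^sup>2 \<partial>\<nu>) \<le> e"
    "(\<Sum>k\<in>K. (cmod (c k))\<^sup>2) \<le> e"
proof -
  interpret \<nu>: finite_measure \<nu> by fact
  interpret L: prob_space lebesgue01 by (rule prob_space_lebesgue01)
  have sp: "space \<nu> = {0..1}" using sets_eq_imp_space_eq[OF sets] by simp
  have meas: "f \<in> borel_measurable \<nu>" if "f \<in> borel_measurable borel" for f :: "real \<Rightarrow> real"
    using measurable_lebesgue01[OF that] measurable_cong_sets[OF sets refl] by auto
  obtain K where K: "compact K" "K \<subseteq> {0..1}" "measure \<nu> ({0..1} - K) \<le> e / 8" "emeasure lebesgue01 K = 0"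
    using singular_compact_carrier[OF fin sets sing, of "e / 8"] e by auto
  have Ks: "K \<in> sets lebesgue01" using K(1,2) by (simp add: sets_lebesgue01_iff borel_compact)
  \<comment> \<open>The point \<open>1\<close>, whose preimage \<open>{0, 1}\<close> is null, makes \<open>C\<close> nonempty and accounts for the
    identification of the endpoints.\<close>
  define C where "C = insert 1 (circle_map ` K)"
  have C: "closed C" "C \<noteq> {}"
    using compact_continuous_image[OF continuous_circle_map K(1)]
    by (auto simp: C_def intro!: compact_imp_closed)
  define \<phi> where "\<phi> = (\<lambda>m z. max 0 (1 - real m * infdist z C))"
  have \<phi>01: "0 \<le> \<phi> m z" "\<phi> m z \<le> 1" for m z
    using infdist_nonneg[of z C] by (auto simp: \<phi>_def)
  have \<phi>cont: "continuous_on A (\<phi> m)" for A m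
    unfolding \<phi>_def by (intro continuous_intros)
  have \<phi>meas: "(\<lambda>t. \<phi> m (circle_map t)) \<in> borel_measurable borel" for m
    by (rule measurable_compose[OF borel_measurable_circle_map borel_measurable_continuous_onI[OF \<phi>cont]])
  have "(\<lambda>m. \<integral>t. (\<phi> m (circle_map t))\<^sup>2 \<partial>lebesgue01) \<longlonglongrightarrow> (\<integral>t. 0 \<partial>lebesgue01)"
  proof (rule integral_dominated_convergence[where w="\<lambda>_. 1"])
    have "emeasure lborel {0, 1 :: real} = 0" by (rule emeasure_lborel_countable) auto
    moreover have "{0, 1} \<in> sets lebesgue01" by (simp add: sets_lebesgue01_iff)
    ultimately have "{0, 1} \<in> null_sets lebesgue01"
      by (simp add: null_sets_def lebesgue01_def emeasure_restrict_space)
    moreover have "K \<in> null_sets lebesgue01" using Ks K(4) by auto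
    ultimately have "K \<union> {0, 1} \<in> null_sets lebesgue01" by blast
    then have "AE t in lebesgue01. t \<notin> K \<union> {0, 1}" by (rule AE_not_in)
    moreover have "AE t in lebesgue01. t \<in> {0..1}" using AE_space[of lebesgue01] by simp
    ultimately show "AE t in lebesgue01. (\<lambda>m. (\<phi> m (circle_map t))\<^sup>2) \<longlonglongrightarrow> 0"
    proof eventually_elim
      case (elim t)
      note True = elim(2)
        have "circle_map t \<noteq> 1"
          using circle_map_eqD[of t 0] True elim by (auto simp: circle_map_def)
        moreover have "circle_map t \<noteq> circle_map s" if "s \<in> K" for s
          using circle_map_eqD[of t s] True elim that K(2) by auto
        ultimately have "circle_map t \<notin> C" by (auto simp: C_def)
        then have d: "infdist (circle_map t) C > 0"
          using C infdist_pos_not_in_closed[of C "circle_map t"] by simp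
        obtain m0 :: nat where m0: "1 < real m0 * infdist (circle_map t) C"
          using reals_Archimedean3[OF d] by blast
        have "\<forall>\<^sub>F m in sequentially. (\<phi> m (circle_map t))\<^sup>2 = 0"
          using eventually_ge_at_top[of m0]
        proof eventually_elim
          case (elim m)
          have "real m0 * infdist (circle_map t) C \<le> real m * infdist (circle_map t) C"
            using elim d by (intro mult_right_mono) auto
          then show ?case using m0 by (simp add: \<phi>_def)
        qed
        then show ?case by (rule tendsto_eventually)
    qed
  qed (use \<phi>01 \<phi>meas in \<open>auto intro!: measurable_lebesgue01 simp: power_le_one\<close>)
  then have "(\<lambda>m. \<integral>t. (\<phi> m (circle_map t))\<^sup>2 \<partial>lebesgue01) \<longlonglongrightarrow> 0" by simp
  then have "\<forall>\<^sub>F m in sequentially. (\<integral>t. (\<phi> m (circle_map t))\<^sup>2 \<partial>lebesgue01) < e / 8"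
    using e by (intro order_tendstoD(2)) auto
  then obtain m where m: "(\<integral>t. (\<phi> m (circle_map t))\<^sup>2 \<partial>lebesgue01) < e / 8"
    by (auto simp: eventually_sequentially)
  define V where "V = measure \<nu> {0..1}"
  define \<eta> where "\<eta> = sqrt (e / (8 * (1 + V)))"
  have V: "V \<ge> 0" by (simp add: V_def)
  have "\<eta>\<^sup>2 = e / (8 * (1 + V))" using e V by (simp add: \<eta>_def)
  then have \<eta>: "\<eta> > 0" "\<eta>\<^sup>2 * (1 + V) = e / 8"
    using e V by (simp add: \<eta>_def, simp add: divide_simps, simp add: algebra_simps)
  have \<eta>2: "\<eta>\<^sup>2 \<le> e / 8" "\<eta>\<^sup>2 * V \<le> e / 8"
    using \<eta>(2) mult_nonneg_nonneg[OF zero_le_power2[of \<eta>] V] zero_le_power2[of \<eta>]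
    unfolding distrib_left by linarith+
  obtain p where p: "real_polynomial_function p" "\<And>z. z \<in> sphere 0 1 \<Longrightarrow> \<bar>\<phi> m z - p z\<bar> < \<eta>"
    using Stone_Weierstrass_real_polynomial_function[OF compact_sphere \<phi>cont \<eta>(1), of 0 1 m] by blast
  from trig_poly_real_polynomial_function[OF p(1)]
  obtain J c where J: "finite J" "\<And>z. cmod z = 1 \<Longrightarrow> complex_of_real (p z) = (\<Sum>k\<in>J. c k * z powi k)"
    unfolding trig_poly_def by blast
  have P: "(\<Sum>k\<in>J. c k * circle_map t powi k) = of_real (p (circle_map t))" for t
    by (simp add: J(2))
  have near: "\<bar>\<phi> m (circle_map t) - p (circle_map t)\<bar> < \<eta>" for t
    by (rule p(2)) simp
  have pmeas: "(\<lambda>t. p (circle_map t)) \<in> borel_measurable borel"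
    using p(1) by (intro measurable_compose[OF borel_measurable_circle_map] borel_measurable_continuous_onI
        continuous_on_polymonial_function) (simp add: real_polynomial_function_eq)
  have sq: "(a + b)\<^sup>2 \<le> 2 * a\<^sup>2 + 2 * b\<^sup>2" for a b :: real
    using sum_squares_bound[of a b] by (simp add: power2_eq_square algebra_simps)
  have sqn: "x\<^sup>2 \<le> 2 * y\<^sup>2 + 2 * \<eta>\<^sup>2" if "\<bar>x - y\<bar> < \<eta>" for x y :: real
  proof -
    have "(x - y)\<^sup>2 \<le> \<eta>\<^sup>2" using that by (intro abs_le_square_iff[THEN iffD1]) simp
    then show ?thesis using sq[of y "x - y"] by simp
  qed
  have "{0..1} - K \<in> sets \<nu>"
    using Ks sets.compl_sets[of K lebesgue01] by (simp add: sets)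
  then have ind: "integrable \<nu> (indicat_real ({0..1} - K))"
    by (intro integrable_real_indicator) (simp_all add: \<nu>.emeasure_finite less_top[symmetric])
  have "(\<integral>t. (cmod (1 - (\<Sum>k\<in>J. c k * circle_map t powi k)))\<^sup>2 \<partial>\<nu>)
      = (\<integral>t. (1 - p (circle_map t))\<^sup>2 \<partial>\<nu>)"
  proof -
    have "(cmod (1 - complex_of_real y))\<^sup>2 = (1 - y)\<^sup>2" for y
      by (metis norm_of_real of_real_1 of_real_diff power2_abs)
    then show ?thesis unfolding P by simp
  qed
  also have "\<dots> \<le> (\<integral>t. 2 * indicator ({0..1} - K) t + 2 * \<eta>\<^sup>2 \<partial>\<nu>)"
  proof (rule integral_mono)
    show "integrable \<nu> (\<lambda>t. 2 * indicator ({0..1} - K) t + 2 * \<eta>\<^sup>2)"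
      using ind by simp
    show pw: "(1 - p (circle_map t))\<^sup>2 \<le> 2 * indicator ({0..1} - K) t + 2 * \<eta>\<^sup>2"
      if "t \<in> space \<nu>" for t
    proof -
      have "(1 - p (circle_map t))\<^sup>2 \<le> 2 * (1 - \<phi> m (circle_map t))\<^sup>2 + 2 * \<eta>\<^sup>2"
        using near[of t] by (intro sqn) simp
      also have "(1 - \<phi> m (circle_map t))\<^sup>2 \<le> indicator ({0..1} - K) t"
        using that sp \<phi>01[of m "circle_map t"]
        by (auto simp: indicator_def power_le_one \<phi>_def C_def)
      finally show ?thesis by simp
    qed
    show "integrable \<nu> (\<lambda>t. (1 - p (circle_map t))\<^sup>2)"
    proof (rule \<nu>.integrable_const_bound[where B="2 + 2 * \<eta>\<^sup>2"])
      show "AE t in \<nu>. norm ((1 - p (circle_map t))\<^sup>2) \<le> 2 + 2 * \<eta>\<^sup>2"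
      proof (rule AE_I2)
        fix t assume "t \<in> space \<nu>"
        from pw[OF this] show "norm ((1 - p (circle_map t))\<^sup>2) \<le> 2 + 2 * \<eta>\<^sup>2"
          by (cases "t \<in> {0..1} - K") simp_all
      qed
    qed (use pmeas in \<open>auto intro!: meas\<close>)
  qed
  also have "\<dots> = 2 * measure \<nu> ({0..1} - K) + 2 * \<eta>\<^sup>2 * V"
    using ind sp by (simp add: V_def Int_absorb2)
  also have "\<dots> \<le> e" using K(3) \<eta>2 e by simp
  finally have 1: "(\<integral>t. (cmod (1 - (\<Sum>k\<in>J. c k * circle_map t powi k)))\<^sup>2 \<partial>\<nu>) \<le> e" .
  have "(\<Sum>k\<in>J. (cmod (c k))\<^sup>2) = (\<integral>t. (p (circle_map t))\<^sup>2 \<partial>lebesgue01)"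
    unfolding integral_trig_poly_square[OF J(1), symmetric] P by simp
  also have "\<dots> \<le> (\<integral>t. 2 * (\<phi> m (circle_map t))\<^sup>2 + 2 * \<eta>\<^sup>2 \<partial>lebesgue01)"
  proof (rule integral_mono)
    show "integrable lebesgue01 (\<lambda>t. 2 * (\<phi> m (circle_map t))\<^sup>2 + 2 * \<eta>\<^sup>2)"
      using \<phi>meas[of m] \<phi>01[of m] by (intro L.integrable_const_bound[where B="2 + 2 * \<eta>\<^sup>2"])
        (auto intro!: measurable_lebesgue01 simp: power_le_one)
    show pw: "(p (circle_map t))\<^sup>2 \<le> 2 * (\<phi> m (circle_map t))\<^sup>2 + 2 * \<eta>\<^sup>2" for t
      using near[of t] by (intro sqn) simp
    have "(p (circle_map t))\<^sup>2 \<le> 2 + 2 * \<eta>\<^sup>2" for t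
      using pw[of t] power_le_one[OF \<phi>01, of m "circle_map t" 2] by linarith
    then show "integrable lebesgue01 (\<lambda>t. (p (circle_map t))\<^sup>2)"
      using pmeas by (intro L.integrable_const_bound[where B="2 + 2 * \<eta>\<^sup>2"]) (auto intro!: measurable_lebesgue01)
  qed
  also have "\<dots> = 2 * (\<integral>t. (\<phi> m (circle_map t))\<^sup>2 \<partial>lebesgue01) + 2 * \<eta>\<^sup>2"
    using \<phi>meas[of m] \<phi>01[of m] L.prob_space
    by (subst Bochner_Integration.integral_add)
       (auto intro!: L.integrable_const_bound[where B="1"] measurable_lebesgue01 simp: power_le_one)
  also have "\<dots> \<le> e" using m \<eta>2 e by simp
  finally have 2: "(\<Sum>k\<in>J. (cmod (c k))\<^sup>2) \<le> e" .
  show ?thesis using that[OF J(1) 1 2] .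
qed

section \<open>Families of integer polynomials\<close>

text \<open>Values at all integers; for an integer polynomial the floor only converts the type.\<close>

definition ival :: "rat poly \<Rightarrow> int \<Rightarrow> int" where
  "ival p k = \<lfloor>poly p (of_int k)\<rfloor>"

text \<open>The polynomial \<open>p (x + h)\<close>.\<close>

definition shift_poly :: "int \<Rightarrow> rat poly \<Rightarrow> rat poly" where
  "shift_poly h p = pcompose p [:of_int h, 1:]"

text \<open>Families are sets of polynomials, so a family is indexed by its own members.\<close>

definition ess_distinct_family :: "rat poly set \<Rightarrow> bool" where
  "ess_distinct_family Q \<longleftrightarrow> (\<forall>p\<in>Q. \<forall>q\<in>Q. p \<noteq> q \<longrightarrow> degree (p - q) > 0)"

lemma of_int_ival: "integer_polynomial p \<Longrightarrow> of_int (ival p k) = poly p (of_int k)"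
  by (simp add: integer_polynomial_def ival_def)

lemma ival_eqI: "of_int z = poly p (of_int k) \<Longrightarrow> ival p k = z"
  by (metis floor_of_int ival_def)

lemma poly_shift_poly: "poly (shift_poly h p) x = poly p (of_int h + x)"
  by (simp add: shift_poly_def poly_pcompose)

lemma ival_shift_poly: "ival (shift_poly h p) k = ival p (k + h)"
  by (simp add: ival_def poly_shift_poly add.commute)

lemma integer_polynomial_shift_poly:
  assumes "integer_polynomial p"
  shows "integer_polynomial (shift_poly h p)"
  using assms unfolding integer_polynomial_def poly_shift_poly of_int_add[symmetric] by blast

lemma integer_polynomial_diff:
  "integer_polynomial p \<Longrightarrow> integer_polynomial q \<Longrightarrow> integer_polynomial (p - q)"
  by (simp add: integer_polynomial_def)

lemma ival_diff:
  assumes "integer_polynomial p" "integer_polynomial q"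
  shows "ival (p - q) k = ival p k - ival q k"
  by (rule ival_eqI) (simp add: of_int_ival assms)

lemma shift_poly_diff: "shift_poly h (p - q) = shift_poly h p - shift_poly h q"
  by (simp add: shift_poly_def pcompose_diff)

lemma shift_poly_shift_poly: "shift_poly h (shift_poly k p) = shift_poly (h + k) p"
  by (rule poly_ext) (simp add: poly_shift_poly add_ac)

lemma degree_shift_poly [simp]: "degree (shift_poly h p) = degree p"
  by (simp add: shift_poly_def degree_pcompose)

lemma lead_coeff_shift_poly [simp]: "lead_coeff (shift_poly h p) = lead_coeff p"
  by (simp add: shift_poly_def lead_coeff_comp)

lemma shift_poly_inverse: "shift_poly (- h) (shift_poly h q) = q"
  by (simp add: shift_poly_shift_poly) (simp add: shift_poly_def)

lemma inj_shift_poly: "shift_poly h p = shift_poly h q \<Longrightarrow> p = q"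
  by (metis shift_poly_inverse)

text \<open>If \<open>p (x + h) - p x\<close> is a constant \<open>c\<close>, then \<open>p (n h) = p 0 + n c\<close> for all \<open>n\<close>.\<close>

lemma degree_shift_poly_diff:
  assumes "degree p \<ge> 2" "h \<noteq> 0"
  shows "degree (shift_poly h p - p) > 0"
proof (rule ccontr)
  assume "\<not> ?thesis"
  then obtain c where c: "shift_poly h p - p = [:c:]" by (auto dest: degree_eq_zeroE)
  have step: "poly p (of_int h + x) = poly p x + c" for x
    using arg_cong[OF c, of "\<lambda>q. poly q x"] by (simp add: poly_shift_poly)
  have lin: "poly p (of_nat n * of_int h) = poly p 0 + of_nat n * c" for n
  proof (induction n)
    case (Suc n)
    have "poly p (of_nat (Suc n) * of_int h) = poly p (of_int h + of_nat n * of_int h)"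
      by (simp add: distrib_right)
    also have "\<dots> = poly p 0 + of_nat n * c + c" unfolding step Suc.IH ..
    finally show ?case by (simp add: distrib_right)
  qed simp
  define q where "q = pcompose p [:0, of_int h:] - [:poly p 0, c:]"
  have "range (of_nat :: nat \<Rightarrow> rat) \<subseteq> {x. poly q x = 0}"
    using lin by (auto simp: q_def poly_pcompose mult.commute)
  moreover have "infinite (range (of_nat :: nat \<Rightarrow> rat))"
    by (simp add: finite_image_iff)
  ultimately have "q = 0" using poly_roots_finite[of q] finite_subset by blast
  then have "degree (pcompose p [:0, of_int h:]) = degree [:poly p 0, c:]" by (simp add: q_def)
  also have "\<dots> \<le> 1" by simp
  finally show False using assms by (simp add: degree_pcompose)
qed

lemma finite_shift_poly_const:
  assumes "degree p \<ge> 2"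
  shows "finite {h. degree (shift_poly h p - q) = 0}"
proof -
  have "h = k" if "degree (shift_poly h p - q) = 0" "degree (shift_poly k p - q) = 0" for h k
  proof (rule ccontr)
    assume "h \<noteq> k"
    have "degree ((shift_poly h p - q) - (shift_poly k p - q)) \<le> 0"
      by (rule degree_diff_le) (simp_all add: that)
    then have "degree (shift_poly (- k) (shift_poly h p - shift_poly k p)) = 0" by simp
    then have "degree (shift_poly (h - k) p - p) = 0"
      by (simp only: shift_poly_diff shift_poly_shift_poly) (simp add: shift_poly_def)
    then show False using degree_shift_poly_diff[OF assms, of "h - k"] \<open>h \<noteq> k\<close> by simp
  qed
  then have "{h. degree (shift_poly h p - q) = 0} \<subseteq> {h}" if "degree (shift_poly h p - q) = 0" for h
    using that by blast
  then show ?thesis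
    by (metis (mono_tags, lifting) Collect_empty_eq finite.emptyI finite.insertI finite_subset)
qed

text \<open>Only the nonlinear members are shifted: for a linear \<open>q\<close> the polynomial \<open>q (x + h)\<close> differs
  from \<open>q\<close> by a constant for every \<open>h\<close>.\<close>

lemma ess_distinct_family_shift:
  assumes "finite Q" "ess_distinct_family Q"
  defines "P \<equiv> {q \<in> Q. degree q \<ge> 2}"
  shows "finite {h. \<not> (ess_distinct_family (Q \<union> shift_poly h ` P) \<and> Q \<inter> shift_poly h ` P = {})}"
proof (rule finite_subset)
  show "finite (\<Union>p\<in>P. \<Union>q\<in>Q. {h. degree (shift_poly h p - q) = 0})"
    using assms(1) by (auto simp: P_def intro!: finite_shift_poly_const)
  show "{h. \<not> (ess_distinct_family (Q \<union> shift_poly h ` P) \<and> Q \<inter> shift_poly h ` P = {})}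
      \<subseteq> (\<Union>p\<in>P. \<Union>q\<in>Q. {h. degree (shift_poly h p - q) = 0})"
  proof (rule subsetI, rule ccontr)
    fix h
    assume h: "h \<in> {h. \<not> (ess_distinct_family (Q \<union> shift_poly h ` P) \<and> Q \<inter> shift_poly h ` P = {})}"
      and "h \<notin> (\<Union>p\<in>P. \<Union>q\<in>Q. {h. degree (shift_poly h p - q) = 0})"
    then have good: "degree (shift_poly h p - q) > 0" "degree (q - shift_poly h p) > 0"
      if "p \<in> P" "q \<in> Q" for p q
      using that degree_minus[of "shift_poly h p - q"] by auto
    have "degree (shift_poly h p - shift_poly h q) > 0"
      if "p \<in> P" "q \<in> P" "shift_poly h p \<noteq> shift_poly h q" for p q
      using that assms(2) by (auto simp: shift_poly_diff[symmetric] ess_distinct_family_def P_def)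
    with good assms(2) have "ess_distinct_family (Q \<union> shift_poly h ` P)"
      unfolding ess_distinct_family_def by auto
    moreover have "Q \<inter> shift_poly h ` P = {}"
      using good(1) by fastforce
    ultimately show False using h by simp
  qed
qed

lemma poly_degree_le_1: "degree p \<le> 1 \<Longrightarrow> p = [:coeff p 0, coeff p 1:]"
  by (rule poly_eqI) (auto simp: coeff_pCons coeff_eq_0 split: nat.split)

lemma ival_linear:
  assumes "degree p \<le> 1"  "integer_polynomial p"
  shows "ival p (n + h) = ival p n + (ival p 1 - ival p 0) * h"
proof -
  obtain a b where p: "p = [:a, b:]"
    using poly_degree_le_1[OF assms(1)] by blast
  show ?thesis
    by (rule ival_eqI) (simp add: of_int_ival[OF assms(2)], simp add: p algebra_simps)
qed

lemma ival_linear_nonzero: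
  assumes "degree p = 1"  "integer_polynomial p"
  shows "ival p 1 - ival p 0 \<noteq> 0"
proof
  assume 0: "ival p 1 - ival p 0 = 0"
  obtain a b where p: "p = [:a, b:]" using poly_degree_le_1[of p] assms(1) by auto
  then have "b \<noteq> 0" using assms(1) by auto
  have "of_int (ival p 1 - ival p 0) = b"
    using of_int_ival[OF assms(2), of 1] of_int_ival[OF assms(2), of 0] by (simp add: p)
  with 0 \<open>b \<noteq> 0\<close> show False by simp
qed

text \<open>The weight of a family is the multiset of degrees of its classes, two polynomials
  belonging to the same class if they agree in degree and leading coefficient.\<close>

definition key :: "rat poly \<Rightarrow> nat \<times> rat" where
  "key p = (degree p, lead_coeff p)"

definition weight :: "rat poly set \<Rightarrow> nat multiset" where
  "weight Q = image_mset fst (mset_set (key ` Q))"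

lemma key_shift_poly [simp]: "key (shift_poly h p) = key p"
  using lead_coeff_shift_poly[of h p] by (simp only: key_def degree_shift_poly)

lemma key_diff:
  assumes "degree q \<le> degree p" "key p \<noteq> key q"
  shows "key (p - q) = (degree p, if degree p = degree q then lead_coeff p - lead_coeff q else lead_coeff p)"
proof (cases "degree p = degree q")
  case True
  then have ne: "coeff (p - q) (degree p) \<noteq> 0" using assms(2) by (simp add: key_def)
  have "degree (p - q) = degree p"
    using le_degree[OF ne] degree_diff_le[of p "degree p" q] True by simp
  then show ?thesis using True by (simp add: key_def)
next
  case False
  then have less: "degree q < degree p" using assms(1) by simp
  then have "degree (p - q) = degree p"
    using degree_add_eq_left[of "- q" p] by simp
  then show ?thesis using less by (simp add: key_def coeff_eq_0)
qed

lemma degree_diff_same_key: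
  assumes "key p = key q" "degree q > 0"
  shows "degree (p - q) < degree q"
proof -
  have "coeff (p - q) (degree q) = 0" "degree (p - q) \<le> degree q"
    using assms(1) by (auto simp: key_def intro: degree_diff_le)
  then show ?thesis using assms(2) eq_zero_or_degree_less[of "p - q" "degree q"] by auto
qed

text \<open>When a member \<open>q\<close> of least degree is subtracted, its own class is replaced by classes of lower
  degree, and every other class passes to a class of the same degree.\<close>

lemma weight_decreases:
  assumes Q: "finite Q" "q \<in> Q" "degree q > 0" "\<And>p. p \<in> Q \<Longrightarrow> degree q \<le> degree p"
    and Q': "finite Q'" "key ` Q' \<subseteq> key ` Q"
  shows "(weight ((\<lambda>p. p - q) ` Q'), weight Q) \<in> Multiset.mult less_than"
proof -
  define d where "d = degree q"
  \<comment> \<open>The effect of subtracting \<open>q\<close> on the classes other than that of \<open>q\<close>.\<close>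
  define \<phi> where "\<phi> = (\<lambda>(e, c). (e, if e = d then c - lead_coeff q else (c :: rat)))"
  define A where "A = key ` Q - {key q}"
  define K where "K = key ` ((\<lambda>p. p - q) ` Q')"
  have finA: "finite A" using Q by (simp add: A_def)
  have finK: "finite K" using Q' by (simp add: K_def)
  have inj: "inj_on \<phi> A" by (auto simp: inj_on_def \<phi>_def split: if_splits)
  have deg: "degree q \<le> degree p" if "p \<in> Q'" for p
  proof -
    from that Q'(2) obtain p' where "p' \<in> Q" "key p' = key p" by (metis imageE image_eqI subsetD)
    then show ?thesis using Q(4)[of p'] by (simp add: key_def)
  qed
  have K: "K \<subseteq> \<phi> ` A \<union> {k. fst k < d}"
  proof
    fix k assume "k \<in> K"
    then obtain p where p: "p \<in> Q'" "k = key (p - q)" by (auto simp: K_def)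
    show "k \<in> \<phi> ` A \<union> {k. fst k < d}"
    proof (cases "key p = key q")
      case True
      then show ?thesis using degree_diff_same_key[OF True Q(3)] p by (simp add: key_def d_def)
    next
      case False
      have "k = \<phi> (key p)"
        unfolding p(2) key_diff[OF deg[OF p(1)] False] by (simp add: \<phi>_def d_def key_def)
      moreover have "key p \<in> A" using False p Q'(2) by (auto simp: A_def)
      ultimately show ?thesis by blast
    qed
  qed
  define K1 where "K1 = K \<inter> \<phi> ` A"
  define K2 where "K2 = K - \<phi> ` A"
  have "weight ((\<lambda>p. p - q) ` Q') = image_mset fst (mset_set (K1 \<union> K2))"
    by (simp add: weight_def K_def[symmetric] K1_def K2_def Int_Diff_Un)
  also have "\<dots> = image_mset fst (mset_set K1) + image_mset fst (mset_set K2)"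
    using finK by (subst mset_set_Union) (auto simp: K1_def K2_def)
  finally have w1: "weight ((\<lambda>p. p - q) ` Q') = image_mset fst (mset_set K1) + image_mset fst (mset_set K2)" .
  have "fst \<circ> \<phi> = fst" by (auto simp: \<phi>_def)
  then have "image_mset fst (mset_set A) = image_mset fst (mset_set (\<phi> ` A))"
    by (simp add: image_mset_mset_set[OF inj, symmetric] multiset.map_comp)
  also have "\<phi> ` A = K1 \<union> (\<phi> ` A - K)" by (auto simp: K1_def)
  also have "image_mset fst (mset_set \<dots>) = image_mset fst (mset_set K1) + image_mset fst (mset_set (\<phi> ` A - K))"
    using finA finK by (subst mset_set_Union) (auto simp: K1_def)
  finally have A': "image_mset fst (mset_set A)
     = image_mset fst (mset_set K1) + image_mset fst (mset_set (\<phi> ` A - K))" .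
  have kA: "key q \<notin> A" by (simp add: A_def)
  have "key ` Q = insert (key q) A" using Q(2) by (auto simp: A_def)
  then have "weight Q = add_mset d (image_mset fst (mset_set A))"
    using finA kA by (simp add: weight_def) (simp add: key_def d_def)
  then have w2: "weight Q = image_mset fst (mset_set K1) + add_mset d (image_mset fst (mset_set (\<phi> ` A - K)))"
    by (simp add: A')
  show ?thesis
    unfolding w1 w2
  proof (rule one_step_implies_mult)
    show "\<forall>k\<in>set_mset (image_mset fst (mset_set K2)).
       \<exists>j\<in>set_mset (add_mset d (image_mset fst (mset_set (\<phi> ` A - K)))). (k, j) \<in> less_than"
      using K finK by (auto simp: K2_def)
  qed simp
qed

lemma weight_induct [case_names less]:
  assumes "\<And>Q. (\<And>Q'. (weight Q', weight Q) \<in> Multiset.mult less_than \<Longrightarrow> P Q') \<Longrightarrow> P Q"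
  shows "P Q"
proof -
  have "wf (inv_image (Multiset.mult less_than) weight)"
    by (intro wf_inv_image wf_mult wf_less_than)
  then show ?thesis
    by (induction Q rule: wf_induct_rule) (rule assms, simp)
qed

section \<open>Ergodic averages and weak mixing\<close>

lemma mp_automorphism_measurable: "mp_automorphism M U \<Longrightarrow> U \<in> measurable M M"
  by (simp add: mp_automorphism_def)

lemma mp_automorphism_distr:
  assumes "mp_automorphism M U"
  shows "distr M M U = M"
  by (rule measure_eqI) (use assms in \<open>auto simp: mp_automorphism_def emeasure_distr\<close>)

text \<open>\<open>max_birkhoff U F n\<close> is the largest of the first \<open>n + 1\<close> nonempty Birkhoff sums of \<open>F\<close>.\<close>

fun max_birkhoff :: "('a \<Rightarrow> 'a) \<Rightarrow> ('a \<Rightarrow> real) \<Rightarrow> nat \<Rightarrow> 'a \<Rightarrow> real" where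
  "max_birkhoff U F 0 x = F x"
| "max_birkhoff U F (Suc n) x = F x + max 0 (max_birkhoff U F n (U x))"

lemma max_birkhoff_Suc_ge: "max_birkhoff U F n x \<le> max_birkhoff U F (Suc n) x"
proof (induction n arbitrary: x)
  case (Suc n)
  from Suc.IH[of "U x"] show ?case
    unfolding max_birkhoff.simps(2)[of U F "Suc n"] max_birkhoff.simps(2)[of U F n x]
    by (intro add_left_mono max.mono) simp_all
qed simp

lemma max_birkhoff_mono: "n \<le> m \<Longrightarrow> max_birkhoff U F n x \<le> max_birkhoff U F m x"
  by (rule lift_Suc_mono_le[of "\<lambda>n. max_birkhoff U F n x"]) (rule max_birkhoff_Suc_ge)

lemma birkhoff_sum_Suc: "(\<Sum>k<Suc n. F ((U ^^ k) x)) = F x + (\<Sum>k<n. F ((U ^^ k) (U x)))"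
  by (subst sum.lessThan_Suc_shift) (simp add: funpow_swap1)

lemma birkhoff_sum_le: "(\<Sum>k<Suc n. F ((U ^^ k) x)) \<le> max_birkhoff U F n x" for F :: "'a \<Rightarrow> real"
proof (induction n arbitrary: x)
  case (Suc n)
  show ?case unfolding birkhoff_sum_Suc[where n="Suc n"] max_birkhoff.simps
    using Suc.IH[of "U x"] by linarith
qed simp

context prob_space
begin

lemma max_birkhoff_measurable:
  assumes [measurable]: "U \<in> measurable M M" "F \<in> borel_measurable M"
  shows "max_birkhoff U F n \<in> borel_measurable M"
  by (induction n) simp_all

lemma max_birkhoff_bound:
  assumes "U \<in> measurable M M" "\<And>x. x \<in> space M \<Longrightarrow> \<bar>F x\<bar> \<le> B" "x \<in> space M"
  shows "\<bar>max_birkhoff U F n x\<bar> \<le> (n + 1) * B"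
  using assms(3)
proof (induction n arbitrary: x)
  case (Suc n)
  have "U x \<in> space M" using assms(1) Suc.prems by (rule measurable_space)
  from Suc.IH[OF this] assms(2)[OF Suc.prems] show ?case
    by (simp add: algebra_simps max_def abs_if split: if_splits)
qed (use assms(2) in simp)

text \<open>A bounded function with negative integral has bounded Birkhoff sums, almost everywhere:
  the set where they are unbounded is invariant, and if it were conull then \<open>max_birkhoff\<close>
  would increase to infinity and its increments, whose integrals are nonnegative, would have
  integrals tending to \<open>\<integral> F\<close>.\<close>

lemma ergodic_max_birkhoff_bounded:
  assumes U: "ergodic M U" and F[measurable]: "F \<in> borel_measurable M"
    and B: "\<And>x. x \<in> space M \<Longrightarrow> \<bar>F x\<bar> \<le> B" and neg: "(\<integral>x. F x \<partial>M) < 0"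
  shows "AE x in M. \<exists>m::nat. \<forall>n. max_birkhoff U F n x \<le> m"
proof -
  have mp: "mp_automorphism M U" using U by (simp add: ergodic_def)
  note Um[measurable] = mp_automorphism_measurable[OF mp]
  note [measurable] = max_birkhoff_measurable[OF Um F]
  let ?\<Phi> = "max_birkhoff U F"
  define E where "E = {x \<in> space M. \<forall>m::nat. \<exists>n. real m < ?\<Phi> n x}"
  have E[measurable]: "E \<in> sets M" unfolding E_def by measurable
  have "U x \<in> E \<longleftrightarrow> x \<in> E" if x: "x \<in> space M" for x
  proof -
    have Ux: "U x \<in> space M" using Um x by (rule measurable_space)
    obtain b :: nat where b: "B \<le> real b" using real_arch_simple by blast
    show ?thesis
    proof
      assume UE: "U x \<in> E"
      have "\<exists>n. real m < ?\<Phi> n x" for m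
      proof -
        from UE obtain n where "real (m + b) < ?\<Phi> n (U x)" unfolding E_def by blast
        then have "real m < ?\<Phi> (Suc n) x" using B[OF x] b by (auto simp: abs_le_iff)
        then show ?thesis by blast
      qed
      then show "x \<in> E" using x by (simp add: E_def)
    next
      assume xE: "x \<in> E"
      have "\<exists>n. real m < ?\<Phi> n (U x)" for m
      proof -
        from xE obtain n where "real (m + b) < ?\<Phi> n x" unfolding E_def by blast
        also have "\<dots> \<le> ?\<Phi> (Suc n) x" by (rule max_birkhoff_Suc_ge)
        finally have "real m < ?\<Phi> n (U x)"
          using B[OF x] b by (auto simp: abs_le_iff max_def split: if_splits)
        then show ?thesis by blast
      qed
      then show "U x \<in> E" using Ux by (simp add: E_def)
    qed
  qed
  \<comment> \<open>Strict invariance, as demanded by the definition of ergodicity.\<close>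
  then have "U -` E \<inter> space M = E" using sets.sets_into_space[OF E] by auto
  then have "emeasure M E = 0 \<or> emeasure M (space M - E) = 0"
    using U E by (simp add: ergodic_def)
  then show ?thesis
  proof
    assume "emeasure M E = 0"
    then have "AE x in M. x \<notin> E" using E by (intro AE_not_in) auto
    then show ?thesis
      using AE_space by eventually_elim (auto simp: E_def not_less)
  next
    assume "emeasure M (space M - E) = 0"
    then have "AE x in M. x \<notin> space M - E" using E by (intro AE_not_in) auto
    then have EA: "AE x in M. x \<in> E" using AE_space by eventually_elim auto
    have intF: "integrable M F" using B by (intro integrable_const_bound[where B=B]) auto
    have int\<Phi>: "integrable M (?\<Phi> n)" for n
    proof (rule integrable_const_bound[where B="(n + 1) * B"])
      show "AE x in M. norm (?\<Phi> n x) \<le> (n + 1) * B"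
        using max_birkhoff_bound[OF Um, of F B _ n] B
        by (intro AE_I2) (simp add: add.commute)
    qed measurable
    have neg_part: "max 0 (- ?\<Phi> n x) \<le> B" "0 \<le> B" if "x \<in> space M" for n x
      using max_birkhoff_mono[of 0 n U F x] B[OF that] by (auto simp: abs_le_iff)
    have intneg: "integrable M (\<lambda>x. max 0 (- ?\<Phi> n x))" for n
      using neg_part by (intro integrable_const_bound[where B=B]) (auto simp: abs_le_iff)
    have distr: "(\<integral>x. g (U x) \<partial>M) = (\<integral>x. g x \<partial>M)" if "g \<in> borel_measurable M" for g :: "'a \<Rightarrow> real"
      using integral_distr[OF Um that] mp_automorphism_distr[OF mp] by simp
    have intU: "integrable M (\<lambda>x. g (U x))" if "integrable M g" for g :: "'a \<Rightarrow> real"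
      using integrable_distr[OF Um, of g] that mp_automorphism_distr[OF mp] by simp
    have "- (\<integral>x. F x \<partial>M) \<le> (\<integral>x. max 0 (- ?\<Phi> n x) \<partial>M)" for n
    proof -
      have "0 \<le> (\<integral>x. ?\<Phi> (Suc n) x \<partial>M) - (\<integral>x. ?\<Phi> n x \<partial>M)"
        using integral_mono[OF int\<Phi>[of n] int\<Phi>[of "Suc n"] max_birkhoff_Suc_ge] by linarith
      also have "\<dots> = (\<integral>x. ?\<Phi> (Suc n) x \<partial>M) - (\<integral>x. ?\<Phi> n (U x) \<partial>M)"
        by (simp only: distr[OF max_birkhoff_measurable[OF Um F]])
      also have "\<dots> = (\<integral>x. ?\<Phi> (Suc n) x - ?\<Phi> n (U x) \<partial>M)"
        by (rule Bochner_Integration.integral_diff[symmetric]) (rule int\<Phi>, rule intU[OF int\<Phi>])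
      also have "\<dots> = (\<integral>x. F x + max 0 (- ?\<Phi> n (U x)) \<partial>M)"
        by (intro Bochner_Integration.integral_cong) (auto simp: max_def)
      also have "\<dots> = (\<integral>x. F x \<partial>M) + (\<integral>x. max 0 (- ?\<Phi> n (U x)) \<partial>M)"
        by (rule Bochner_Integration.integral_add[OF intF intU[OF intneg]])
      also have "(\<integral>x. max 0 (- ?\<Phi> n (U x)) \<partial>M) = (\<integral>x. max 0 (- ?\<Phi> n x) \<partial>M)"
        by (rule distr[of "\<lambda>x. max 0 (- ?\<Phi> n x)"]) measurable
      finally show ?thesis by simp
    qed
    moreover have "(\<lambda>n. \<integral>x. max 0 (- ?\<Phi> n x) \<partial>M) \<longlonglongrightarrow> (\<integral>x. 0 \<partial>M)"
    proof (rule integral_dominated_convergence[where w="\<lambda>_. B"])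
      show "AE x in M. (\<lambda>n. max 0 (- ?\<Phi> n x)) \<longlonglongrightarrow> 0"
        using EA
      proof eventually_elim
        case (elim x)
        then obtain n0 where "real 0 < ?\<Phi> n0 x" unfolding E_def by blast
        then have "\<forall>n\<ge>n0. max 0 (- ?\<Phi> n x) = 0" using max_birkhoff_mono[of n0 _ U F x] by fastforce
        then show ?case by (intro tendsto_eventually) (auto simp: eventually_sequentially)
      qed
      show "AE x in M. norm (max 0 (- ?\<Phi> n x)) \<le> B" for n
        using neg_part by auto
    qed auto
    ultimately have "- (\<integral>x. F x \<partial>M) \<le> 0"
      by (intro LIMSEQ_le_const[of "\<lambda>n. \<integral>x. max 0 (- ?\<Phi> n x) \<partial>M"]) auto
    then show ?thesis using neg by simp
  qed
qed

lemma ergodic_average_upper: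
  assumes U: "ergodic M U" and F[measurable]: "F \<in> borel_measurable M"
    and B: "\<And>x. x \<in> space M \<Longrightarrow> \<bar>F x\<bar> \<le> B" and mean: "(\<integral>x. F x \<partial>M) = 0" and e: "e > 0"
  shows "AE x in M. \<forall>\<^sub>F n in sequentially. (\<Sum>k<n. F ((U ^^ k) x)) / n < e"
proof -
  have intF: "integrable M F" using B by (intro integrable_const_bound[where B=B]) auto
  have "AE x in M. \<exists>m::nat. \<forall>n. max_birkhoff U (\<lambda>x. F x - e / 2) n x \<le> m"
  proof (rule ergodic_max_birkhoff_bounded[OF U])
    show "(\<integral>x. F x - e / 2 \<partial>M) < 0" using intF mean e prob_space by simp
    show "\<bar>F x - e / 2\<bar> \<le> B + e / 2" if "x \<in> space M" for x
      using B[OF that] e by (auto simp: abs_le_iff)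
  qed simp
  then show ?thesis
  proof eventually_elim
    case (elim x)
    then obtain m :: nat where m: "\<And>n. max_birkhoff U (\<lambda>x. F x - e / 2) n x \<le> m" by blast
    have "(\<lambda>n. real m / real n) \<longlonglongrightarrow> 0" by (rule lim_const_over_n)
    then have "\<forall>\<^sub>F n in sequentially. real m / real n < e / 2"
      using e by (intro order_tendstoD(2)) auto
    moreover have "\<forall>\<^sub>F n in sequentially. n > (0::nat)" by (rule eventually_gt_at_top)
    ultimately show ?case
    proof eventually_elim
      case (elim n)
      then obtain n' where n': "n = Suc n'" by (cases n) auto
      have "(\<Sum>k<n. F ((U ^^ k) x) - e / 2) \<le> m"
        unfolding n' using birkhoff_sum_le[of "\<lambda>x. F x - e / 2" U x n'] m[of n'] by linarith
      then have "(\<Sum>k<n. F ((U ^^ k) x)) \<le> m + n * (e / 2)"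
        by (simp add: sum_subtractf)
      then have "(\<Sum>k<n. F ((U ^^ k) x)) / n \<le> (m + n * (e / 2)) / n"
        by (rule divide_right_mono) simp
      also have "\<dots> = m / n + e / 2" using elim(2) by (simp add: add_divide_distrib)
      finally show ?case using elim(1) by linarith
    qed
  qed
qed

lemma ergodic_average_AE:
  assumes U: "ergodic M U" and F[measurable]: "F \<in> borel_measurable M"
    and B: "\<And>x. x \<in> space M \<Longrightarrow> \<bar>F x\<bar> \<le> B" and mean: "(\<integral>x. F x \<partial>M) = 0"
  shows "AE x in M. (\<lambda>n. (\<Sum>k<n. F ((U ^^ k) x)) / n) \<longlonglongrightarrow> 0"
proof -
  have 1: "AE x in M. \<forall>j::nat. \<forall>\<^sub>F n in sequentially. (\<Sum>k<n. F ((U ^^ k) x)) / n < 1 / (real j + 1)"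
    by (subst AE_all_countable) (auto intro!: ergodic_average_upper[OF U F B mean])
  have 2: "AE x in M. \<forall>j::nat. \<forall>\<^sub>F n in sequentially. (\<Sum>k<n. - F ((U ^^ k) x)) / n < 1 / (real j + 1)"
    by (subst AE_all_countable) (auto intro!: ergodic_average_upper[OF U, of "\<lambda>x. - F x" B] B simp: mean)
  from 1 2 show ?thesis
  proof eventually_elim
    case (elim x)
    show ?case
    proof (rule tendstoI)
      fix e :: real assume "e > 0"
      then obtain j where j: "1 / (real j + 1) < e"
        using reals_Archimedean[of e] by (auto simp: inverse_eq_divide add.commute)
      from spec[OF elim(1), of j] spec[OF elim(2), of j]
      show "\<forall>\<^sub>F n in sequentially. dist ((\<Sum>k<n. F ((U ^^ k) x)) / n) 0 < e"
        by eventually_elim (use j in \<open>simp add: sum_negf abs_less_iff\<close>)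
    qed
  qed
qed

lemma ergodic_average_L1:
  assumes U: "ergodic M U" and F[measurable]: "F \<in> borel_measurable M"
    and B: "\<And>x. x \<in> space M \<Longrightarrow> \<bar>F x\<bar> \<le> B" and mean: "(\<integral>x. F x \<partial>M) = 0"
  shows "(\<lambda>n. \<integral>x. \<bar>(\<Sum>k<n. F ((U ^^ k) x)) / n\<bar> \<partial>M) \<longlonglongrightarrow> 0"
proof -
  have [measurable]: "U \<in> measurable M M"
    using U by (simp add: ergodic_def mp_automorphism_def)
  have Uk[measurable]: "U ^^ k \<in> measurable M M" for k
    by (induction k) (auto simp: o_def)
  have bd: "\<bar>(\<Sum>k<n. F ((U ^^ k) x)) / n\<bar> \<le> B" if x: "x \<in> space M" for n :: nat and x
  proof (cases "n = 0")
    case True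
    then show ?thesis using B[OF x] by auto
  next
    case False
    have "\<bar>\<Sum>k<n. F ((U ^^ k) x)\<bar> \<le> (\<Sum>k<n. B)"
      by (intro order_trans[OF sum_abs] sum_mono B measurable_space[OF Uk x])
    then show ?thesis using False by (simp add: field_simps)
  qed
  have "(\<lambda>n. \<integral>x. \<bar>(\<Sum>k<n. F ((U ^^ k) x)) / n\<bar> \<partial>M) \<longlonglongrightarrow> (\<integral>x. 0 \<partial>M)"
  proof (rule integral_dominated_convergence[where w="\<lambda>_. B"])
    show "AE x in M. (\<lambda>n. \<bar>(\<Sum>k<n. F ((U ^^ k) x)) / n\<bar>) \<longlonglongrightarrow> 0"
    proof -
      have "AE x in M. (\<lambda>n. (\<Sum>k<n. F ((U ^^ k) x)) / n) \<longlonglongrightarrow> 0"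
        by (rule ergodic_average_AE[OF U F _ mean]) (rule B)
      then show ?thesis by eventually_elim (rule tendsto_rabs_zero)
    qed
    show "AE x in M. norm \<bar>(\<Sum>k<n. F ((U ^^ k) x)) / n\<bar> \<le> B" for n :: nat
      by (rule AE_I2) (use bd in auto)
  qed auto
  then show ?thesis by simp
qed

text \<open>The square of the modulus of a correlation of \<open>G\<close> under \<open>S\<close> is a correlation of
  \<open>(x, y) \<mapsto> G x * cnj (G y)\<close> under \<open>S \<times> S\<close>.\<close>

lemma weakly_mixing_correlations_square:
  assumes S: "weakly_mixing M S" and G: "bdd_fun M G" and mean: "(\<integral>x. G x \<partial>M) = 0"
  shows "(\<lambda>n. (\<Sum>h<n. (cmod (\<integral>x. G ((S ^^ h) x) * cnj (G x) \<partial>M))\<^sup>2) / real n) \<longlonglongrightarrow> 0"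
proof -
  interpret P: pair_prob_space M M by unfold_locales
  let ?N = "M \<Otimes>\<^sub>M M"
  define U where "U = map_prod S S"
  have U: "ergodic ?N U" using S by (simp add: weakly_mixing_def U_def)
  have [measurable]: "S \<in> measurable M M" using S by (simp add: weakly_mixing_def mp_automorphism_def)
  have Sk[measurable]: "S ^^ k \<in> measurable M M" for k
    by (induction k) (auto simp: o_def)
  have Uk: "(U ^^ k) (x, y) = ((S ^^ k) x, (S ^^ k) y)" for k x y
    by (induction k) (auto simp: U_def)
  obtain C where C: "bdd_by M C G" using G by (auto simp: bdd_fun_def)
  have C0: "C \<ge> 0" by (rule bdd_by_nonneg[OF C])
  have Gm[measurable]: "G \<in> borel_measurable M" by (rule bdd_by_measurable[OF C])
  define F where "F = (\<lambda>z. G (fst z) * cnj (G (snd z)))"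
  have Fm[measurable]: "F \<in> borel_measurable ?N" unfolding F_def by measurable
  have Fb: "cmod (F z) \<le> C * C" if "z \<in> space ?N" for z
    using that C C0 unfolding F_def norm_mult
    by (intro mult_mono) (auto simp: space_pair_measure bdd_byD)
  have prod: "(\<integral>z. f (fst z) * g (snd z) \<partial>?N) = (\<integral>x. f x \<partial>M) * (\<integral>y. g y \<partial>M)"
    if fg: "bdd_fun M f" "bdd_fun M g" for f g :: "'a \<Rightarrow> complex"
  proof -
    have "integrable ?N (\<lambda>(x, y). f x * g y)"
    proof -
      obtain D E where DE: "bdd_by M D f" "bdd_by M E g" using fg unfolding bdd_fun_def by blast
      note [measurable] = bdd_by_measurable[OF DE(1)] bdd_by_measurable[OF DE(2)]
      show ?thesis
      proof (rule P.P.integrable_const_bound[where B="D * E"])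
        show "AE z in ?N. norm (case z of (x, y) \<Rightarrow> f x * g y) \<le> D * E"
          using DE bdd_by_nonneg[OF DE(1)]
          by (intro AE_I2) (auto simp: space_pair_measure norm_mult bdd_byD intro!: mult_mono)
      qed measurable
    qed
    from P.integral_fst[OF this] show ?thesis by (simp add: case_prod_beta')
  qed
  have meanF: "(\<integral>z. F z \<partial>?N) = 0"
    unfolding F_def by (subst prod[OF G bdd_fun_cnj[OF G]]) (simp add: mean)
  have intF: "integrable ?N F"
    by (rule P.P.integrable_const_bound[where B="C * C"]) (auto intro: Fb)
  have L1: "(\<lambda>n. \<integral>z. \<bar>(\<Sum>k<n. r (F ((U ^^ k) z))) / n\<bar> \<partial>?N) \<longlonglongrightarrow> 0"
    if "r = Re \<or> r = Im" for r
  proof (rule P.P.ergodic_average_L1[OF U, of "\<lambda>z. r (F z)"])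
    show "(\<lambda>z. r (F z)) \<in> borel_measurable ?N" using that by auto
    show "\<bar>r (F z)\<bar> \<le> C * C" if "z \<in> space ?N" for z
      using Fb[OF that] \<open>r = Re \<or> r = Im\<close> abs_Re_le_cmod[of "F z"] abs_Im_le_cmod[of "F z"] by auto
    show "(\<integral>z. r (F z) \<partial>?N) = 0"
      using that integral_Re[OF intF] integral_Im[OF intF] meanF by auto
  qed
  define c where "c = (\<lambda>h. \<integral>x. G ((S ^^ h) x) * cnj (G x) \<partial>M)"
  have UkS: "F ((U ^^ k) z) = G ((S ^^ k) (fst z)) * cnj (G ((S ^^ k) (snd z)))" for k z
    by (cases z) (simp add: Uk F_def)
  have UkSp: "(U ^^ k) z \<in> space ?N" if "z \<in> space ?N" for k z
    using that measurable_space[OF Sk] by (cases z) (auto simp: Uk space_pair_measure)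
  have FUm[measurable]: "(\<lambda>z. F ((U ^^ k) z)) \<in> borel_measurable ?N" for k
    unfolding UkS by measurable
  have c2: "complex_of_real ((cmod (c h))\<^sup>2) = (\<integral>z. F ((U ^^ h) z) * cnj (F z) \<partial>?N)" for h
  proof -
    have b: "bdd_fun M (\<lambda>x. G ((S ^^ h) x) * cnj (G x))"
    proof (rule bdd_fun_mult[OF bdd_funI[of _ C] bdd_fun_cnj[OF G]])
      show "bdd_by M C (\<lambda>x. G ((S ^^ h) x))"
        using C measurable_space[OF Sk] by (simp add: bdd_by_def)
    qed
    have "complex_of_real ((cmod (c h))\<^sup>2) = c h * cnj (c h)" by (rule complex_norm_square)
    also have "\<dots> = (\<integral>x. G ((S ^^ h) x) * cnj (G x) \<partial>M) * (\<integral>x. cnj (G ((S ^^ h) x) * cnj (G x)) \<partial>M)"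
      by (simp add: c_def Bochner_Integration.integral_cnj[symmetric] del: Bochner_Integration.integral_cnj)
    also have "\<dots> = (\<integral>z. (G ((S ^^ h) (fst z)) * cnj (G (fst z))) * cnj (G ((S ^^ h) (snd z)) * cnj (G (snd z))) \<partial>?N)"
      by (rule prod[OF b bdd_fun_cnj[OF b], symmetric])
    also have "\<dots> = (\<integral>z. F ((U ^^ h) z) * cnj (F z) \<partial>?N)"
      by (intro Bochner_Integration.integral_cong) (simp_all only: UkS, simp add: F_def mult_ac)
    finally show ?thesis .
  qed
  let ?J = "\<lambda>r n. \<integral>z. \<bar>(\<Sum>k<n. r (F ((U ^^ k) z))) / real n\<bar> \<partial>?N"
  show ?thesis
    unfolding c_def[THEN fun_cong, symmetric]
  proof (rule real_tendsto_sandwich0)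
    fix n :: nat
    define A where "A = (\<lambda>z. (\<Sum>k<n. F ((U ^^ k) z)) / of_nat n)"
    have Am[measurable]: "A \<in> borel_measurable ?N" unfolding A_def by measurable
    have Ab: "cmod (A z) \<le> C * C" if z: "z \<in> space ?N" for z
    proof (cases "n = 0")
      case False
      have "cmod (\<Sum>k<n. F ((U ^^ k) z)) \<le> (\<Sum>k<n. C * C)"
        by (intro order_trans[OF norm_sum] sum_mono Fb UkSp z)
      then show ?thesis using False by (simp add: A_def norm_divide field_simps)
    qed (simp add: A_def)
    have intA: "integrable ?N A"
      by (rule P.P.integrable_const_bound[where B="C * C"]) (auto intro: Ab)
    have ReA: "Re (A z) = (\<Sum>k<n. Re (F ((U ^^ k) z))) / real n" for z
      by (simp add: A_def)
    have ImA: "Im (A z) = (\<Sum>k<n. Im (F ((U ^^ k) z))) / real n" for z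
      by (simp add: A_def)
    have bFF: "integrable ?N (\<lambda>z. F ((U ^^ h) z) * cnj (F z))" for h
      by (rule P.P.integrable_const_bound[where B="(C * C) * (C * C)"])
         (auto simp: norm_mult intro!: mult_mono Fb UkSp)
    have "complex_of_real ((\<Sum>h<n. (cmod (c h))\<^sup>2) / real n)
        = (\<Sum>h<n. \<integral>z. F ((U ^^ h) z) * cnj (F z) \<partial>?N) / of_nat n"
      by (simp only: of_real_divide of_real_sum c2 of_real_of_nat_eq)
    also have "\<dots> = (\<integral>z. A z * cnj (F z) \<partial>?N)"
    proof -
      have "(\<integral>z. A z * cnj (F z) \<partial>?N)
          = (\<integral>z. (\<Sum>h<n. F ((U ^^ h) z) * cnj (F z)) / of_nat n \<partial>?N)"
        by (simp only: A_def times_divide_eq_left sum_distrib_right)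
      also have "\<dots> = (\<integral>z. (\<Sum>h<n. F ((U ^^ h) z) * cnj (F z)) \<partial>?N) / of_nat n"
        by (rule integral_divide_zero)
      also have "(\<integral>z. (\<Sum>h<n. F ((U ^^ h) z) * cnj (F z)) \<partial>?N)
          = (\<Sum>h<n. \<integral>z. F ((U ^^ h) z) * cnj (F z) \<partial>?N)"
        by (rule Bochner_Integration.integral_sum) (rule bFF)
      finally show ?thesis by (rule sym)
    qed
    finally have eq: "complex_of_real ((\<Sum>h<n. (cmod (c h))\<^sup>2) / real n)
        = (\<integral>z. A z * cnj (F z) \<partial>?N)" .
    have "(\<Sum>h<n. (cmod (c h))\<^sup>2) / real n = cmod (complex_of_real ((\<Sum>h<n. (cmod (c h))\<^sup>2) / real n))"
      by (subst norm_of_real) (simp add: sum_nonneg)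
    also have "\<dots> \<le> (\<integral>z. cmod (A z * cnj (F z)) \<partial>?N)"
      unfolding eq by (rule integral_norm_bound)
    also have "\<dots> \<le> (\<integral>z. C * C * (\<bar>Re (A z)\<bar> + \<bar>Im (A z)\<bar>) \<partial>?N)"
    proof (rule integral_mono)
      show "integrable ?N (\<lambda>z. cmod (A z * cnj (F z)))"
        by (rule P.P.integrable_const_bound[where B="(C * C) * (C * C)"])
           (auto simp: norm_mult intro!: mult_mono Fb Ab)
      show "integrable ?N (\<lambda>z. C * C * (\<bar>Re (A z)\<bar> + \<bar>Im (A z)\<bar>))"
        by (intro integrable_mult_right Bochner_Integration.integrable_add integrable_abs
            integrable_Re integrable_Im intA)
      fix z assume z: "z \<in> space ?N"
      show "cmod (A z * cnj (F z)) \<le> C * C * (\<bar>Re (A z)\<bar> + \<bar>Im (A z)\<bar>)"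
        unfolding norm_mult using Fb[OF z] cmod_le[of "A z"] C0
        by (subst mult.commute[of "C * C"]) (auto intro!: mult_mono)
    qed
    also have "\<dots> = C * C * (?J Re n + ?J Im n)"
      unfolding ReA[symmetric] ImA[symmetric]
      by (subst integral_mult_right_zero, subst Bochner_Integration.integral_add)
         (auto intro!: integrable_abs integrable_Re integrable_Im intA)
    finally show "(\<Sum>h<n. (cmod (c h))\<^sup>2) / real n \<le> C * C * (?J Re n + ?J Im n)" .
  next
    show "(\<lambda>n. C * C * (?J Re n + ?J Im n)) \<longlonglongrightarrow> 0"
      using tendsto_mult_left[OF tendsto_add[OF L1[of Re] L1[of Im]], of "C * C"] by simp
  qed (simp add: sum_nonneg)
qed

end

section \<open>Polynomial averages of a weakly mixing action of the integers\<close>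

context prob_space
begin

text \<open>Finitely many lags contribute nothing in the limit, so no bound is needed there.\<close>

lemma van_der_corput_exceptions:
  assumes u: "seq_bdd C u" and E: "finite (E :: int set)"
    and corr: "\<And>h. int h \<notin> E \<Longrightarrow> correl_le u (int h) (\<beta> h)"
    and \<beta>0: "\<And>h. \<beta> h \<ge> 0"
    and \<beta>: "(\<lambda>H. (\<Sum>h<H. \<beta> h) / real H) \<longlonglongrightarrow> 0"
  shows "L2_null (\<lambda>N x. cesaro N (\<lambda>n. u n x))"
proof -
  define E' where "E' = {h. int h \<in> E}"
  have E': "finite E'" unfolding E'_def
    using finite_vimageI[OF E, of int] by (simp add: vimage_def)
  define \<beta>' where "\<beta>' = (\<lambda>h. \<beta> h + (if h \<in> E' then C * C else 0))"
  have CC: "C * C \<ge> 0" by simp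
  show ?thesis
  proof (rule van_der_corput[OF u, of \<beta>'])
    fix h
    show "correl_le u (int h) (\<beta>' h)"
    proof (cases "h \<in> E'")
      case True
      have "correl_le u (int h) (C * C)" by (rule correl_le_trivial[OF u])
      then show ?thesis using True \<beta>0[of h] unfolding correl_le_def \<beta>'_def
        by (auto elim!: eventually_mono)
    next
      case False
      then show ?thesis using corr[of h] by (simp add: \<beta>'_def E'_def)
    qed
    show "\<beta>' h \<ge> 0" using \<beta>0[of h] by (simp add: \<beta>'_def)
  next
    have "(\<lambda>H. real (card E') * (C * C) / real H) \<longlonglongrightarrow> 0" by (rule lim_const_over_n)
    from tendsto_add[OF \<beta> this]
    have lim: "(\<lambda>H. (\<Sum>h<H. \<beta> h) / real H + real (card E') * (C * C) / real H) \<longlonglongrightarrow> 0" by simp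
    show "(\<lambda>H. (\<Sum>h<H. \<beta>' h) / real H) \<longlonglongrightarrow> 0"
    proof (rule real_tendsto_sandwich0[OF _ _ lim])
      fix H :: nat
      show "0 \<le> (\<Sum>h<H. \<beta>' h) / real H"
        using \<beta>0 by (intro divide_nonneg_nonneg sum_nonneg) (auto simp: \<beta>'_def)
      have "(\<Sum>h<H. if h \<in> E' then C * C else 0) \<le> (\<Sum>h\<in>E'. C * C)"
        using E' CC by (simp only: sum.inter_filter[symmetric] finite_lessThan) (rule sum_mono2, auto)
      then have "(\<Sum>h<H. \<beta>' h) \<le> (\<Sum>h<H. \<beta> h) + real (card E') * (C * C)"
        by (simp add: \<beta>'_def sum.distrib)
      from divide_right_mono[OF this, of "real H"]
      show "(\<Sum>h<H. \<beta>' h) / real H \<le> (\<Sum>h<H. \<beta> h) / real H + real (card E') * (C * C) / real H"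
        by (simp add: add_divide_distrib)
    qed
  qed
qed

lemma L2_null_cong:
  assumes "\<And>N x. N > 0 \<Longrightarrow> x \<in> space M \<Longrightarrow> F N x = G N x" "L2_null F"
  shows "L2_null G"
  unfolding L2_null_def
proof (rule Lim_transform_eventually[OF assms(2)[unfolded L2_null_def]])
  show "\<forall>\<^sub>F N in sequentially. (\<integral>x. (cmod (F N x))\<^sup>2 \<partial>M) = (\<integral>x. (cmod (G N x))\<^sup>2 \<partial>M)"
    using eventually_gt_at_top[of 0]
    by eventually_elim (intro Bochner_Integration.integral_cong, auto simp: assms(1))
qed

lemma bdd_by_common:
  assumes "finite Q" "\<And>q. q \<in> Q \<Longrightarrow> bdd_fun M (G q)"
  obtains C where "C \<ge> 1" "\<And>q. q \<in> Q \<Longrightarrow> bdd_by M C (G q)"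
proof -
  have "\<exists>C\<ge>1. \<forall>q\<in>Q. bdd_by M C (G q)"
    using assms
  proof (induction Q)
    case (insert q Q)
    obtain C where C: "C \<ge> 1" "\<forall>q\<in>Q. bdd_by M C (G q)" using insert by auto
    obtain D where D: "bdd_by M D (G q)" using insert.prems[of q] by (auto simp: bdd_fun_def)
    show ?case
      by (rule exI[of _ "max C D"]) (use C D in \<open>auto intro: bdd_by_mono\<close>)
  qed auto
  then show ?thesis using that by blast
qed

end

text \<open>A measure preserving action of an abelian group, written additively.  The laws are required
  on the space only.\<close>

locale prob_action = prob_space M for M :: "'a measure" +
  fixes act :: "'g::ab_group_add \<Rightarrow> 'a \<Rightarrow> 'a"
  assumes act_measurable [measurable]: "act g \<in> measurable M M"
    and act_distr: "distr M M (act g) = M"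
    and act_zero: "x \<in> space M \<Longrightarrow> act 0 x = x"
    and act_add: "x \<in> space M \<Longrightarrow> act (g + k) x = act g (act k x)"
begin

lemma act_space: "x \<in> space M \<Longrightarrow> act g x \<in> space M"
  using act_measurable by (rule measurable_space)

lemma bdd_by_act: "bdd_by M C f \<Longrightarrow> bdd_by M C (\<lambda>x. f (act g x))"
  by (auto simp: bdd_by_def act_space)

lemma bdd_fun_act: "bdd_fun M f \<Longrightarrow> bdd_fun M (\<lambda>x. f (act g x))"
  by (auto simp: bdd_fun_def intro: bdd_by_act)

lemma integral_act:
  fixes f :: "'a \<Rightarrow> 'b::{banach, second_countable_topology}"
  assumes "f \<in> borel_measurable M"
  shows "(\<integral>x. f (act g x) \<partial>M) = (\<integral>x. f x \<partial>M)"
  using integral_distr[OF act_measurable assms, of g] act_distr by simp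

end

text \<open>The action of a single weakly mixing map.  Weak mixing is used only in the form that the
  correlations of functions of mean zero tend to \<open>0\<close> in the mean.\<close>

locale weak_mixing_action = prob_action M act for M :: "'a measure" and act :: "int \<Rightarrow> 'a \<Rightarrow> 'a" +
  assumes mixing: "bdd_fun M G \<Longrightarrow> (\<integral>x. G x \<partial>M) = 0 \<Longrightarrow>
    (\<lambda>H. (\<Sum>h<H. (cmod (\<integral>x. G (act (int h) x) * cnj (G x) \<partial>M))\<^sup>2) / real H) \<longlonglongrightarrow> 0"
begin

lemma mixing_multiple:
  assumes G: "bdd_fun M G" and mean: "(\<integral>x. G x \<partial>M) = 0" and a: "a \<noteq> 0"
  shows "(\<lambda>H. (\<Sum>h<H. cmod (\<integral>x. G (act (a * int h) x) * cnj (G x) \<partial>M)) / real H) \<longlonglongrightarrow> 0"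
proof -
  define c where "c = (\<lambda>k. cmod (\<integral>x. G (act k x) * cnj (G x) \<partial>M))"
  have "c (- k) = c k" for k
  proof -
    have "(\<integral>x. G (act (- k) x) * cnj (G x) \<partial>M) = (\<integral>x. G (act (- k) (act k x)) * cnj (G (act k x)) \<partial>M)"
      by (rule integral_act[symmetric]) (intro bdd_fun_measurable bdd_fun_mult bdd_fun_cnj bdd_fun_act G)
    also have "\<dots> = (\<integral>x. cnj (G (act k x) * cnj (G x)) \<partial>M)"
      by (intro Bochner_Integration.integral_cong) (simp_all flip: act_add add: act_zero mult.commute)
    also have "\<dots> = cnj (\<integral>x. G (act k x) * cnj (G x) \<partial>M)" by (rule Bochner_Integration.integral_cnj)
    finally show ?thesis by (simp only: c_def complex_mod_cnj)
  qed
  moreover have "int (nat \<bar>a\<bar> * h) = (if a \<ge> 0 then a * int h else - (a * int h))" for h by simp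
  ultimately have c_abs: "c (a * int h) = c (int (nat \<bar>a\<bar> * h))" for h by metis
  define b where "b = nat \<bar>a\<bar>"
  have b: "b > 0" using a by (simp add: b_def)
  have lim: "(\<lambda>H. (\<Sum>h<H. (c (int h))\<^sup>2) / real H) \<longlonglongrightarrow> 0"
    unfolding c_def by (rule mixing[OF G mean])
  \<comment> \<open>The multiples of \<open>b\<close> have positive density, so the mean over them tends to \<open>0\<close> as well.\<close>
  have "strict_mono (\<lambda>H. b * H)" using b by (simp add: strict_mono_def)
  from LIMSEQ_subseq_LIMSEQ[OF lim this]
  have "(\<lambda>H. (\<Sum>h<b * H. (c (int h))\<^sup>2) / real (b * H)) \<longlonglongrightarrow> 0" by (simp add: o_def)
  from tendsto_mult_left[OF this, of "real b"]
  have lim2: "(\<lambda>H. (\<Sum>h<b * H. (c (int h))\<^sup>2) / real H) \<longlonglongrightarrow> 0" using b by simp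
  have "(\<lambda>H. ((\<Sum>h<H. c (a * int h)) / real H)\<^sup>2) \<longlonglongrightarrow> 0"
  proof (rule real_tendsto_sandwich0[OF _ _ lim2])
    fix H :: nat
    have "((\<Sum>h<H. c (a * int h)) / real H)\<^sup>2 \<le> (\<Sum>h<H. (c (a * int h))\<^sup>2) / real H"
      using sum_squared_le_sum_of_squares[of "\<lambda>h. c (a * int h)" "{..<H}"]
      by (cases "H = 0") (simp_all add: power_divide field_simps power2_eq_square)
    also have "(\<Sum>h<H. (c (a * int h))\<^sup>2) = (\<Sum>j\<in>(\<lambda>h. b * h) ` {..<H}. (c (int j))\<^sup>2)"
      using b by (subst sum.reindex) (auto simp: inj_on_def c_abs b_def)
    also have "\<dots> \<le> (\<Sum>h<b * H. (c (int h))\<^sup>2)"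
      using b by (intro sum_mono2) auto
    finally show "((\<Sum>h<H. c (a * int h)) / real H)\<^sup>2 \<le> (\<Sum>h<b * H. (c (int h))\<^sup>2) / real H"
      by (simp add: divide_right_mono)
  qed simp
  from tendsto_real_sqrt[OF this]
  have "(\<lambda>H. \<bar>(\<Sum>h<H. c (a * int h)) / real H\<bar>) \<longlonglongrightarrow> 0" by simp
  then show ?thesis unfolding c_def by (rule tendsto_rabs_zero_cancel)
qed

text \<open>The product at time \<open>n\<close> of the iterates \<open>q n\<close> applied to the functions \<open>G q\<close>.\<close>

definition poly_prod :: "rat poly set \<Rightarrow> (rat poly \<Rightarrow> 'a \<Rightarrow> complex) \<Rightarrow> int \<Rightarrow> 'a \<Rightarrow> complex" where
  "poly_prod Q G n x = (\<Prod>q\<in>Q. G q (act (ival q n) x))"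

lemma poly_prod_bdd:
  assumes "\<And>q. q \<in> Q \<Longrightarrow> bdd_by M C (G q)"
  shows "bdd_by M (C ^ card Q) (poly_prod Q G n)"
  using bdd_by_prod[of Q M "\<lambda>_. C" "\<lambda>q x. G q (act (ival q n) x)"] assms
  by (simp add: poly_prod_def[abs_def] bdd_by_act)

lemma poly_prod_cesaro_bdd:
  assumes "finite Q" "\<And>q. q \<in> Q \<Longrightarrow> bdd_fun M (G q)"
  shows "bdd_fun M (\<lambda>x. cesaro N (\<lambda>n. poly_prod Q G n x))"
proof -
  obtain C where "\<And>q. q \<in> Q \<Longrightarrow> bdd_by M C (G q)" using bdd_by_common[where G=G, OF assms] by blast
  from bdd_by_cesaro[OF poly_prod_bdd[OF this]] show ?thesis by (rule bdd_funI)
qed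

text \<open>The conclusion of Bergelson's theorem for the family \<open>Q\<close>: averages of the products tend to the
  product of the means in \<open>L\<^sup>2\<close>.\<close>

definition pet_limit :: "rat poly set \<Rightarrow> bool" where
  "pet_limit Q \<longleftrightarrow> (\<forall>G. (\<forall>q\<in>Q. bdd_fun M (G q)) \<longrightarrow>
     L2_null (\<lambda>N x. cesaro N (\<lambda>n. poly_prod Q G n x) - (\<Prod>q\<in>Q. \<integral>x. G q x \<partial>M)))"

text \<open>Replacing the functions by their means one at a time reduces the general case to the one
  where some function has mean zero.\<close>

lemma pet_limitI:
  assumes Q: "finite Q"
    and zero: "\<And>G q. \<lbrakk>\<And>q. q \<in> Q \<Longrightarrow> bdd_fun M (G q); q \<in> Q; (\<integral>x. G q x \<partial>M) = 0\<rbrakk>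
      \<Longrightarrow> L2_null (\<lambda>N x. cesaro N (\<lambda>n. poly_prod Q G n x))"
  shows "pet_limit Q"
  unfolding pet_limit_def
proof (intro allI impI)
  fix G :: "rat poly \<Rightarrow> 'a \<Rightarrow> complex" assume G: "\<forall>q\<in>Q. bdd_fun M (G q)"
  define K where "K = (\<lambda>P q. if q \<in> P then (\<lambda>_. \<integral>x. G q x \<partial>M) else G q)"
  have Kb: "bdd_fun M (K P q)" if "q \<in> Q" for P q using G that by (simp add: K_def bdd_fun_const)
  have "L2_null (\<lambda>N x. cesaro N (\<lambda>n. poly_prod Q G n x) - cesaro N (\<lambda>n. poly_prod Q (K P) n x))"
    if "P \<subseteq> Q" for P
    using finite_subset[OF that Q] that
  proof (induction P)
    case empty
    have "K {} = G" by (rule ext) (simp add: K_def)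
    then show ?case by (simp add: L2_null_def)
  next
    case (insert r P)
    define H where "H = (K P)(r := (\<lambda>x. G r x - (\<integral>x. G r x \<partial>M)))"
    have r: "r \<in> Q" "r \<notin> P" using insert by auto
    have Hb: "bdd_fun M (H q)" if "q \<in> Q" for q
      using Kb[OF that, of P] G r by (auto simp: H_def bdd_fun_diff bdd_fun_const)
    have "(\<integral>x. H r x \<partial>M) = 0"
      using integrable_bdd_fun[of "G r"] G r prob_space by (simp add: H_def)
    from zero[of H r, OF Hb r(1) this]
    have null: "L2_null (\<lambda>N x. cesaro N (\<lambda>n. poly_prod Q H n x))" .
    have pp: "poly_prod Q H n x = poly_prod Q (K P) n x - poly_prod Q (K (insert r P)) n x" for n x
    proof -
      have rest: "(\<Prod>q\<in>Q - {r}. F q (act (ival q n) x)) = (\<Prod>q\<in>Q - {r}. K P q (act (ival q n) x))"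
        if "\<And>q. q \<noteq> r \<Longrightarrow> F q = K P q" for F
        by (intro prod.cong refl) (simp add: that)
      have "poly_prod Q F n x = F r (act (ival r n) x) * (\<Prod>q\<in>Q - {r}. K P q (act (ival q n) x))"
        if "\<And>q. q \<noteq> r \<Longrightarrow> F q = K P q" for F
        unfolding poly_prod_def by (subst prod.remove[OF Q r(1)]) (intro arg_cong2[where f="(*)"] refl rest that)
      from this[of H] this[of "K P"] this[of "K (insert r P)"]
      show ?thesis using r by (simp add: H_def K_def left_diff_distrib)
    qed
    have IH: "L2_null (\<lambda>N x. cesaro N (\<lambda>n. poly_prod Q G n x) - cesaro N (\<lambda>n. poly_prod Q (K P) n x))"
      using insert by simp
    have "L2_null (\<lambda>N x. (cesaro N (\<lambda>n. poly_prod Q G n x) - cesaro N (\<lambda>n. poly_prod Q (K P) n x))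
        + cesaro N (\<lambda>n. poly_prod Q H n x))"
      by (rule L2_null_add[OF _ _ IH null])
         (use G in \<open>auto intro!: bdd_fun_diff poly_prod_cesaro_bdd Q Kb Hb\<close>)
    then show ?case by (simp only: pp cesaro_diff) simp
  qed
  from this[OF order_refl]
  show "L2_null (\<lambda>N x. cesaro N (\<lambda>n. poly_prod Q G n x) - (\<Prod>q\<in>Q. \<integral>x. G q x \<partial>M))"
    by (rule L2_null_cong[rotated]) (simp add: poly_prod_def K_def cesaro_const)
qed

text \<open>The polynomials occurring in the correlation of \<open>poly_prod Q G\<close> at lag \<open>h\<close>.\<close>

definition shifted_family :: "rat poly set \<Rightarrow> int \<Rightarrow> rat poly set" where
  "shifted_family Q h = Q \<union> shift_poly h ` {q \<in> Q. degree q \<ge> 2}"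

text \<open>The functions attached to the members of \<open>shifted_family Q h\<close> in the product of
  \<open>poly_prod Q G (n + h)\<close> and the conjugate of \<open>poly_prod Q F n\<close>.  For a linear \<open>q\<close> the
  polynomials \<open>q (n + h)\<close> and \<open>q n\<close> differ by a constant, and their two functions are merged.\<close>

definition shifted_functions ::
    "rat poly set \<Rightarrow> (rat poly \<Rightarrow> 'a \<Rightarrow> complex) \<Rightarrow> (rat poly \<Rightarrow> 'a \<Rightarrow> complex) \<Rightarrow> int
      \<Rightarrow> rat poly \<Rightarrow> 'a \<Rightarrow> complex" where
  "shifted_functions Q G F h q =
     (if q \<in> Q then
        if degree q \<ge> 2 then (\<lambda>x. cnj (F q x))
        else (\<lambda>x. G q (act ((ival q 1 - ival q 0) * h) x) * cnj (F q x))
      else G (shift_poly (- h) q))"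

lemma shifted_functions_bdd:
  assumes "C \<ge> 1" "\<And>q. q \<in> Q \<Longrightarrow> bdd_by M C (G q)" "\<And>q. q \<in> Q \<Longrightarrow> bdd_by M C (F q)"
    "q \<in> shifted_family Q h"
  shows "bdd_by M (C * C) (shifted_functions Q G F h q)"
proof -
  have "C \<le> C * C" using assms(1) by simp
  note mono = bdd_by_mono[OF _ this]
  show ?thesis
    using assms(2-4)
    by (auto simp: shifted_functions_def shifted_family_def shift_poly_inverse
        intro!: bdd_by_mult bdd_by_act bdd_by_cnj intro: mono bdd_by_cnj)
qed

lemma poly_prod_correlation:
  assumes Q: "finite Q" "\<And>q. q \<in> Q \<Longrightarrow> integer_polynomial q"
    and disj: "Q \<inter> shift_poly h ` {q \<in> Q. degree q \<ge> 2} = {}" and x: "x \<in> space M"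
  shows "poly_prod Q G (n + h) x * cnj (poly_prod Q F n x)
    = poly_prod (shifted_family Q h) (shifted_functions Q G F h) n x"
proof -
  let ?P = "{q \<in> Q. degree q \<ge> 2}" and ?G = "shifted_functions Q G F h"
  have "poly_prod (shifted_family Q h) ?G n x
     = (\<Prod>q\<in>Q. ?G q (act (ival q n) x)) * (\<Prod>q\<in>shift_poly h ` ?P. ?G q (act (ival q n) x))"
    unfolding poly_prod_def shifted_family_def using Q disj by (intro prod.union_disjoint) auto
  also have "(\<Prod>q\<in>shift_poly h ` ?P. ?G q (act (ival q n) x))
     = (\<Prod>q\<in>?P. ?G (shift_poly h q) (act (ival (shift_poly h q) n) x))"
    by (subst prod.reindex) (auto simp: inj_on_def dest: inj_shift_poly)
  also have "\<dots> = (\<Prod>q\<in>?P. G q (act (ival q (n + h)) x))"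
  proof (intro prod.cong refl)
    fix q assume "q \<in> ?P"
    then have "shift_poly h q \<notin> Q" using disj by blast
    then show "?G (shift_poly h q) (act (ival (shift_poly h q) n) x) = G q (act (ival q (n + h)) x)"
      by (simp add: shifted_functions_def shift_poly_inverse ival_shift_poly)
  qed
  also have "\<dots> = (\<Prod>q\<in>Q. if degree q \<ge> 2 then G q (act (ival q (n + h)) x) else 1)"
    by (rule prod.inter_filter[OF Q(1)])
  also have "(\<Prod>q\<in>Q. ?G q (act (ival q n) x)) * \<dots>
     = (\<Prod>q\<in>Q. G q (act (ival q (n + h)) x) * cnj (F q (act (ival q n) x)))"
    unfolding prod.distrib[symmetric]
  proof (intro prod.cong refl)
    fix q assume q: "q \<in> Q"
    show "?G q (act (ival q n) x) * (if degree q \<ge> 2 then G q (act (ival q (n + h)) x) else 1)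
        = G q (act (ival q (n + h)) x) * cnj (F q (act (ival q n) x))"
    proof (cases "degree q \<ge> 2")
      case False
      then have "ival q (n + h) = (ival q 1 - ival q 0) * h + ival q n"
        using ival_linear[of q n h] Q(2)[OF q] by simp
      then show ?thesis using False q x by (simp add: shifted_functions_def act_add)
    qed (use q in \<open>simp add: shifted_functions_def\<close>)
  qed
  finally show ?thesis by (simp add: poly_prod_def prod.distrib)
qed

text \<open>Integrals of such products are unchanged when a member \<open>r\<close> is subtracted from the family.\<close>

lemma integral_poly_prod_diff:
  assumes Q: "finite Q" "r \<in> Q" "\<And>q. q \<in> Q \<Longrightarrow> integer_polynomial q"
    and G: "\<And>q. q \<in> Q \<Longrightarrow> bdd_fun M (G q)"
  shows "(\<integral>x. poly_prod Q G n x \<partial>M)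
    = (\<integral>x. G r x * poly_prod ((\<lambda>q. q - r) ` (Q - {r})) (\<lambda>q. G (q + r)) n x \<partial>M)"
proof -
  have "(\<integral>x. poly_prod Q G n x \<partial>M) = (\<integral>x. poly_prod Q G n (act (- ival r n) x) \<partial>M)"
    unfolding poly_prod_def
    by (rule integral_act[symmetric]) (intro bdd_fun_measurable bdd_fun_prod bdd_fun_act G)
  also have "\<dots> = (\<integral>x. G r x * poly_prod ((\<lambda>q. q - r) ` (Q - {r})) (\<lambda>q. G (q + r)) n x \<partial>M)"
  proof (rule Bochner_Integration.integral_cong[OF refl])
    fix x assume x: "x \<in> space M"
    have "poly_prod Q G n (act (- ival r n) x) = (\<Prod>q\<in>Q. G q (act (ival (q - r) n) x))"
      unfolding poly_prod_def
      using Q(2,3) x by (intro prod.cong refl) (simp flip: act_add add: ival_diff)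
    also have "\<dots> = G r x * (\<Prod>q\<in>Q - {r}. G q (act (ival (q - r) n) x))"
      using x by (subst prod.remove[OF Q(1,2)]) (simp add: ival_def act_zero)
    also have "(\<Prod>q\<in>Q - {r}. G q (act (ival (q - r) n) x))
        = poly_prod ((\<lambda>q. q - r) ` (Q - {r})) (\<lambda>q. G (q + r)) n x"
      unfolding poly_prod_def by (subst prod.reindex) (auto simp: inj_on_def)
    finally show "poly_prod Q G n (act (- ival r n) x)
        = G r x * poly_prod ((\<lambda>q. q - r) ` (Q - {r})) (\<lambda>q. G (q + r)) n x" .
  qed
  finally show ?thesis .
qed

lemma integral_poly_prod_limit:
  assumes Q: "finite Q" "r \<in> Q" "\<And>q. q \<in> Q \<Longrightarrow> integer_polynomial q"
    and G: "\<And>q. q \<in> Q \<Longrightarrow> bdd_fun M (G q)"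
    and pet: "pet_limit ((\<lambda>q. q - r) ` (Q - {r}))"
  shows "(\<lambda>N. cesaro N (\<lambda>n. \<integral>x. poly_prod Q G n x \<partial>M)) \<longlonglongrightarrow> (\<Prod>q\<in>Q. \<integral>x. G q x \<partial>M)"
proof -
  define Q' where "Q' = (\<lambda>q. q - r) ` (Q - {r})"
  define G' where "G' = (\<lambda>q. G (q + r))"
  have Q': "finite Q'" using Q by (simp add: Q'_def)
  have G': "bdd_fun M (G' q)" if "q \<in> Q'" for q
    using that G by (auto simp: Q'_def G'_def)
  define L where "L = (\<Prod>q\<in>Q'. \<integral>x. G' q x \<partial>M)"
  have L: "(\<Prod>q\<in>Q. \<integral>x. G q x \<partial>M) = (\<integral>x. G r x \<partial>M) * L"
  proof -
    have "L = (\<Prod>q\<in>Q - {r}. \<integral>x. G q x \<partial>M)"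
      unfolding L_def Q'_def G'_def by (subst prod.reindex) (auto simp: inj_on_def)
    then show ?thesis using prod.remove[OF Q(1,2)] by simp
  qed
  have "L2_null (\<lambda>N x. cesaro N (\<lambda>n. poly_prod Q' G' n x) - L)"
    using pet G' unfolding pet_limit_def Q'_def[symmetric] L_def by blast
  from L2_null_integral_mult[OF G[OF Q(2)] _ this]
  have lim: "(\<lambda>N. \<integral>x. G r x * (cesaro N (\<lambda>n. poly_prod Q' G' n x) - L) \<partial>M) \<longlonglongrightarrow> 0"
    by (simp add: bdd_fun_diff bdd_fun_const poly_prod_cesaro_bdd Q' G')
  obtain C where C: "\<And>q. q \<in> Q' \<Longrightarrow> bdd_by M C (G' q)" using bdd_by_common[where G=G', OF Q' G'] by blast
  obtain D where D: "bdd_by M D (G r)" using G[OF Q(2)] by (auto simp: bdd_fun_def)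
  have eq: "(\<integral>x. G r x * (cesaro N (\<lambda>n. poly_prod Q' G' n x) - L) \<partial>M)
      = cesaro N (\<lambda>n. \<integral>x. poly_prod Q G n x \<partial>M) - (\<integral>x. G r x \<partial>M) * L" for N
  proof -
    have b: "bdd_by M (D * C ^ card Q') (\<lambda>x. G r x * poly_prod Q' G' n x)" for n
      by (intro bdd_by_mult D poly_prod_bdd C)
    have "(\<integral>x. G r x * (cesaro N (\<lambda>n. poly_prod Q' G' n x) - L) \<partial>M)
        = (\<integral>x. cesaro N (\<lambda>n. G r x * poly_prod Q' G' n x) - G r x * L \<partial>M)"
      by (simp add: right_diff_distrib cesaro_cmult)
    also have "\<dots> = (\<integral>x. cesaro N (\<lambda>n. G r x * poly_prod Q' G' n x) \<partial>M) - (\<integral>x. G r x \<partial>M) * L"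
      using integrable_bdd_by[OF bdd_by_cesaro[OF b]] integrable_bdd_by[OF D] by simp
    also have "(\<integral>x. cesaro N (\<lambda>n. G r x * poly_prod Q' G' n x) \<partial>M)
        = cesaro N (\<lambda>n. \<integral>x. G r x * poly_prod Q' G' n x \<partial>M)"
      by (rule integral_cesaro[OF b])
    also have "\<dots> = cesaro N (\<lambda>n. \<integral>x. poly_prod Q G n x \<partial>M)"
      unfolding Q'_def G'_def by (intro cesaro_cong integral_poly_prod_diff[symmetric] Q G)
    finally show ?thesis .
  qed
  from lim show ?thesis unfolding eq L by (rule LIM_zero_cancel)
qed

text \<open>Bergelson's theorem.  By van der Corput's lemma it suffices to bound the correlations.  After
  subtraction of a polynomial \<open>r\<close> of least degree the family of the correlation at lag \<open>h\<close> has
  smaller weight, so by induction that correlation tends to a product of means.  One of these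
  means belongs to the function \<open>G q0\<close> of mean zero: it vanishes if \<open>q0\<close> is nonlinear, and if \<open>q0\<close>
  is linear it is a correlation of \<open>G q0\<close> at a multiple of \<open>h\<close>, which tends to \<open>0\<close> in the mean.\<close>

theorem polynomial_ergodic_theorem:
  assumes "finite Q" "ess_distinct_family Q" "\<And>q. q \<in> Q \<Longrightarrow> integer_polynomial q \<and> degree q > 0"
  shows "pet_limit Q"
  using assms
proof (induction Q rule: weight_induct)
  case (less Q)
  note Q = less.prems
  show ?case
  proof (rule pet_limitI[OF Q(1)])
    fix G :: "rat poly \<Rightarrow> 'a \<Rightarrow> complex" and q0
    assume G: "\<And>q. q \<in> Q \<Longrightarrow> bdd_fun M (G q)" and q0: "q0 \<in> Q" "(\<integral>x. G q0 x \<partial>M) = 0"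
    obtain C where C: "C \<ge> 1" "\<And>q. q \<in> Q \<Longrightarrow> bdd_by M C (G q)" using bdd_by_common[where G=G, OF Q(1) G] by blast
    obtain r where r: "r \<in> Q" "\<And>q. q \<in> Q \<Longrightarrow> degree r \<le> degree q"
      using ex_has_least_nat[of "\<lambda>q. q \<in> Q" q0 degree] q0 by blast
    let ?Q = "shifted_family Q" and ?G = "shifted_functions Q G G"
    define E where "E = {h. \<not> (ess_distinct_family (?Q h) \<and> Q \<inter> shift_poly h ` {q \<in> Q. degree q \<ge> 2} = {})}"
    have E: "finite E"
      unfolding E_def shifted_family_def by (rule ess_distinct_family_shift[OF Q(1,2)])
    define D where "D = (C * C) ^ (2 * card Q)"
    define b where "b = (\<lambda>h. cmod (\<integral>x. ?G h q0 x \<partial>M))"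
    have finQ: "finite (?Q h)" for h using Q(1) by (simp add: shifted_family_def)
    have Gb: "bdd_by M (C * C) (?G h q)" if "q \<in> ?Q h" for h q
      by (rule shifted_functions_bdd[OF C C(2) that])
    show "L2_null (\<lambda>N x. cesaro N (\<lambda>n. poly_prod Q G n x))"
    proof (rule van_der_corput_exceptions[where C="C ^ card Q" and E=E and \<beta>="\<lambda>h. D * b (int h)"])
      show "seq_bdd (C ^ card Q) (poly_prod Q G)"
        unfolding seq_bdd_def by (intro allI poly_prod_bdd C)
      show "finite E" by (rule E)
      show "D * b (int h) \<ge> 0" for h using C(1) by (simp add: D_def b_def)
    next
      fix h :: nat assume "int h \<notin> E"
      then have good: "ess_distinct_family (?Q (int h))"
        "Q \<inter> shift_poly (int h) ` {q \<in> Q. degree q \<ge> 2} = {}" by (auto simp: E_def)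
      have rQ: "r \<in> ?Q (int h)" using r by (simp add: shifted_family_def)
      have ip: "integer_polynomial q" if "q \<in> ?Q (int h)" for q
        using that Q(3) by (auto simp: shifted_family_def integer_polynomial_shift_poly)
      define Q' where "Q' = (\<lambda>q. q - r) ` (?Q (int h) - {r})"
      have "pet_limit Q'"
      proof (rule less.IH)
        show "(weight Q', weight Q) \<in> Multiset.mult less_than"
          unfolding Q'_def
        proof (rule weight_decreases[OF Q(1) r(1) _ r(2)])
          show "0 < degree r" using Q(3) r(1) by simp
          show "finite (?Q (int h) - {r})" using finQ by simp
          show "key ` (?Q (int h) - {r}) \<subseteq> key ` Q" by (auto simp: shifted_family_def)
        qed
        show "finite Q'" using finQ by (simp add: Q'_def)
        show "ess_distinct_family Q'"
          using good(1) by (auto simp: ess_distinct_family_def Q'_def)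
        show "integer_polynomial q \<and> 0 < degree q" if "q \<in> Q'" for q
          using that good(1) rQ ip by (auto simp: Q'_def ess_distinct_family_def intro: integer_polynomial_diff)
      qed
      then have "(\<lambda>N. cesaro N (\<lambda>n. \<integral>x. poly_prod (?Q (int h)) (?G (int h)) n x \<partial>M))
          \<longlonglongrightarrow> (\<Prod>q\<in>?Q (int h). \<integral>x. ?G (int h) q x \<partial>M)"
        unfolding Q'_def by (intro integral_poly_prod_limit finQ rQ ip) (auto intro: bdd_funI[OF Gb] rQ)
      moreover have "correl (poly_prod Q G) (int h) N
          = cesaro N (\<lambda>n. \<integral>x. poly_prod (?Q (int h)) (?G (int h)) n x \<partial>M)" for N
        unfolding correl_def
        by (intro cesaro_cong Bochner_Integration.integral_cong refl poly_prod_correlation Q(1) good(2))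
           (use Q(3) in simp)
      ultimately have lim: "correl (poly_prod Q G) (int h) \<longlonglongrightarrow> (\<Prod>q\<in>?Q (int h). \<integral>x. ?G (int h) q x \<partial>M)"
        by presburger
      show "correl_le (poly_prod Q G) (int h) (D * b (int h))"
      proof (rule correl_leI_tendsto[OF lim])
        have q0Q: "q0 \<in> ?Q (int h)" using q0 by (simp add: shifted_family_def)
        have one: "1 \<le> C * C" using C(1) mult_mono[of 1 C 1 C] by simp
        have cQ: "card (?Q (int h) - {q0}) \<le> 2 * card Q"
        proof -
          have "card (?Q (int h) - {q0}) \<le> card (?Q (int h))" by (intro card_mono finQ) auto
          also have "\<dots> \<le> card Q + card (shift_poly (int h) ` {q \<in> Q. degree q \<ge> 2})"
            unfolding shifted_family_def by (rule card_Un_le)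
          also have "card (shift_poly (int h) ` {q \<in> Q. degree q \<ge> 2}) \<le> card {q \<in> Q. degree q \<ge> 2}"
            using Q(1) by (intro card_image_le) simp
          also have "\<dots> \<le> card Q" using Q(1) by (intro card_mono) auto
          finally show ?thesis by simp
        qed
        have eq: "cmod (\<Prod>q\<in>?Q (int h). \<integral>x. ?G (int h) q x \<partial>M)
            = b (int h) * (\<Prod>q\<in>?Q (int h) - {q0}. cmod (\<integral>x. ?G (int h) q x \<partial>M))"
          by (subst prod.remove[OF finQ q0Q]) (simp add: norm_mult prod_norm b_def)
        have "(\<Prod>q\<in>?Q (int h) - {q0}. cmod (\<integral>x. ?G (int h) q x \<partial>M)) \<le> (\<Prod>q\<in>?Q (int h) - {q0}. C * C)"
          by (intro prod_mono conjI norm_ge_zero integral_bdd_by_le Gb) auto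
        also have "\<dots> \<le> D"
          unfolding D_def prod_constant using one cQ by (intro power_increasing) auto
        finally have "(\<Prod>q\<in>?Q (int h) - {q0}. cmod (\<integral>x. ?G (int h) q x \<partial>M)) \<le> D" .
        from mult_left_mono[OF this, of "b (int h)"]
        show "cmod (\<Prod>q\<in>?Q (int h). \<integral>x. ?G (int h) q x \<partial>M) \<le> D * b (int h)"
          unfolding eq by (simp add: b_def mult.commute)
      qed
    next
      have "(\<lambda>H. (\<Sum>h<H. b (int h)) / real H) \<longlonglongrightarrow> 0"
      proof (cases "degree q0 \<ge> 2")
        case True
        then have "b h = 0" for h using q0 by (simp add: b_def shifted_functions_def)
        then show ?thesis by simp
      next
        case False
        then have "degree q0 = 1" using Q(3)[OF q0(1)] by simp
        then have "ival q0 1 - ival q0 0 \<noteq> 0" using Q(3)[OF q0(1)] by (intro ival_linear_nonzero) auto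
        from mixing_multiple[OF G[OF q0(1)] q0(2) this]
        show ?thesis using False q0 by (simp add: b_def shifted_functions_def)
      qed
      from tendsto_mult_left[OF this, of D]
      show "(\<lambda>H. (\<Sum>h<H. D * b (int h)) / real H) \<longlonglongrightarrow> 0"
        by (simp add: sum_distrib_left)
    qed
  qed
qed

end

section \<open>Products along linear and polynomial iterates\<close>

text \<open>An action of an abelian group together with a weakly mixing action of the integers by some of
  its members.  The action laws are required of \<open>act (s k)\<close>, not of \<open>s\<close> itself.\<close>

locale mixing_subaction = prob_action M act + S: weak_mixing_action M "\<lambda>k. act (s k)"
  for M :: "'a measure" and act :: "'g::ab_group_add \<Rightarrow> 'a \<Rightarrow> 'a" and s :: "int \<Rightarrow> 'g"
begin

text \<open>A product along linear iterates \<open>r i n\<close> and polynomial iterates \<open>s (q n)\<close>, the latter with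
  the common additional iterate \<open>w n\<close>.  Linear iterates are additive maps of the integers into the
  acting group.\<close>

definition mixed_prod :: "nat \<Rightarrow> (nat \<Rightarrow> int \<Rightarrow> 'g) \<Rightarrow> (nat \<Rightarrow> 'a \<Rightarrow> complex) \<Rightarrow> (int \<Rightarrow> 'g)
    \<Rightarrow> rat poly set \<Rightarrow> (rat poly \<Rightarrow> 'a \<Rightarrow> complex) \<Rightarrow> int \<Rightarrow> 'a \<Rightarrow> complex" where
  "mixed_prod L r H w Q G n x = (\<Prod>i<L. H i (act (r i n) x)) * S.poly_prod Q G n (act (w n) x)"

lemma mixed_prod_seq_bdd:
  assumes "finite Q" "\<And>i. i < L \<Longrightarrow> bdd_fun M (H i)" "\<And>q. q \<in> Q \<Longrightarrow> bdd_fun M (G q)"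
  obtains C where "seq_bdd C (mixed_prod L r H w Q G)"
proof -
  obtain C where C: "\<And>q. q \<in> Q \<Longrightarrow> bdd_by M C (G q)"
    using bdd_by_common[where G=G, OF assms(1,3)] by blast
  have "\<And>i. i \<in> {..<L} \<Longrightarrow> bdd_fun M (H i)" using assms(2) by simp
  then obtain D where D: "\<And>i. i \<in> {..<L} \<Longrightarrow> bdd_by M D (H i)"
    using bdd_by_common[where G=H, OF finite_lessThan[of L]] by blast
  have "bdd_by M ((\<Prod>i<L. D) * C ^ card Q) (mixed_prod L r H w Q G n)" for n
    unfolding mixed_prod_def
    by (intro bdd_by_mult bdd_by_prod bdd_by_act[of _ "S.poly_prod Q G n"] bdd_by_act D S.poly_prod_bdd C)
  then show ?thesis using that unfolding seq_bdd_def by blast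
qed

lemma mixed_prod_correlation:
  assumes Q: "finite Q" "\<And>q. q \<in> Q \<Longrightarrow> integer_polynomial q"
    and disj: "Q \<inter> shift_poly h ` {q \<in> Q. degree q \<ge> 2} = {}"
    and r: "\<And>i m n. r i (m + n) = r i m + r i n" and w: "\<And>m n. w (m + n) = w m + w n"
    and x: "x \<in> space M"
  shows "mixed_prod L r H w Q G (n + h) x * cnj (mixed_prod L r H w Q G n x)
     = mixed_prod L r (\<lambda>i x. H i (act (r i h) x) * cnj (H i x)) w (S.shifted_family Q h)
         (S.shifted_functions Q (\<lambda>q x. G q (act (w h) x)) G h) n x"
proof -
  have lin: "(\<Prod>i<L. H i (act (r i (n + h)) x)) * cnj (\<Prod>i<L. H i (act (r i n) x))
      = (\<Prod>i<L. H i (act (r i h) (act (r i n) x)) * cnj (H i (act (r i n) x)))"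
    using x by (simp add: prod.distrib r add.commute[of "r _ n"] act_add)
  have "act (s k) (act (w (n + h)) x) = act (w h) (act (s k) (act (w n) x))" for k
    using x by (simp add: w act_space add_ac flip: act_add)
  then have "S.poly_prod Q G (n + h) (act (w (n + h)) x)
      = S.poly_prod Q (\<lambda>q x. G q (act (w h) x)) (n + h) (act (w n) x)"
    by (simp add: S.poly_prod_def)
  then have pp: "S.poly_prod Q G (n + h) (act (w (n + h)) x) * cnj (S.poly_prod Q G n (act (w n) x))
      = S.poly_prod (S.shifted_family Q h) (S.shifted_functions Q (\<lambda>q x. G q (act (w h) x)) G h) n (act (w n) x)"
    using S.poly_prod_correlation[OF Q disj act_space[OF x]] by simp
  show ?thesis
    unfolding mixed_prod_def pp[symmetric] lin[symmetric] by (simp add: mult_ac)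
qed

lemma mixed_prod_measurable:
  assumes "\<And>i. i < L \<Longrightarrow> bdd_fun M (H i)" "\<And>q. q \<in> Q \<Longrightarrow> bdd_fun M (G q)"
  shows "mixed_prod L r H w Q G n \<in> borel_measurable M"
  unfolding mixed_prod_def S.poly_prod_def using assms
  by (intro bdd_fun_measurable bdd_fun_mult bdd_fun_prod bdd_fun_act[of "H _"]
      bdd_fun_act[where f="\<lambda>x. (\<Prod>q\<in>Q. G q (act (s (ival q n)) x))"] bdd_fun_act[of "G _"]) auto

text \<open>An integral of such a product does not change when one of the linear iterates is removed
  from all the others.  The common translation \<open>w\<close> thereby disappears if there is no linear
  iterate.\<close>

lemma integral_mixed_prod_0:
  assumes "\<And>q. q \<in> Q \<Longrightarrow> bdd_fun M (G q)"
  shows "(\<integral>x. mixed_prod 0 r H w Q G n x \<partial>M) = (\<integral>x. S.poly_prod Q G n x \<partial>M)"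
proof -
  have "S.poly_prod Q G n \<in> borel_measurable M"
    unfolding S.poly_prod_def[abs_def] using assms
    by (intro bdd_fun_measurable bdd_fun_prod bdd_fun_act[of "G _"]) auto
  from integral_act[OF this, of "w n"] show ?thesis by (simp add: mixed_prod_def)
qed

lemma integral_mixed_prod_Suc:
  assumes "\<And>i. i < Suc L \<Longrightarrow> bdd_fun M (H i)" "\<And>q. q \<in> Q \<Longrightarrow> bdd_fun M (G q)"
  shows "(\<integral>x. mixed_prod (Suc L) r H w Q G n x \<partial>M)
    = (\<integral>x. H L x * mixed_prod L (\<lambda>i n. r i n - r L n) H (\<lambda>n. w n - r L n) Q G n x \<partial>M)"
proof -
  have "(\<integral>x. mixed_prod (Suc L) r H w Q G n x \<partial>M) = (\<integral>x. mixed_prod (Suc L) r H w Q G n (act (- r L n) x) \<partial>M)"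
    by (rule integral_act[symmetric]) (intro mixed_prod_measurable assms)
  also have "\<dots> = (\<integral>x. H L x * mixed_prod L (\<lambda>i n. r i n - r L n) H (\<lambda>n. w n - r L n) Q G n x \<partial>M)"
    by (intro Bochner_Integration.integral_cong)
       (simp_all add: mixed_prod_def act_zero flip: act_add)
  finally show ?thesis .
qed

text \<open>Averages of products with \<open>L\<close> linear iterates tend to \<open>0\<close>, for additive linear
  iterates, bounded functions and essentially distinct polynomials of degree at least \<open>2\<close>, provided that
  one of the functions \<open>G q\<close> has mean zero.\<close>

definition mixed_null :: "nat \<Rightarrow> bool" where
  "mixed_null L \<longleftrightarrow> (\<forall>r H w Q G.
     (\<forall>i m n. r i (m + n) = r i m + r i n) \<longrightarrow> (\<forall>m n. w (m + n) = w m + w n) \<longrightarrow>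
     (\<forall>i<L. bdd_fun M (H i)) \<longrightarrow> finite Q \<longrightarrow> ess_distinct_family Q \<longrightarrow>
     (\<forall>q\<in>Q. integer_polynomial q \<and> degree q \<ge> 2 \<and> bdd_fun M (G q)) \<longrightarrow>
     (\<exists>q\<in>Q. (\<integral>x. G q x \<partial>M) = 0) \<longrightarrow>
     L2_null (\<lambda>N x. cesaro N (\<lambda>n. mixed_prod L r H w Q G n x)))"

lemma mixed_nullD:
  assumes "mixed_null L"
    "\<And>i m n. r i (m + n) = r i m + r i n" "\<And>m n. w (m + n) = w m + w n"
    "\<And>i. i < L \<Longrightarrow> bdd_fun M (H i)" "finite Q" "ess_distinct_family Q"
    "\<And>q. q \<in> Q \<Longrightarrow> integer_polynomial q \<and> degree q \<ge> 2" "\<And>q. q \<in> Q \<Longrightarrow> bdd_fun M (G q)"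
    "q0 \<in> Q" "(\<integral>x. G q0 x \<partial>M) = 0"
  shows "L2_null (\<lambda>N x. cesaro N (\<lambda>n. mixed_prod L r H w Q G n x))"
  using assms(1)[unfolded mixed_null_def, THEN spec[of _ r], THEN spec[of _ H], THEN spec[of _ w],
      THEN spec[of _ Q], THEN spec[of _ G]] assms(2-) by blast

text \<open>The weak form of the statement for \<open>L\<close> linear iterates follows from the strong form for one
  linear iterate less, and from Bergelson's theorem if there is none.\<close>

lemma mixed_prod_integral_tendsto:
  assumes r: "\<And>i m n. r i (m + n) = r i m + r i n" and w: "\<And>m n. w (m + n) = w m + w n"
    and H: "\<And>i. i < L \<Longrightarrow> bdd_fun M (H i)"
    and Q: "finite Q" "ess_distinct_family Q" "\<And>q. q \<in> Q \<Longrightarrow> integer_polynomial q \<and> degree q \<ge> 2"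
    and G: "\<And>q. q \<in> Q \<Longrightarrow> bdd_fun M (G q)" and q0: "q0 \<in> Q" "(\<integral>x. G q0 x \<partial>M) = 0"
    and IH: "\<And>L'. L = Suc L' \<Longrightarrow> mixed_null L'"
  shows "(\<lambda>N. cesaro N (\<lambda>n. \<integral>x. mixed_prod L r H w Q G n x \<partial>M)) \<longlonglongrightarrow> 0"
proof -
  have "\<exists>f F C. bdd_fun M f \<and> (\<forall>n. bdd_by M C (F n)) \<and> L2_null (\<lambda>N x. cesaro N (\<lambda>n. F n x)) \<and>
      (\<forall>n. (\<integral>x. mixed_prod L r H w Q G n x \<partial>M) = (\<integral>x. f x * F n x \<partial>M))"
  proof (cases L)
    case 0
    have "S.pet_limit Q"
    proof (rule S.polynomial_ergodic_theorem[OF Q(1,2)])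
      fix q assume "q \<in> Q"
      from Q(3)[OF this] show "integer_polynomial q \<and> degree q > 0" by auto
    qed
    moreover have "(\<Prod>q\<in>Q. \<integral>x. G q x \<partial>M) = 0" using Q(1) q0 by (intro prod_zero) auto
    ultimately have null: "L2_null (\<lambda>N x. cesaro N (\<lambda>n. S.poly_prod Q G n x))"
      using G unfolding S.pet_limit_def by fastforce
    obtain C where C: "\<And>q. q \<in> Q \<Longrightarrow> bdd_by M C (G q)"
      using bdd_by_common[where G=G, OF Q(1) G] by blast
    show ?thesis
      by (rule exI[of _ "\<lambda>_. 1"], rule exI[of _ "S.poly_prod Q G"], rule exI[of _ "C ^ card Q"])
         (simp add: bdd_fun_const S.poly_prod_bdd C null 0 integral_mixed_prod_0 G)
  next
    case (Suc L')
    let ?F = "mixed_prod L' (\<lambda>i n. r i n - r L' n) H (\<lambda>n. w n - r L' n) Q G"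
    have H': "\<And>i. i < L' \<Longrightarrow> bdd_fun M (H i)" using H Suc by simp
    have "L2_null (\<lambda>N x. cesaro N (\<lambda>n. ?F n x))"
      by (rule mixed_nullD[where H=H and G=G, OF IH[OF Suc] _ _ H' Q G q0]) (simp_all add: r w)
    moreover obtain C where "seq_bdd C ?F" using mixed_prod_seq_bdd[OF Q(1) H' G] .
    moreover have "bdd_fun M (H L')" using H Suc by simp
    moreover have "(\<integral>x. mixed_prod L r H w Q G n x \<partial>M) = (\<integral>x. H L' x * ?F n x \<partial>M)" for n
      unfolding Suc by (intro integral_mixed_prod_Suc H G) (simp_all add: Suc)
    ultimately show ?thesis unfolding seq_bdd_def by blast
  qed
  then obtain f F C where f: "bdd_fun M f" and F: "\<And>n. bdd_by M C (F n)"
    "L2_null (\<lambda>N x. cesaro N (\<lambda>n. F n x))"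
    and eq: "\<And>n. (\<integral>x. mixed_prod L r H w Q G n x \<partial>M) = (\<integral>x. f x * F n x \<partial>M)" by blast
  obtain D where D: "bdd_by M D f" using f by (auto simp: bdd_fun_def)
  have "(\<lambda>N. \<integral>x. f x * cesaro N (\<lambda>n. F n x) \<partial>M) \<longlonglongrightarrow> 0"
    by (rule L2_null_integral_mult[OF f bdd_funI[OF bdd_by_cesaro[OF F(1)]] F(2)])
  moreover have "(\<integral>x. f x * cesaro N (\<lambda>n. F n x) \<partial>M) = cesaro N (\<lambda>n. \<integral>x. f x * F n x \<partial>M)" for N
    unfolding cesaro_cmult[symmetric] by (rule integral_cesaro[OF bdd_by_mult[OF D F(1)]])
  ultimately show ?thesis by (simp add: eq)
qed

lemma mixed_prod_correl_tendsto:
  assumes r: "\<And>i m n. r i (m + n) = r i m + r i n" and w: "\<And>m n. w (m + n) = w m + w n"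
    and H: "\<And>i. i < L \<Longrightarrow> bdd_fun M (H i)"
    and Q: "finite Q" "ess_distinct_family Q" "\<And>q. q \<in> Q \<Longrightarrow> integer_polynomial q \<and> degree q \<ge> 2"
    and G: "\<And>q. q \<in> Q \<Longrightarrow> bdd_fun M (G q)" and q0: "q0 \<in> Q" "(\<integral>x. G q0 x \<partial>M) = 0"
    and IH: "\<And>L'. L = Suc L' \<Longrightarrow> mixed_null L'"
  shows "\<exists>E. finite E \<and> (\<forall>h. h \<notin> E \<longrightarrow> correl_le (mixed_prod L r H w Q G) h 0)"
proof -
  define E where "E = {h. \<not> (ess_distinct_family (Q \<union> shift_poly h ` {q \<in> Q. degree q \<ge> 2})
      \<and> Q \<inter> shift_poly h ` {q \<in> Q. degree q \<ge> 2} = {})}"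
  have "finite E" unfolding E_def by (rule ess_distinct_family_shift[OF Q(1,2)])
  moreover have "correl_le (mixed_prod L r H w Q G) h 0" if "h \<notin> E" for h
  proof -
    have good: "ess_distinct_family (S.shifted_family Q h)"
      "Q \<inter> shift_poly h ` {q \<in> Q. degree q \<ge> 2} = {}"
      using that by (auto simp: E_def S.shifted_family_def)
    let ?G = "S.shifted_functions Q (\<lambda>q x. G q (act (w h) x)) G h"
    obtain C where C: "C \<ge> 1" "\<And>q. q \<in> Q \<Longrightarrow> bdd_by M C (G q)"
      using bdd_by_common[where G=G, OF Q(1) G] by blast
    have "(\<lambda>N. cesaro N (\<lambda>n. \<integral>x. mixed_prod L r (\<lambda>i x. H i (act (r i h) x) * cnj (H i x)) w
        (S.shifted_family Q h) ?G n x \<partial>M)) \<longlonglongrightarrow> 0"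
    proof (rule mixed_prod_integral_tendsto[OF r w])
      show "bdd_fun M (\<lambda>x. H i (act (r i h) x) * cnj (H i x))" if "i < L" for i
        by (intro bdd_fun_mult bdd_fun_act[of "H i"] bdd_fun_cnj H that)
      show "finite (S.shifted_family Q h)" using Q(1) by (simp add: S.shifted_family_def)
      show "ess_distinct_family (S.shifted_family Q h)" by (rule good(1))
      show "integer_polynomial q \<and> 2 \<le> degree q" if "q \<in> S.shifted_family Q h" for q
        using that Q(3) by (auto simp: S.shifted_family_def integer_polynomial_shift_poly)
      show "bdd_fun M (?G q)" if "q \<in> S.shifted_family Q h" for q
        by (rule bdd_funI[OF S.shifted_functions_bdd[OF C(1) _ C(2) that]]) (rule bdd_by_act[OF C(2)])
      show "q0 \<in> S.shifted_family Q h" using q0 by (simp add: S.shifted_family_def)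
      show "(\<integral>x. ?G q0 x \<partial>M) = 0" using q0 Q(3)[OF q0(1)] by (simp add: S.shifted_functions_def)
    qed (rule IH)
    moreover have "correl (mixed_prod L r H w Q G) h N
        = cesaro N (\<lambda>n. \<integral>x. mixed_prod L r (\<lambda>i x. H i (act (r i h) x) * cnj (H i x)) w
            (S.shifted_family Q h) ?G n x \<partial>M)" for N
      unfolding correl_def
      by (intro cesaro_cong Bochner_Integration.integral_cong refl mixed_prod_correlation Q(1) good(2) r w)
         (use Q(3) in simp)
    ultimately have "correl (mixed_prod L r H w Q G) h \<longlonglongrightarrow> 0" by presburger
    then show ?thesis by (rule correl_leI_tendsto) simp
  qed
  ultimately show ?thesis by blast
qed

lemma mixed_null: "mixed_null L"
proof (induction L rule: less_induct)
  case (less L)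
  show ?case
    unfolding mixed_null_def
  proof (intro allI impI)
    fix r :: "nat \<Rightarrow> int \<Rightarrow> 'g" and H :: "nat \<Rightarrow> 'a \<Rightarrow> complex" and w :: "int \<Rightarrow> 'g" and Q
      and G :: "rat poly \<Rightarrow> 'a \<Rightarrow> complex"
    assume r: "\<forall>i m n. r i (m + n) = r i m + r i n" and w: "\<forall>m n. w (m + n) = w m + w n"
      and H: "\<forall>i<L. bdd_fun M (H i)" and Q: "finite Q" "ess_distinct_family Q"
        "\<forall>q\<in>Q. integer_polynomial q \<and> 2 \<le> degree q \<and> bdd_fun M (G q)"
      and "\<exists>q\<in>Q. (\<integral>x. G q x \<partial>M) = 0"
    then obtain q0 where q0: "q0 \<in> Q" "(\<integral>x. G q0 x \<partial>M) = 0" by blast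
    have "\<exists>E. finite E \<and> (\<forall>h. h \<notin> E \<longrightarrow> correl_le (mixed_prod L r H w Q G) h 0)"
      by (rule mixed_prod_correl_tendsto[where ?q0.0=q0]) (simp_all add: r w H Q q0 less.IH)
    then obtain E where E: "finite E" "\<And>h. h \<notin> E \<Longrightarrow> correl_le (mixed_prod L r H w Q G) h 0"
      by blast
    obtain C where C: "seq_bdd C (mixed_prod L r H w Q G)"
      by (rule mixed_prod_seq_bdd[of Q L H G r w]) (simp_all add: Q H)
    show "L2_null (\<lambda>N x. cesaro N (\<lambda>n. mixed_prod L r H w Q G n x))"
      by (rule van_der_corput_exceptions[OF C E(1), of "\<lambda>_. 0"]) (simp_all add: E(2))
  qed
qed

end

section \<open>Sequences with singular spectral measure\<close>

text \<open>Schur's test for the matrix of the relation \<open>l - k \<in> E\<close>.\<close>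

lemma sum_pairs_in_difference_set:
  fixes a :: "int \<Rightarrow> real"
  assumes "finite K" "finite E"
  shows "(\<Sum>k\<in>K. \<Sum>l\<in>K. \<bar>a k\<bar> * \<bar>a l\<bar> * (if l - k \<in> E then 1 else 0)) \<le> card E * (\<Sum>k\<in>K. (a k)\<^sup>2)"
proof -
  define inE where "inE = (\<lambda>k l. if l - k \<in> E then 1 else 0 :: real)"
  have 1: "(\<Sum>l\<in>K. inE k l) \<le> card E" for k
  proof -
    have "(\<Sum>l\<in>K. inE k l) = card {l \<in> K. l - k \<in> E}"
      using assms(1) by (simp add: inE_def sum.inter_filter[symmetric])
    also have "card {l \<in> K. l - k \<in> E} \<le> card E"
      using assms by (intro card_inj_on_le[of "\<lambda>l. l - k"]) (auto simp: inj_on_def)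
    finally show ?thesis by simp
  qed
  have 2: "(\<Sum>k\<in>K. inE k l) \<le> card E" for l
  proof -
    have "(\<Sum>k\<in>K. inE k l) = card {k \<in> K. l - k \<in> E}"
      using assms(1) by (simp add: inE_def sum.inter_filter[symmetric])
    also have "card {k \<in> K. l - k \<in> E} \<le> card E"
      using assms by (intro card_inj_on_le[of "\<lambda>k. l - k"]) (auto simp: inj_on_def)
    finally show ?thesis by simp
  qed
  have "(\<Sum>k\<in>K. \<Sum>l\<in>K. \<bar>a k\<bar> * \<bar>a l\<bar> * inE k l)
      \<le> (\<Sum>k\<in>K. \<Sum>l\<in>K. (a k)\<^sup>2 / 2 * inE k l + (a l)\<^sup>2 / 2 * inE k l)"
  proof (intro sum_mono)
    fix k l
    have "\<bar>a k\<bar> * \<bar>a l\<bar> \<le> (a k)\<^sup>2 / 2 + (a l)\<^sup>2 / 2"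
      using sum_squares_bound[of "\<bar>a k\<bar>" "\<bar>a l\<bar>"] by simp
    then show "\<bar>a k\<bar> * \<bar>a l\<bar> * inE k l \<le> (a k)\<^sup>2 / 2 * inE k l + (a l)\<^sup>2 / 2 * inE k l"
      by (simp add: inE_def)
  qed
  also have "\<dots> = (\<Sum>k\<in>K. (a k)\<^sup>2 / 2 * (\<Sum>l\<in>K. inE k l)) + (\<Sum>l\<in>K. (a l)\<^sup>2 / 2 * (\<Sum>k\<in>K. inE k l))"
  proof -
    have "(\<Sum>k\<in>K. \<Sum>l\<in>K. (a l)\<^sup>2 / 2 * inE k l) = (\<Sum>l\<in>K. \<Sum>k\<in>K. (a l)\<^sup>2 / 2 * inE k l)"
      by (rule sum.swap)
    then show ?thesis by (simp only: sum.distrib sum_distrib_left)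
  qed
  also have "\<dots> \<le> (\<Sum>k\<in>K. (a k)\<^sup>2 / 2 * card E) + (\<Sum>l\<in>K. (a l)\<^sup>2 / 2 * card E)"
    by (intro add_mono sum_mono mult_left_mono 1 2) auto
  also have "\<dots> = card E * (\<Sum>k\<in>K. (a k)\<^sup>2)"
    by (simp add: sum_distrib_left sum.distrib[symmetric] mult.commute)
  finally show ?thesis by (simp add: inE_def)
qed

text \<open>The powers of a single measure preserving transformation.\<close>

locale int_action = prob_action M act for M :: "'a measure" and act :: "int \<Rightarrow> 'a \<Rightarrow> 'a"
begin

text \<open>The map sending \<open>f (act j x)\<close> to the \<open>j\<close>-th power of the circle coordinate extends to an isometry
  into \<open>L\<^sup>2(\<nu>)\<close>.\<close>

lemma spectral_isometry:
  assumes f: "bdd_fun M f" and \<nu>: "finite_measure \<nu>" "sets \<nu> = sets lebesgue01"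
    and spec: "\<And>n. fourier_coeff \<nu> n = (\<integral>x. f (act n x) * cnj (f x) \<partial>M)"
  shows "(\<integral>x. (cmod (\<Sum>j\<in>J. d j * f (act j x)))\<^sup>2 \<partial>M)
    = (\<integral>t. (cmod (\<Sum>j\<in>J. d j * circle_map t powi j))\<^sup>2 \<partial>\<nu>)"
proof -
  have bJ: "bdd_fun M (\<lambda>x. f (act j x) * cnj (f (act l x)))" for j l
    by (intro bdd_fun_mult bdd_fun_cnj bdd_fun_act[of f] f)
  have coef: "(\<integral>x. f (act j x) * cnj (f (act l x)) \<partial>M) = (\<integral>t. circle_map t powi (j - l) \<partial>\<nu>)" for j l
  proof -
    have "(\<integral>x. f (act j x) * cnj (f (act l x)) \<partial>M)
        = (\<integral>x. f (act j (act (- l) x)) * cnj (f (act l (act (- l) x))) \<partial>M)"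
      by (rule integral_act[symmetric]) (rule bdd_fun_measurable[OF bJ])
    also have "\<dots> = (\<integral>x. f (act (j - l) x) * cnj (f x) \<partial>M)"
      by (intro Bochner_Integration.integral_cong) (simp_all add: act_zero flip: act_add)
    also have "\<dots> = (\<integral>t. circle_map t powi (j - l) \<partial>\<nu>)"
      unfolding spec[symmetric] fourier_coeff_def circle_map_powi ..
    finally show ?thesis .
  qed
  have "complex_of_real (\<integral>x. (cmod (\<Sum>j\<in>J. d j * f (act j x)))\<^sup>2 \<partial>M)
      = (\<Sum>j\<in>J. \<Sum>l\<in>J. (d j * cnj (d l)) * (\<integral>t. circle_map t powi (j - l) \<partial>\<nu>))"
    unfolding coef[symmetric] by (rule integral_square_sum_expand) (rule integrable_bdd_fun[OF bJ])
  also have "\<dots> = complex_of_real (\<integral>t. (cmod (\<Sum>j\<in>J. d j * circle_map t powi j))\<^sup>2 \<partial>\<nu>)"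
    by (rule integral_trig_poly_square_expand[OF \<nu>, symmetric])
  finally show ?thesis by (simp only: of_real_eq_iff)
qed

text \<open>Singularity of the spectral measure lets \<open>f\<close> be reproduced up to a small error by a
  combination of its translates with small square sum of the coefficients.\<close>

lemma singular_spectrum_L2_null:
  assumes f: "bdd_fun M f" and \<nu>: "finite_measure \<nu>" "sets \<nu> = sets lebesgue01"
    and sing: "mutually_singular \<nu> lebesgue01"
    and spec: "\<And>n. fourier_coeff \<nu> n = (\<integral>x. f (act n x) * cnj (f x) \<partial>M)"
    and u: "seq_bdd C u" and E: "finite E" "\<And>h. h \<notin> E \<Longrightarrow> correl_le u h 0"
  shows "L2_null (\<lambda>N x. cesaro N (\<lambda>n. f (act n x) * u n x))"
  unfolding L2_null_def
proof (rule LIMSEQ_I)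
  fix e :: real assume e: "e > 0"
  obtain B where B: "bdd_by M B f" using f by (auto simp: bdd_fun_def)
  have C0: "C \<ge> 0" by (rule bdd_by_nonneg[OF seq_bddD[OF u, of 0]])
  define A where "A = 1 + C\<^sup>2 + B\<^sup>2 * (C * C * card E)"
  have A: "A > 0" unfolding A_def using C0 by (intro add_pos_nonneg mult_nonneg_nonneg) auto
  define d where "d = e / (6 * A)"
  have d: "d > 0" using e A by (simp add: d_def)
  obtain K :: "int set" and c where K: "finite K"
    "(\<integral>t. (cmod (1 - (\<Sum>k\<in>K. c k * circle_map t powi k)))\<^sup>2 \<partial>\<nu>) \<le> d" "(\<Sum>k\<in>K. (cmod (c k))\<^sup>2) \<le> d"
    using singular_trig_poly_approx[OF \<nu> sing d] by blast
  define \<beta> where "\<beta> = (\<lambda>h. C * C * (if h \<in> E then 1 else 0))"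
  have corr: "correl_le u h (\<beta> h)" for h
    using E(2)[of h] correl_le_trivial[OF u, of h] by (simp add: \<beta>_def)
  have t: "seq_bdd B (\<lambda>n x. f (act n x))" using bdd_by_act[OF B] by (simp add: seq_bdd_def)
  have approx: "(\<integral>x. (cmod (f (act n x) - (\<Sum>k\<in>K. c k * f (act (n + k) x))))\<^sup>2 \<partial>M) \<le> d" for n
  proof -
    \<comment> \<open>The coefficients of \<open>1 - P\<close>.\<close>
    define b where "b = (\<lambda>j. (if j = 0 then 1 else 0) - (if j \<in> K then c j else 0))"
    have comb: "(\<Sum>j\<in>insert 0 K. b j * z j) = z 0 - (\<Sum>k\<in>K. c k * z k)" for z
    proof -
      have "(\<Sum>j\<in>insert 0 K. b j * z j) = (\<Sum>j\<in>insert 0 K. (if j = 0 then z j else 0))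
          - (\<Sum>j\<in>insert 0 K. (if j \<in> K then c j * z j else 0))"
        unfolding sum_subtractf[symmetric] by (intro sum.cong) (auto simp: b_def left_diff_distrib)
      also have "(\<Sum>j\<in>insert 0 K. (if j \<in> K then c j * z j else 0)) = (\<Sum>j\<in>K. c j * z j)"
        using K(1) by (intro sum.mono_neutral_cong_right) auto
      also have "(\<Sum>j\<in>insert 0 K. (if j = 0 then z j else 0)) = z 0"
        using K(1) by simp
      finally show ?thesis .
    qed
    have "(\<integral>x. (cmod (f (act n x) - (\<Sum>k\<in>K. c k * f (act (n + k) x))))\<^sup>2 \<partial>M)
        = (\<integral>x. (cmod (\<Sum>j\<in>insert 0 K. b j * f (act j (act n x))))\<^sup>2 \<partial>M)"
      unfolding comb
      by (intro Bochner_Integration.integral_cong refl)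
         (simp add: act_space act_zero add.commute[of n] act_add)
    also have "\<dots> = (\<integral>x. (cmod (\<Sum>j\<in>insert 0 K. b j * f (act j x)))\<^sup>2 \<partial>M)"
    proof (rule integral_act)
      have [measurable]: "f \<in> borel_measurable M" by (rule bdd_fun_measurable[OF f])
      show "(\<lambda>x. (cmod (\<Sum>j\<in>insert 0 K. b j * f (act j x)))\<^sup>2) \<in> borel_measurable M" by measurable
    qed
    also have "\<dots> = (\<integral>t. (cmod (\<Sum>j\<in>insert 0 K. b j * circle_map t powi j))\<^sup>2 \<partial>\<nu>)"
      by (rule spectral_isometry[OF f \<nu> spec])
    also have "\<dots> \<le> d" unfolding comb using K(2) by simp
    finally show ?thesis .
  qed
  have "(\<Sum>k\<in>K. \<Sum>l\<in>K. cmod (c k) * cmod (c l) * \<beta> (l - k))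
      = C * C * (\<Sum>k\<in>K. \<Sum>l\<in>K. \<bar>cmod (c k)\<bar> * \<bar>cmod (c l)\<bar> * (if l - k \<in> E then 1 else 0))"
    by (simp add: \<beta>_def sum_distrib_left mult_ac)
  also have "\<dots> \<le> C * C * (card E * (\<Sum>k\<in>K. (cmod (c k))\<^sup>2))"
    by (intro mult_left_mono sum_pairs_in_difference_set K E) auto
  also have "\<dots> \<le> C * C * (card E * d)"
    using K(3) by (intro mult_left_mono) auto
  finally have V: "(\<Sum>k\<in>K. \<Sum>l\<in>K. cmod (c k) * cmod (c l) * \<beta> (l - k)) \<le> C * C * (card E * d)" .
  have "3 * (C\<^sup>2 * d + B\<^sup>2 * (\<Sum>k\<in>K. \<Sum>l\<in>K. cmod (c k) * cmod (c l) * \<beta> (l - k)))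
      \<le> 3 * (C\<^sup>2 * d + B\<^sup>2 * (C * C * (card E * d)))"
    by (intro mult_left_mono add_left_mono V) auto
  also have "\<dots> = 3 * (A * d) - 3 * d" by (simp add: A_def algebra_simps)
  also have "\<dots> < e / 2" using A d by (simp add: d_def)
  finally have small: "3 * (C\<^sup>2 * d + B\<^sup>2 * (\<Sum>k\<in>K. \<Sum>l\<in>K. cmod (c k) * cmod (c l) * \<beta> (l - k))) < e / 2" .
  have "\<forall>\<^sub>F N in sequentially. (\<integral>x. (cmod (cesaro N (\<lambda>n. f (act n x) * u n x)))\<^sup>2 \<partial>M)
     \<le> 3 * (C\<^sup>2 * d + B\<^sup>2 * (\<Sum>k\<in>K. \<Sum>l\<in>K. cmod (c k) * cmod (c l) * \<beta> (l - k))) + e / 2"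
    using e by (intro weighted_van_der_corput[OF t u K(1) approx corr]) simp
  then have "\<forall>\<^sub>F N in sequentially. (\<integral>x. (cmod (cesaro N (\<lambda>n. f (act n x) * u n x)))\<^sup>2 \<partial>M) < e"
    by eventually_elim (use small in linarith)
  then show "\<exists>no. \<forall>n\<ge>no. norm ((\<integral>x. (cmod (cesaro n (\<lambda>n. f (act n x) * u n x)))\<^sup>2 \<partial>M) - 0) < e"
    by (simp add: eventually_sequentially)
qed

end

section \<open>Actions generated by commuting automorphisms\<close>

context
  fixes M :: "'a measure"
begin

text \<open>Commutation on the space; values elsewhere are irrelevant.\<close>

definition commute_on :: "('a \<Rightarrow> 'a) \<Rightarrow> ('a \<Rightarrow> 'a) \<Rightarrow> bool" where
  "commute_on f g \<longleftrightarrow> (\<forall>x\<in>space M. f (g x) = g (f x))"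

lemma mp_automorphism_space: "mp_automorphism M F \<Longrightarrow> x \<in> space M \<Longrightarrow> F x \<in> space M"
  using mp_automorphism_measurable measurable_space by metis

lemma mp_automorphism_inv_left:
  "mp_automorphism M F \<Longrightarrow> x \<in> space M \<Longrightarrow> inv_into (space M) F (F x) = x"
  by (simp add: mp_automorphism_def bij_betw_def)

lemma mp_automorphism_inv_right:
  "mp_automorphism M F \<Longrightarrow> x \<in> space M \<Longrightarrow> F (inv_into (space M) F x) = x"
  using bij_betw_inv_into_right[of F "space M" "space M" x] by (auto simp: mp_automorphism_def)

lemma mp_automorphism_inv_space:
  "mp_automorphism M F \<Longrightarrow> x \<in> space M \<Longrightarrow> inv_into (space M) F x \<in> space M"
  by (metis mp_automorphism_def measurable_space)

lemma mp_automorphism_distr_inv: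
  assumes F: "mp_automorphism M F"
  shows "distr M M (inv_into (space M) F) = M"
proof (rule measure_eqI)
  fix A assume "A \<in> sets (distr M M (inv_into (space M) F))"
  then have A: "A \<in> sets M" by simp
  have "inv_into (space M) F -` A \<inter> space M = F ` A"
    using sets.sets_into_space[OF A] mp_automorphism_inv_left[OF F] mp_automorphism_inv_right[OF F]
      mp_automorphism_space[OF F] by (force simp: image_iff)
  then show "emeasure (distr M M (inv_into (space M) F)) A = emeasure M A"
    using A F by (simp add: emeasure_distr mp_automorphism_def)
qed simp

lemma funpow_measurable:
  assumes "F \<in> measurable M M"
  shows "F ^^ n \<in> measurable M M"
  using assms by (induction n) (auto intro: measurable_comp)

lemma funpow_distr:
  assumes F: "F \<in> measurable M M" and "distr M M F = M"
  shows "distr M M (F ^^ n) = M"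
proof (induction n)
  case 0
  then show ?case by (simp add: id_def)
next
  case (Suc n)
  have "distr M M (F ^^ Suc n) = distr (distr M M (F ^^ n)) M F"
    using distr_distr[OF F funpow_measurable[OF F, of n]] by simp
  then show ?case using Suc assms(2) by (simp del: funpow.simps)
qed

lemma aut_power_measurable:
  assumes F: "mp_automorphism M F"
  shows "aut_power M F k \<in> measurable M M"
  using F by (auto simp: aut_power_def mp_automorphism_def intro: funpow_measurable)

lemma aut_power_distr:
  assumes F: "mp_automorphism M F"
  shows "distr M M (aut_power M F k) = M"
  using mp_automorphism_distr[OF F] mp_automorphism_distr_inv[OF F] F
  by (auto simp: aut_power_def mp_automorphism_def intro: funpow_distr)

lemma aut_power_space: "mp_automorphism M F \<Longrightarrow> x \<in> space M \<Longrightarrow> aut_power M F k x \<in> space M"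
  using aut_power_measurable measurable_space by metis

lemma aut_power_plus_1:
  assumes F: "mp_automorphism M F" and x: "x \<in> space M"
  shows "aut_power M F (k + 1) x = F (aut_power M F k x)"
proof (cases "k \<ge> 0")
  case True
  then have "nat (k + 1) = Suc (nat k)" by simp
  then show ?thesis using True by (simp add: aut_power_def)
next
  case False
  define m where "m = nat (- (k + 1))"
  have m: "nat (- k) = Suc m" using False by (simp add: m_def)
  have k1: "aut_power M F (k + 1) = inv_into (space M) F ^^ m"
    using False by (cases "k + 1 = 0") (auto simp: aut_power_def m_def)
  have "inv_into (space M) F ^^ m \<in> measurable M M"
    using F by (intro funpow_measurable) (simp add: mp_automorphism_def)
  then have "(inv_into (space M) F ^^ m) x \<in> space M" using x measurable_space by metis
  then show ?thesis using mp_automorphism_inv_right[OF F] False by (simp add: k1) (simp add: aut_power_def m)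
qed

lemma aut_power_minus_1:
  assumes F: "mp_automorphism M F" and x: "x \<in> space M"
  shows "aut_power M F (k - 1) x = inv_into (space M) F (aut_power M F k x)"
  using aut_power_plus_1[OF F x, of "k - 1"] mp_automorphism_inv_left[OF F aut_power_space[OF F x, of "k - 1"]]
  by simp

lemma aut_power_add:
  assumes F: "mp_automorphism M F" and x: "x \<in> space M"
  shows "aut_power M F (j + k) x = aut_power M F j (aut_power M F k x)"
proof (induction j rule: int_induct[where k=0])
  case base
  show ?case by (simp add: aut_power_def)
next
  case (step1 i)
  then show ?case
    using aut_power_plus_1[OF F x, of "i + k"] aut_power_plus_1[OF F aut_power_space[OF F x], of i k]
    by (simp add: add_ac)
next
  case (step2 i)
  then show ?case
    using aut_power_minus_1[OF F x, of "i + k"] aut_power_minus_1[OF F aut_power_space[OF F x], of i k]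
    by (simp add: algebra_simps)
qed

lemma commute_on_sym: "commute_on f g \<Longrightarrow> commute_on g f"
  by (simp add: commute_on_def)

lemma commute_on_inv:
  assumes F: "mp_automorphism M F" and G: "\<And>x. x \<in> space M \<Longrightarrow> G x \<in> space M" and c: "commute_on F G"
  shows "commute_on (inv_into (space M) F) G"
  unfolding commute_on_def
proof
  fix x assume x: "x \<in> space M"
  define y where "y = inv_into (space M) F x"
  have y: "y \<in> space M" "F y = x"
    using mp_automorphism_inv_space[OF F x] mp_automorphism_inv_right[OF F x] by (simp_all add: y_def)
  have "G x = F (G y)" using c y by (auto simp: commute_on_def)
  then show "inv_into (space M) F (G x) = G (inv_into (space M) F x)"
    using mp_automorphism_inv_left[OF F G[OF y(1)]] by (simp add: y_def)
qed

lemma commute_on_funpow: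
  assumes "\<And>x. x \<in> space M \<Longrightarrow> F x \<in> space M" "commute_on F G"
  shows "commute_on (F ^^ n) G"
proof (induction n)
  case (Suc n)
  have "(F ^^ n) x \<in> space M" if "x \<in> space M" for x
    using that assms(1) by (induction n) auto
  then show ?case using Suc assms by (simp add: commute_on_def)
qed (simp add: commute_on_def)

lemma commute_on_aut_power:
  assumes F: "mp_automorphism M F" and G: "\<And>x. x \<in> space M \<Longrightarrow> G x \<in> space M" and c: "commute_on F G"
  shows "commute_on (aut_power M F k) G"
  unfolding aut_power_def
  using commute_on_funpow[OF mp_automorphism_space[OF F] c]
    commute_on_funpow[OF mp_automorphism_inv_space[OF F] commute_on_inv[OF F G c]] by simp

lemma commute_on_aut_power2:
  assumes F: "mp_automorphism M F" and G: "mp_automorphism M G" and c: "commute_on F G"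
  shows "commute_on (aut_power M F j) (aut_power M G k)"
proof (rule commute_on_aut_power[OF F aut_power_space[OF G]])
  show "commute_on F (aut_power M G k)"
    by (rule commute_on_sym[OF commute_on_aut_power[OF G mp_automorphism_space[OF F] commute_on_sym[OF c]]])
qed

lemma generate_commutative_group_commute:
  assumes gen: "generate_commutative_group M \<F>" and F: "mp_automorphism M F" "F \<in> \<F>"
    and G: "mp_automorphism M G" "G \<in> \<F>"
  shows "commute_on F G"
proof -
  let ?B = "BijGroup (space M)" and ?r = "\<lambda>R. restrict R (space M)"
  let ?H = "subgroup_generated ?B (?r ` \<F>)"
  interpret comm_group ?H using gen by (simp add: generate_commutative_group_def)
  have Bij: "?r K \<in> Bij (space M)" if "mp_automorphism M K" for K
    using that by (auto simp: Bij_def mp_automorphism_def cong: bij_betw_cong)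
  have carr: "?r K \<in> carrier ?H" if "mp_automorphism M K" "K \<in> \<F>" for K
    using that Bij[OF that(1)] by (auto simp: carrier_subgroup_generated BijGroup_def intro!: generate.incl)
  have mult: "?r K \<otimes>\<^bsub>?H\<^esub> ?r K' = compose (space M) (?r K) (?r K')"
    if "mp_automorphism M K" "mp_automorphism M K'" for K K'
    using Bij[OF that(1)] Bij[OF that(2)] by (simp add: BijGroup_def)
  have "compose (space M) (?r F) (?r G) = compose (space M) (?r G) (?r F)"
    using m_comm[OF carr[OF F] carr[OF G]] mult F G by simp
  then show ?thesis
    using mp_automorphism_space[OF F(1)] mp_automorphism_space[OF G(1)]
    by (auto simp: commute_on_def compose_def fun_eq_iff split: if_splits)
qed

text \<open>The composition of the powers \<open>F i\<close> to the exponent \<open>v i\<close> for \<open>i < n\<close>.\<close>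

primrec multi_power :: "(nat \<Rightarrow> 'a \<Rightarrow> 'a) \<Rightarrow> nat \<Rightarrow> (nat \<Rightarrow> int) \<Rightarrow> 'a \<Rightarrow> 'a" where
  "multi_power F 0 v x = x"
| "multi_power F (Suc n) v x = aut_power M (F n) (v n) (multi_power F n v x)"

lemma multi_power_space:
  assumes "\<And>i. i < n \<Longrightarrow> mp_automorphism M (F i)" "x \<in> space M"
  shows "multi_power F n v x \<in> space M"
  using assms by (induction n) (auto intro: aut_power_space)

lemma multi_power_commute:
  assumes F: "\<And>i. i < n \<Longrightarrow> mp_automorphism M (F i)" and G: "mp_automorphism M G"
    and c: "\<And>i. i < n \<Longrightarrow> commute_on (F i) G"
  shows "commute_on (multi_power F n v) (aut_power M G k)"
  using F c
proof (induction n)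
  case (Suc n)
  have Fn: "mp_automorphism M (F n)" using Suc.prems by simp
  have 1: "commute_on (multi_power F n v) (aut_power M G k)" using Suc by simp
  have 2: "commute_on (aut_power M (F n) (v n)) (aut_power M G k)"
    using Suc.prems by (intro commute_on_aut_power2 Fn G) simp
  show ?case
    unfolding commute_on_def
  proof
    fix x assume x: "x \<in> space M"
    have "multi_power F n v x \<in> space M" using Suc.prems x by (intro multi_power_space) auto
    then show "multi_power F (Suc n) v (aut_power M G k x) = aut_power M G k (multi_power F (Suc n) v x)"
      using 1 2 x by (simp add: commute_on_def)
  qed
qed (simp add: commute_on_def)

text \<open>Exponent vectors act through the commuting powers; only the coordinates below \<open>n\<close> matter.\<close>

lemma prob_action_multi_power:
  assumes M: "prob_space M" and F: "\<And>i. i < n \<Longrightarrow> mp_automorphism M (F i)"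
    and c: "\<And>i j. i < n \<Longrightarrow> j < n \<Longrightarrow> commute_on (F i) (F j)"
  shows "prob_action M (multi_power F n)"
proof -
  interpret prob_space M by (rule M)
  have add: "multi_power F n (v + w) x = multi_power F n v (multi_power F n w x)" if x: "x \<in> space M" for v w x
    using F c
  proof (induction n)
    case (Suc n)
    have Fn: "mp_automorphism M (F n)" using Suc.prems by simp
    have sp: "multi_power F n u x \<in> space M" if "x \<in> space M" for u x
      using Suc.prems that by (intro multi_power_space) auto
    have comm: "commute_on (multi_power F n v) (aut_power M (F n) (w n))"
      using Suc.prems by (intro multi_power_commute) auto
    have "multi_power F (Suc n) (v + w) x
        = aut_power M (F n) (v n) (aut_power M (F n) (w n) (multi_power F n v (multi_power F n w x)))"
    proof -
      have IH: "multi_power F n (v + w) x = multi_power F n v (multi_power F n w x)"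
        using Suc.prems by (intro Suc.IH) auto
      show ?thesis
        unfolding multi_power.simps plus_fun_apply IH by (intro aut_power_add[OF Fn] sp x)
    qed
    also have "aut_power M (F n) (w n) (multi_power F n v (multi_power F n w x))
        = multi_power F n v (aut_power M (F n) (w n) (multi_power F n w x))"
      using comm sp[OF x] by (simp add: commute_on_def)
    finally show ?case by simp
  qed simp
  have meas: "multi_power F n v \<in> measurable M M \<and> distr M M (multi_power F n v) = M" for v
    using F
  proof (induction n)
    case 0
    have "multi_power F 0 v = (\<lambda>x. x)" by (rule ext) simp
    then show ?case by simp
  next
    case (Suc n)
    have IH: "multi_power F n v \<in> measurable M M" "distr M M (multi_power F n v) = M" using Suc by auto
    have Fn: "mp_automorphism M (F n)" using Suc.prems by simp
    have eq: "multi_power F (Suc n) v = aut_power M (F n) (v n) \<circ> multi_power F n v" by (rule ext) simp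
    have d: "distr M M (multi_power F (Suc n) v) = distr (distr M M (multi_power F n v)) M (aut_power M (F n) (v n))"
      unfolding eq by (rule distr_distr[symmetric, OF aut_power_measurable[OF Fn] IH(1)])
    have "multi_power F (Suc n) v \<in> measurable M M"
      unfolding eq by (rule measurable_comp[OF IH(1) aut_power_measurable[OF Fn]])
    moreover have "distr M M (multi_power F (Suc n) v) = M"
      unfolding d IH(2) by (rule aut_power_distr[OF Fn])
    ultimately show ?case by blast
  qed
  have "multi_power F n 0 x = x" for x by (induction n) (simp_all add: aut_power_def)
  then show ?thesis by unfold_locales (use meas add in auto)
qed

text \<open>The exponent vector of the \<open>k\<close>-th power of the \<open>i\<close>-th generator.\<close>

definition unit_vec :: "nat \<Rightarrow> int \<Rightarrow> nat \<Rightarrow> int" where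
  "unit_vec i k = (\<lambda>j. if j = i then k else 0)"

lemma unit_vec_add: "unit_vec i (k + l) = unit_vec i k + unit_vec i l"
  by (auto simp: unit_vec_def)

lemma multi_power_unit_vec:
  "multi_power F n (unit_vec i k) x = (if i < n then aut_power M (F i) k x else x)"
  by (induction n) (auto simp: unit_vec_def aut_power_def less_Suc_eq)

end

lemma prob_action_aut_power:
  assumes "prob_space M" "mp_automorphism M F"
  shows "int_action M (aut_power M F)"
proof -
  interpret prob_space M by fact
  show ?thesis
    by unfold_locales
       (auto simp: aut_power_measurable aut_power_distr aut_power_add assms(2), simp add: aut_power_def)
qed

lemma weak_mixing_action_aut_power:
  assumes M: "prob_space M" and S: "weakly_mixing M S"
  shows "weak_mixing_action M (aut_power M S)"
proof -
  interpret prob_space M by fact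
  interpret int_action M "aut_power M S"
    using S by (intro prob_action_aut_power M) (simp add: weakly_mixing_def)
  show ?thesis
    by unfold_locales (use weakly_mixing_correlations_square[OF S] in \<open>simp add: aut_power_def\<close>)
qed

section \<open>Essentially bounded functions\<close>

text \<open>A representative that is bounded at every point, for an essentially bounded function.\<close>

definition truncation :: "'a measure \<Rightarrow> ('a \<Rightarrow> complex) \<Rightarrow> 'a \<Rightarrow> complex" where
  "truncation M f = (SOME f'. bdd_fun M f' \<and> (AE x in M. f x = f' x))"

lemma truncation:
  assumes "f \<in> L_infinity M"
  shows "bdd_fun M (truncation M f)" "AE x in M. f x = truncation M f x"
proof -
  obtain C where f[measurable]: "f \<in> borel_measurable M" and C: "AE x in M. cmod (f x) \<le> C"
    using assms by (auto simp: L_infinity_def)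
  define f' where "f' = (\<lambda>x. if cmod (f x) \<le> C then f x else 0)"
  have "bdd_by M (max C 0) f'" by (auto simp: bdd_by_def f'_def)
  moreover have "AE x in M. f x = f' x" using C by eventually_elim (simp add: f'_def)
  ultimately have "bdd_fun M f' \<and> (AE x in M. f x = f' x)" by (auto intro: bdd_funI)
  then have "bdd_fun M (truncation M f) \<and> (AE x in M. f x = truncation M f x)"
    unfolding truncation_def by (rule someI[of "\<lambda>f'. bdd_fun M f' \<and> (AE x in M. f x = f' x)"])
  then show "bdd_fun M (truncation M f)" "AE x in M. f x = truncation M f x" by auto
qed

lemma AE_aut_power:
  assumes "mp_automorphism M F" "AE x in M. P x"
  shows "AE x in M. P (aut_power M F k x)"
  using AE_distrD[OF aut_power_measurable[OF assms(1)]] aut_power_distr[OF assms(1)] assms(2) by metis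

lemma koopman_measurable:
  assumes "mp_automorphism M F" "f \<in> borel_measurable M"
  shows "koopman M F k f \<in> borel_measurable M"
  unfolding koopman_def by (rule measurable_compose[OF aut_power_measurable[OF assms(1)] assms(2)])

section \<open>Products of a singular sequence with commuting iterates\<close>

theorem theorem3p13:
  fixes M :: "'a measure"
    and L1 L2 :: nat
    and T S W :: "'a \<Rightarrow> 'a"
    and R :: "nat \<Rightarrow> 'a \<Rightarrow> 'a"
    and p :: "nat \<Rightarrow> rat poly"
    and f :: "'a \<Rightarrow> complex"
    and h g :: "nat \<Rightarrow> 'a \<Rightarrow> complex"
    and \<nu> :: "real measure"
  assumes "prob_space M"
    and "L2 \<ge> 1"
    and "mp_automorphism M T" and "mp_automorphism M S" and "mp_automorphism M W"
    and "\<forall>i\<in>{1..L1}. mp_automorphism M (R i)"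
    and "generate_commutative_group M (R ` {1..L1} \<union> {S, W})"
    and "weakly_mixing M S"
    and "\<forall>j\<in>{1..L2}. integer_polynomial (p j) \<and> degree (p j) \<ge> 2"
    and "\<forall>i\<in>{1..L2}. \<forall>j\<in>{1..L2}. i \<noteq> j \<longrightarrow> essentially_distinct (p i) (p j)"
    and "f \<in> L_infinity M"
    and "\<forall>i\<in>{1..L1}. h i \<in> L_infinity M"
    and "\<forall>j\<in>{1..L2}. g j \<in> L_infinity M"
    and "\<exists>j\<in>{1..L2}. (\<integral>x. g j x \<partial>M) = 0"
    and "is_spectral_measure M f T \<nu>"
    and "mutually_singular \<nu> lebesgue01"
  shows "tendsto_L_two M
    (\<lambda>N x. (1 / of_nat N) *
       (\<Sum>n=1..N. koopman M T (int n) f x *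
          (\<Prod>i=1..L1. koopman M (R i) (int n) (h i) x) *
          (\<Prod>j=1..L2. koopman M S (int_value (p j) n) (koopman M W (int n) (g j)) x)))
    (\<lambda>x. 0)"
proof -
  have M: "prob_space M" by (rule assms(1))
  interpret prob_space M by (rule M)
  have T: "mp_automorphism M T" and S: "mp_automorphism M S" and W: "mp_automorphism M W"
    and R: "\<And>i. i \<in> {1..L1} \<Longrightarrow> mp_automorphism M (R i)"
    using assms by auto
  \<comment> \<open>Generators number \<open>0\<close> and \<open>1\<close> are \<open>S\<close> and \<open>W\<close>; number \<open>i + 1\<close> is \<open>R i\<close> for \<open>i \<ge> 1\<close>.\<close>
  define gen where "gen = (\<lambda>i. if i = 0 then S else if i = 1 then W else R (i - 1))"
  define k0 where "k0 = L1 + 2"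
  have gen_mem: "mp_automorphism M (gen i) \<and> gen i \<in> R ` {1..L1} \<union> {S, W}" if "i < k0" for i
  proof (cases "i \<ge> 2")
    case True
    then have "i - 1 \<in> {1..L1}" using that by (auto simp: k0_def)
    then show ?thesis using True R[of "i - 1"] by (simp add: gen_def)
  next
    case False
    then have "i = 0 \<or> i = 1" by linarith
    then show ?thesis using S W by (auto simp: gen_def)
  qed
  have gen_commute: "commute_on M (gen i) (gen j)" if "i < k0" "j < k0" for i j
    using generate_commutative_group_commute[OF assms(7)] gen_mem that by blast
  define act where "act = multi_power M gen k0"
  define s :: "int \<Rightarrow> nat \<Rightarrow> int" where "s = unit_vec 0"
  define w :: "int \<Rightarrow> nat \<Rightarrow> int" where "w = unit_vec 1"
  define r :: "nat \<Rightarrow> int \<Rightarrow> nat \<Rightarrow> int" where "r = (\<lambda>i. unit_vec (i + 2))"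
  have act_s: "act (s k) x = aut_power M S k x" for k x
    by (simp add: act_def s_def multi_power_unit_vec gen_def k0_def)
  have act_w: "act (w k) x = aut_power M W k x" for k x
    by (simp add: act_def w_def multi_power_unit_vec gen_def k0_def)
  have act_r: "act (r i k) x = aut_power M (R (Suc i)) k x" if "i < L1" for i k x
    using that by (simp add: act_def r_def multi_power_unit_vec gen_def k0_def)
  interpret A: prob_action M act
    unfolding act_def using gen_mem gen_commute by (intro prob_action_multi_power M) auto
  have "(\<lambda>k. act (s k)) = aut_power M S" by (intro ext) (rule act_s)
  then interpret A: mixing_subaction M act s
    using weak_mixing_action_aut_power[OF M assms(8)] A.prob_action_axioms
    by (intro mixing_subaction.intro) simp_all
  interpret T: int_action M "aut_power M T" by (rule prob_action_aut_power[OF M T])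

  define Q where "Q = p ` {1..L2}"
  have inj: "inj_on p {1..L2}"
  proof (rule inj_onI, rule ccontr)
    fix i j assume ij: "i \<in> {1..L2}" "j \<in> {1..L2}" "p i = p j" "i \<noteq> j"
    then have "essentially_distinct (p i) (p j)" using assms(10) by blast
    moreover have "p i - p j = [:0:]" using ij(3) by simp
    ultimately show False unfolding essentially_distinct_def by blast
  qed
  define H where "H = (\<lambda>i. truncation M (h (Suc i)))"
  define G where "G = (\<lambda>q. truncation M (g (inv_into {1..L2} p q)))"
  define f' where "f' = truncation M f"
  have Gp: "G (p j) = truncation M (g j)" if "j \<in> {1..L2}" for j
    using that inj by (simp add: G_def)
  have f': "bdd_fun M f'" "AE x in M. f x = f' x"
    using truncation[OF assms(11)] by (simp_all add: f'_def)
  have H: "bdd_fun M (H i)" if "i < L1" for i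
  proof -
    have "h (Suc i) \<in> L_infinity M" using bspec[OF assms(12), of "Suc i"] that by simp
    then show ?thesis unfolding H_def by (rule truncation(1))
  qed
  have Q: "finite Q" "ess_distinct_family Q" "\<And>q. q \<in> Q \<Longrightarrow> integer_polynomial q \<and> degree q \<ge> 2"
  proof -
    show "finite Q" by (simp add: Q_def)
    show "integer_polynomial q \<and> degree q \<ge> 2" if "q \<in> Q" for q
      using that bspec[OF assms(9)] by (auto simp: Q_def)
    show "ess_distinct_family Q"
      unfolding ess_distinct_family_def
    proof (intro ballI impI, rule ccontr)
      fix q q' assume q: "q \<in> Q" "q' \<in> Q" "q \<noteq> q'" and deg: "\<not> degree (q - q') > 0"
      obtain i j where ij: "i \<in> {1..L2}" "j \<in> {1..L2}" "q = p i" "q' = p j"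
        using q(1,2) unfolding Q_def by blast
      then have "essentially_distinct q q'" using bspec[OF bspec[OF assms(10) ij(1)] ij(2)] q(3) by auto
      moreover obtain c where "q - q' = [:c:]" using deg degree_eq_zeroE by blast
      ultimately show False unfolding essentially_distinct_def by blast
    qed
  qed
  have G: "bdd_fun M (G q)" if q: "q \<in> Q" for q
  proof -
    obtain j where j: "j \<in> {1..L2}" "q = p j" using q unfolding Q_def by blast
    then show ?thesis using truncation(1)[OF bspec[OF assms(13) j(1)]] by (simp add: Gp)
  qed
  obtain j0 where j0: "j0 \<in> {1..L2}" "(\<integral>x. g j0 x \<partial>M) = 0" using assms(14) by blast
  have meas_g: "g j \<in> borel_measurable M" if "j \<in> {1..L2}" for j
    using bspec[OF assms(13) that] by (simp add: L_infinity_def)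
  have meas_h: "h i \<in> borel_measurable M" if "i \<in> {1..L1}" for i
    using bspec[OF assms(12) that] by (simp add: L_infinity_def)
  have meas_f: "f \<in> borel_measurable M" using assms(11) by (auto simp: L_infinity_def)
  have "(\<integral>x. G (p j0) x \<partial>M) = (\<integral>x. g j0 x \<partial>M)"
  proof (rule integral_cong_AE)
    show "AE x in M. G (p j0) x = g j0 x"
      using truncation(2)[OF bspec[OF assms(13) j0(1)]] by eventually_elim (simp add: Gp[OF j0(1)])
    show "G (p j0) \<in> borel_measurable M"
      using j0(1) by (intro bdd_fun_measurable G) (simp add: Q_def)
  qed (rule meas_g[OF j0(1)])
  then have q0: "p j0 \<in> Q" "(\<integral>x. G (p j0) x \<partial>M) = 0" using j0 by (auto simp: Q_def)

  define u where "u = A.mixed_prod L1 r H w Q G"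
  have "\<exists>E. finite E \<and> (\<forall>k. k \<notin> E \<longrightarrow> correl_le u k 0)"
    unfolding u_def
    by (rule A.mixed_prod_correl_tendsto[where ?q0.0="p j0"])
       (simp_all add: r_def w_def unit_vec_add H Q G q0 A.mixed_null)
  then obtain E where E: "finite E" "\<And>k. k \<notin> E \<Longrightarrow> correl_le u k 0" by blast
  obtain C where u: "seq_bdd C u"
    unfolding u_def by (rule A.mixed_prod_seq_bdd[of Q L1 H G r w]) (simp_all add: Q H G)

  have \<nu>: "finite_measure \<nu>" "sets \<nu> = sets lebesgue01"
    using assms(15) by (auto simp: is_spectral_measure_def)
  have spec: "fourier_coeff \<nu> k = (\<integral>x. f' (aut_power M T k x) * cnj (f' x) \<partial>M)" for k
  proof -
    have "fourier_coeff \<nu> k = (\<integral>x. f (aut_power M T k x) * cnj (f x) \<partial>M)"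
      using assms(15) by (simp add: is_spectral_measure_def L_two_inner_def koopman_def)
    also have "\<dots> = (\<integral>x. f' (aut_power M T k x) * cnj (f' x) \<partial>M)"
    proof (rule integral_cong_AE)
      show "AE x in M. f (aut_power M T k x) * cnj (f x) = f' (aut_power M T k x) * cnj (f' x)"
        using f'(2) AE_aut_power[OF T f'(2), of k] by eventually_elim simp
      show "(\<lambda>x. f (aut_power M T k x) * cnj (f x)) \<in> borel_measurable M"
        using koopman_measurable[OF T meas_f, of k] meas_f by (simp add: koopman_def)
      show "(\<lambda>x. f' (aut_power M T k x) * cnj (f' x)) \<in> borel_measurable M"
        using koopman_measurable[OF T bdd_fun_measurable[OF f'(1)], of k] bdd_fun_measurable[OF f'(1)]
        by (simp add: koopman_def)
    qed
    finally show ?thesis .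
  qed
  have null: "L2_null (\<lambda>N x. cesaro N (\<lambda>n. f' (aut_power M T n x) * u n x))"
    by (rule T.singular_spectrum_L2_null[OF f'(1) \<nu> assms(16) spec u E])

  define a where "a = (\<lambda>n x. koopman M T (int n) f x *
          (\<Prod>i=1..L1. koopman M (R i) (int n) (h i) x) *
          (\<Prod>j=1..L2. koopman M S (int_value (p j) n) (koopman M W (int n) (g j)) x))"
  define F where "F = (\<lambda>N x. (1 / of_nat N) * (\<Sum>n=1..N. a n x))"
  have AE_n: "AE x in M. \<forall>n::nat. a n x
      = f' (aut_power M T (int n) x) * u (int n) x"
    unfolding AE_all_countable
  proof
    fix n :: nat
    have 1: "AE x in M. f (aut_power M T (int n) x) = f' (aut_power M T (int n) x)"
      by (rule AE_aut_power[OF T f'(2)])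
    have 2: "AE x in M. \<forall>i\<in>{1..L1}. h i (aut_power M (R i) (int n) x) = truncation M (h i) (aut_power M (R i) (int n) x)"
    proof (intro AE_finite_allI)
      fix i assume i: "i \<in> {1..L1}"
      then have "AE x in M. h i x = truncation M (h i) x" using assms(12) by (intro truncation(2)) blast
      from AE_aut_power[OF R[OF i] this]
      show "AE x in M. h i (aut_power M (R i) (int n) x) = truncation M (h i) (aut_power M (R i) (int n) x)" .
    qed simp
    have 3: "AE x in M. \<forall>j\<in>{1..L2}. g j (aut_power M W (int n) (aut_power M S (int_value (p j) n) x))
        = truncation M (g j) (aut_power M W (int n) (aut_power M S (int_value (p j) n) x))"
    proof (intro AE_finite_allI)
      fix j assume "j \<in> {1..L2}"
      then have "AE x in M. g j x = truncation M (g j) x" using assms(13) by (intro truncation(2)) blast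
      from AE_aut_power[OF S AE_aut_power[OF W this]]
      show "AE x in M. g j (aut_power M W (int n) (aut_power M S (int_value (p j) n) x))
        = truncation M (g j) (aut_power M W (int n) (aut_power M S (int_value (p j) n) x))" .
    qed simp
    from 1 2 3 AE_space
    show "AE x in M. a n x
      = f' (aut_power M T (int n) x) * u (int n) x"
    proof eventually_elim
      case (elim x)
      have "(\<Prod>i=1..L1. koopman M (R i) (int n) (h i) x)
          = (\<Prod>i=1..L1. truncation M (h i) (aut_power M (R i) (int n) x))"
        using elim(2) by (intro prod.cong refl) (simp add: koopman_def)
      also have "\<dots> = (\<Prod>i<L1. H i (act (r i (int n)) x))"
        by (simp add: prod.atLeast1_atMost_eq H_def act_r)
      finally have lin: "(\<Prod>i=1..L1. koopman M (R i) (int n) (h i) x) = (\<Prod>i<L1. H i (act (r i (int n)) x))" .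
      have "act (s k) (act (w (int n)) x) = aut_power M W (int n) (aut_power M S k x)" for k
        using A.act_add[OF elim(4), of "s k" "w (int n)"] A.act_add[OF elim(4), of "w (int n)" "s k"]
        by (simp only: add.commute[of "s k"] act_w act_s)
      then have "A.S.poly_prod Q G (int n) (act (w (int n)) x)
          = (\<Prod>q\<in>Q. G q (aut_power M W (int n) (aut_power M S (ival q (int n)) x)))"
        by (simp add: A.S.poly_prod_def)
      also have "\<dots> = (\<Prod>j=1..L2. G (p j) (aut_power M W (int n) (aut_power M S (ival (p j) (int n)) x)))"
        unfolding Q_def by (subst prod.reindex[OF inj]) simp
      also have "\<dots> = (\<Prod>j=1..L2. koopman M S (int_value (p j) n) (koopman M W (int n) (g j)) x)"
        using elim(3) by (intro prod.cong refl) (simp add: Gp koopman_def ival_def int_value_def)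
      finally show ?case
        using elim(1) lin by (simp add: a_def u_def A.mixed_prod_def koopman_def mult.assoc)
    qed
  qed
  have AE_F: "AE x in M. F N x = cesaro N (\<lambda>n. f' (aut_power M T n x) * u n x)" for N
    using AE_n by eventually_elim (simp add: F_def cesaro_def)
  have F_meas: "F N \<in> borel_measurable M" for N
    unfolding F_def a_def
    by (intro borel_measurable_times borel_measurable_const borel_measurable_sum borel_measurable_prod
        koopman_measurable T S W R meas_f meas_g meas_h) auto
  obtain B where B: "bdd_by M B f'" using f'(1) by (auto simp: bdd_fun_def)
  have b: "bdd_by M (B * C) (\<lambda>x. cesaro N (\<lambda>n. f' (aut_power M T n x) * u n x))" for N
    by (intro bdd_by_cesaro bdd_by_mult T.bdd_by_act[OF B] seq_bddD[OF u])
  have sq: "AE x in M. (cmod (F N x))\<^sup>2 = (cmod (cesaro N (\<lambda>n. f' (aut_power M T n x) * u n x)))\<^sup>2" for N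
    using AE_F[of N] by eventually_elim simp
  have sq_meas: "(\<lambda>x. (cmod (F N x))\<^sup>2) \<in> borel_measurable M" for N
    using F_meas[of N] by simp
  have c_meas: "(\<lambda>x. (cmod (cesaro N (\<lambda>n. f' (aut_power M T n x) * u n x)))\<^sup>2) \<in> borel_measurable M" for N
    using bdd_by_measurable[OF b[of N]] by simp
  have "F N \<in> L_two M" for N
    using F_meas integrable_cong_AE[OF sq_meas c_meas sq, of N] integrable_bdd_by_square[OF b[of N]]
    by (simp add: L_two_def)
  moreover have "(\<lambda>x. 0) \<in> L_two M" by (simp add: L_two_def)
  moreover have "(\<lambda>N. L_two_norm M (\<lambda>x. F N x - 0)) \<longlonglongrightarrow> 0"
  proof -
    have "(\<integral>x. (cmod (F N x))\<^sup>2 \<partial>M)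
        = (\<integral>x. (cmod (cesaro N (\<lambda>n. f' (aut_power M T n x) * u n x)))\<^sup>2 \<partial>M)" for N
      by (rule integral_cong_AE[OF sq_meas c_meas sq])
    then have "(\<lambda>N. \<integral>x. (cmod (F N x))\<^sup>2 \<partial>M) \<longlonglongrightarrow> 0"
      using null by (simp add: L2_null_def)
    from tendsto_real_sqrt[OF this] show ?thesis by (simp add: L_two_norm_def)
  qed
  ultimately show ?thesis
    unfolding tendsto_L_two_def F_def a_def by blast
qed

end
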